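(* Assume that $f:\mathbb{R}^d\to\mathbb{R}$ is $\ell$-gradient Lipschitz and $\rho$-Hessian Lipschitz. Then there exists $c_{\max}>0$ such that for any $\delta>0$, $\epsilon\le \ell^2/\rho$, $\Delta_f\ge f(\pmb{x}_0)-f^\star$, and $c\le c_{\max}$, the algorithm PGDOT$(\pmb{x}_0,\ell,\rho,\epsilon,c,\delta,\Delta_f)$ outputs an $\epsilon$-second-order stationary point of $f$ with probability $1-\delta$, terminating within the following number of iterations: $$O\left(\frac{\ell\,(f(\pmb{x}_0)-f^\star)}{\epsilon^2}\,\log^4\left(\frac{d\,\ell\,\Delta_f}{\epsilon^2\delta}\right)\right).$$
   Context: Notation. $\|\cdot\|$ is the Euclidean norm of a vector and the spectral norm of a matrix; $\lambda_{\min}(A)$ is the minimum eigenvalue of a square matrix $A$; $f^\star:=\min_{\pmb{x}\in\mathbb{R}^d} f(\pmb{x})$; $\#S$ is the number of elements of a finite set $S$; $\mathrm{Unif}(0,1)$ is the uniform distribution on $[0,1]$ (in the algorithm, a sample from it); $\pmb{x}=(x^1,\ldots,x^d)$. The symbol $O(\cdot)$ hides only absolute constants which do not depend on any problem parameter. Definitions. A differentiable $f$ is $\ell$-gradient Lipschitz if $\|\nabla f(\pmb{x}_1)-\nabla f(\pmb{x}_2)\|\le \ell\|\pmb{x}_1-\pmb{x}_2\|$ for all $\pmb{x}_1,\pmb{x}_2\in\mathbb{R}^d$. A twice differentiable $f$ is $\rho$-Hessian Lipschitz if $\|\nabla^2 f(\pmb{x}_1)-\nabla^2 f(\pmb{x}_2)\|\le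 \rho\|\pmb{x}_1-\pmb{x}_2\|$ for all $\pmb{x}_1,\pmb{x}_2\in\mathbb{R}^d$. For such $f$, a point $\pmb{x}$ is an $\epsilon$-second-order stationary point if $\|\nabla f(\pmb{x})\|\le\epsilon$ and $\lambda_{\min}(\nabla^2 f(\pmb{x}))\ge-\sqrt{\rho\epsilon}$. Algorithm PGDOT$(\pmb{x}_0,\ell,\rho,\epsilon,c,\delta,\Delta_f)$ (perturbed gradient descent adapted to occupation time), started at $\pmb{x}_0$. Here $w:\{0,1,\ldots\}\to(0,\infty)$ is an increasing weight function on the nonnegative integers. Set $$\chi=3\max\left\{\log\left(\tfrac{d\ell\Delta_f}{c\epsilon^2\delta}\right),4\right\},\quad \eta=\tfrac{c}{\ell},\quad r=\tfrac{\epsilon\sqrt c}{\chi^2\ell},\quad g_{\mathrm{thres}}=\tfrac{\epsilon\sqrt c}{\chi^2},\quad f_{\mathrm{thres}}=\tfrac{c}{\chi^3}\sqrt{\tfrac{\epsilon^3}{\rho}},\quad t_{\mathrm{thres}}=\tfrac{\chi\ell}{c^2\sqrt{\rho\epsilon}},$$ and $t_{\mathrm{noise}}=-t_{\mathrm{thres}}-1$. For $t=0,1,\ldots$ do the following. 1. If $\|\nabla f(\pmb{x}_t)\|\le g_{\mathrm{thres}}$ and $t-t_{\mathrm{noise}}>t_{\mathrm{thres}}$: set $\widetilde{\pmb{x}}_t\leftarrow\pmb{x}_t$, $t_{\mathrm{noise}}\leftarrow t$, and for each coordinate $i=1,\ldots,d$ compute $L^i_t=\#\{s<t: x^i_s\le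 x^i_t\}$ and $R^i_t=\#\{s<t: x^i_s>x^i_t\}$, and replace $x^i_t$ by $\widetilde x^i_t-\frac{r}{\sqrt d}\mathrm{Unif}(0,1)$ with probability $p$ and by $\widetilde x^i_t+\frac{r}{\sqrt d}\mathrm{Unif}(0,1)$ with probability $1-p$, where $p=\frac{w(R^i_t)}{w(L^i_t)+w(R^i_t)}$. 2. If $t-t_{\mathrm{noise}}=t_{\mathrm{thres}}$ and $f(\pmb{x}_t)-f(\widetilde{\pmb{x}}_{t_{\mathrm{noise}}})>-f_{\mathrm{thres}}$: return $\widetilde{\pmb{x}}_{t_{\mathrm{noise}}}$ (and stop). 3. Set $\pmb{x}_{t+1}\leftarrow\pmb{x}_t-\eta\nabla f(\pmb{x}_t)$.
   Formalization: The number of iterations is bounded by a constant times the maximum of the stated bound and t_thres (the stated bound is 0 when f(x_0)=f*, yet a run takes more than t_thres iterations); the constant in O may depend on c; t_thres is rounded up to an integer so that the stopping test can hold. *)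

theory Defs
  imports "HOL-Probability.Probability" "Jordan_Normal_Form.Char_Poly"
begin

text \<open>
  The constants in the complexity bound must not depend on the dimension, so \<open>d\<close> has to be
  quantified inside the theorem. Hence \<open>\<real>\<^sup>d\<close> is the explicit carrier \<open>carrier_vec d\<close> of
  \<^typ>\<open>real vec\<close> and not a type \<open>real ^ 'n\<close>. This type has no topology
  in the library, so Frechet derivatives are spelled out below; functions on \<open>\<real>\<^sup>d\<close> are only
  ever evaluated on \<open>carrier_vec d\<close>.
\<close>

hide_type (open) Finite_Cartesian_Product.vec
hide_const (open) Finite_Cartesian_Product.vec Finite_Cartesian_Product.vec_nth
  Determinants.det Finite_Cartesian_Product.mat Finite_Cartesian_Product.transpose
unbundle no vec_syntax
unbundle no inner_syntax


subsection \<open>Smoothness and stationarity on \<open>\<real>\<^sup>d\<close>\<close>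

definition vnorm :: "real vec \<Rightarrow> real" where
  "vnorm v = sqrt (v \<bullet> v)"

definition spectral_norm :: "real mat \<Rightarrow> real" where
  "spectral_norm A = (SUP v \<in> {v \<in> carrier_vec (dim_col A). vnorm v \<le> 1}. vnorm (A *\<^sub>v v))"

definition lambda_min :: "real mat \<Rightarrow> real" where
  "lambda_min A = Min {k. eigenvalue A k}"

definition has_gradient :: "nat \<Rightarrow> (real vec \<Rightarrow> real) \<Rightarrow> real vec \<Rightarrow> real vec \<Rightarrow> bool" where
  "has_gradient d f x g \<longleftrightarrow> g \<in> carrier_vec d \<and>
     (\<forall>e>0. \<exists>s>0. \<forall>h\<in>carrier_vec d. vnorm h < s \<longrightarrow>
        \<bar>f (x + h) - f x - g \<bullet> h\<bar> \<le> e * vnorm h)"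

definition grad :: "nat \<Rightarrow> (real vec \<Rightarrow> real) \<Rightarrow> real vec \<Rightarrow> real vec" where
  "grad d f x = (THE g. has_gradient d f x g)"

definition differentiable_Rd :: "nat \<Rightarrow> (real vec \<Rightarrow> real) \<Rightarrow> bool" where
  "differentiable_Rd d f \<longleftrightarrow> (\<forall>x\<in>carrier_vec d. \<exists>g. has_gradient d f x g)"

text \<open>The Hessian is the Jacobian matrix of the gradient map.\<close>

definition has_hessian :: "nat \<Rightarrow> (real vec \<Rightarrow> real) \<Rightarrow> real vec \<Rightarrow> real mat \<Rightarrow> bool" where
  "has_hessian d f x H \<longleftrightarrow> H \<in> carrier_mat d d \<and>
     (\<forall>e>0. \<exists>s>0. \<forall>h\<in>carrier_vec d. vnorm h < s \<longrightarrow>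
        vnorm (grad d f (x + h) - grad d f x - H *\<^sub>v h) \<le> e * vnorm h)"

definition hessian :: "nat \<Rightarrow> (real vec \<Rightarrow> real) \<Rightarrow> real vec \<Rightarrow> real mat" where
  "hessian d f x = (THE H. has_hessian d f x H)"

definition twice_differentiable_Rd :: "nat \<Rightarrow> (real vec \<Rightarrow> real) \<Rightarrow> bool" where
  "twice_differentiable_Rd d f \<longleftrightarrow>
     differentiable_Rd d f \<and> (\<forall>x\<in>carrier_vec d. \<exists>H. has_hessian d f x H)"

definition gradient_Lipschitz :: "nat \<Rightarrow> real \<Rightarrow> (real vec \<Rightarrow> real) \<Rightarrow> bool" where
  "gradient_Lipschitz d l f \<longleftrightarrow> differentiable_Rd d f \<and>
     (\<forall>x1\<in>carrier_vec d. \<forall>x2\<in>carrier_vec d.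
        vnorm (grad d f x1 - grad d f x2) \<le> l * vnorm (x1 - x2))"

definition hessian_Lipschitz :: "nat \<Rightarrow> real \<Rightarrow> (real vec \<Rightarrow> real) \<Rightarrow> bool" where
  "hessian_Lipschitz d \<rho> f \<longleftrightarrow> twice_differentiable_Rd d f \<and>
     (\<forall>x1\<in>carrier_vec d. \<forall>x2\<in>carrier_vec d.
        spectral_norm (hessian d f x1 - hessian d f x2) \<le> \<rho> * vnorm (x1 - x2))"

definition second_order_stationary ::
    "nat \<Rightarrow> (real vec \<Rightarrow> real) \<Rightarrow> real \<Rightarrow> real \<Rightarrow> real vec \<Rightarrow> bool" where
  "second_order_stationary d f \<rho> \<epsilon> x \<longleftrightarrow> x \<in> carrier_vec d \<and>
     vnorm (grad d f x) \<le> \<epsilon> \<and> lambda_min (hessian d f x) \<ge> - sqrt (\<rho> * \<epsilon>)"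

definition has_minimum :: "nat \<Rightarrow> (real vec \<Rightarrow> real) \<Rightarrow> bool" where
  "has_minimum d f \<longleftrightarrow> (\<exists>z\<in>carrier_vec d. \<forall>x\<in>carrier_vec d. f z \<le> f x)"

definition fstar :: "nat \<Rightarrow> (real vec \<Rightarrow> real) \<Rightarrow> real" where
  "fstar d f = (INF x \<in> carrier_vec d. f x)"


subsection \<open>Parameters of PGDOT\<close>

text \<open>
  For \<open>\<Delta>f = 0\<close> the logarithm is \<open>-\<infinity>\<close> on paper and \<^term>\<open>ln 0 = (0::real)\<close> here;
  the maximum is 4 in both readings.
\<close>

definition chi :: "nat \<Rightarrow> real \<Rightarrow> real \<Rightarrow> real \<Rightarrow> real \<Rightarrow> real \<Rightarrow> real" where
  "chi d l \<epsilon> c \<delta> \<Delta>f = 3 * max (ln (real d * l * \<Delta>f / (c * \<epsilon>\<^sup>2 * \<delta>))) 4"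

definition g_thres :: "nat \<Rightarrow> real \<Rightarrow> real \<Rightarrow> real \<Rightarrow> real \<Rightarrow> real \<Rightarrow> real" where
  "g_thres d l \<epsilon> c \<delta> \<Delta>f = \<epsilon> * sqrt c / (chi d l \<epsilon> c \<delta> \<Delta>f)\<^sup>2"

definition radius :: "nat \<Rightarrow> real \<Rightarrow> real \<Rightarrow> real \<Rightarrow> real \<Rightarrow> real \<Rightarrow> real" where
  "radius d l \<epsilon> c \<delta> \<Delta>f = \<epsilon> * sqrt c / ((chi d l \<epsilon> c \<delta> \<Delta>f)\<^sup>2 * l)"

definition f_thres :: "nat \<Rightarrow> real \<Rightarrow> real \<Rightarrow> real \<Rightarrow> real \<Rightarrow> real \<Rightarrow> real \<Rightarrow> real" where
  "f_thres d l \<rho> \<epsilon> c \<delta> \<Delta>f = c / (chi d l \<epsilon> c \<delta> \<Delta>f) ^ 3 * sqrt (\<epsilon> ^ 3 / \<rho>)"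

text \<open>
  The stopping test compares an integer with \<open>t_thres\<close> for equality, so \<open>t_thres\<close> is rounded
  up to an integer; with the unrounded number the algorithm would in general never stop.
\<close>

definition t_thres :: "nat \<Rightarrow> real \<Rightarrow> real \<Rightarrow> real \<Rightarrow> real \<Rightarrow> real \<Rightarrow> real \<Rightarrow> int" where
  "t_thres d l \<rho> \<epsilon> c \<delta> \<Delta>f = \<lceil>chi d l \<epsilon> c \<delta> \<Delta>f * l / (c\<^sup>2 * sqrt (\<rho> * \<epsilon>))\<rceil>"


subsection \<open>The algorithm\<close>

text \<open>
  At every time \<open>t\<close> and coordinate \<open>i\<close> there are two independent uniform variables: \<open>Sign\<close>
  decides which of the two replacements is made (\<open>Sign < p\<close> has probability \<open>p\<close>), and
  \<open>Size\<close> is the sample from \<open>Unif(0,1)\<close>.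
\<close>

datatype noise_kind = Sign | Size

type_synonym noise = "nat \<times> nat \<times> noise_kind \<Rightarrow> real"

definition noise_space :: "noise measure" where
  "noise_space = (\<Pi>\<^sub>M j \<in> UNIV. uniform_measure lborel {0..1})"

text \<open>
  \<open>xs = [x\<^sub>0, \<dots>, x\<^sub>t\<^sub>-\<^sub>1]\<close> holds the earlier iterates (after a possible perturbation),
  \<open>x\<close> is the current iterate before perturbation.
\<close>

definition perturb ::
    "nat \<Rightarrow> (nat \<Rightarrow> real) \<Rightarrow> real \<Rightarrow> noise \<Rightarrow> real vec list \<Rightarrow> real vec \<Rightarrow> real vec" where
  "perturb d w r \<omega> xs x = vec d (\<lambda>i.
     let t = length xs;
         L = card {s. s < t \<and> (xs ! s) $ i \<le> x $ i};
         R = card {s. s < t \<and> (xs ! s) $ i > x $ i};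
         p = w R / (w L + w R);
         u = \<omega> (t, i, Size)
     in if \<omega> (t, i, Sign) < p then x $ i - r / sqrt (real d) * u
        else x $ i + r / sqrt (real d) * u)"

text \<open>
  \<open>Running xs x t\<^sub>n\<^sub>o\<^sub>i\<^sub>s\<^sub>e y\<close> is the state at the start of pass \<open>t = length xs\<close> of the loop, with
  \<open>y\<close> the last point at which noise was added. \<open>Returned n y\<close>: the algorithm has
  returned \<open>y\<close> in its \<open>n\<close>-th pass (the pass \<open>t = n - 1\<close>).
\<close>

datatype pgdot_state =
    Running "real vec list" "real vec" int "real vec"
  | Returned nat "real vec"

fun pgdot_step ::
    "nat \<Rightarrow> (real vec \<Rightarrow> real) \<Rightarrow> (nat \<Rightarrow> real) \<Rightarrow> real \<Rightarrow> real \<Rightarrow> real \<Rightarrow> real \<Rightarrow> real \<Rightarrow> real \<Rightarrow>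
     noise \<Rightarrow> pgdot_state \<Rightarrow> pgdot_state" where
  "pgdot_step d f w l \<rho> \<epsilon> c \<delta> \<Delta>f \<omega> (Returned n y) = Returned n y"
| "pgdot_step d f w l \<rho> \<epsilon> c \<delta> \<Delta>f \<omega> (Running xs x tn y) =
     (let t = int (length xs);
          T = t_thres d l \<rho> \<epsilon> c \<delta> \<Delta>f;
          noisy = (vnorm (grad d f x) \<le> g_thres d l \<epsilon> c \<delta> \<Delta>f \<and> t - tn > T);
          y' = (if noisy then x else y);
          tn' = (if noisy then t else tn);
          x' = (if noisy then perturb d w (radius d l \<epsilon> c \<delta> \<Delta>f) \<omega> xs x else x)
      in if t - tn' = T \<and> f x' - f y' > - f_thres d l \<rho> \<epsilon> c \<delta> \<Delta>f
         then Returned (length xs + 1) y'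
         else Running (xs @ [x']) (x' - (c / l) \<cdot>\<^sub>v grad d f x') tn' y')"

text \<open>
  The last component of the initial state is a dummy: it is not used before noise has been added.
\<close>

definition pgdot_run ::
    "nat \<Rightarrow> (real vec \<Rightarrow> real) \<Rightarrow> (nat \<Rightarrow> real) \<Rightarrow> real vec \<Rightarrow> real \<Rightarrow> real \<Rightarrow> real \<Rightarrow> real \<Rightarrow> real \<Rightarrow> real \<Rightarrow>
     noise \<Rightarrow> nat \<Rightarrow> pgdot_state" where
  "pgdot_run d f w x0 l \<rho> \<epsilon> c \<delta> \<Delta>f \<omega> n =
     (pgdot_step d f w l \<rho> \<epsilon> c \<delta> \<Delta>f \<omega> ^^ n)
       (Running [] x0 (- t_thres d l \<rho> \<epsilon> c \<delta> \<Delta>f - 1) x0)"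

definition pgdot_returns ::
    "nat \<Rightarrow> (real vec \<Rightarrow> real) \<Rightarrow> (nat \<Rightarrow> real) \<Rightarrow> real vec \<Rightarrow> real \<Rightarrow> real \<Rightarrow> real \<Rightarrow> real \<Rightarrow> real \<Rightarrow> real \<Rightarrow>
     noise \<Rightarrow> nat \<Rightarrow> real vec \<Rightarrow> bool" where
  "pgdot_returns d f w x0 l \<rho> \<epsilon> c \<delta> \<Delta>f \<omega> n y \<longleftrightarrow>
     pgdot_run d f w x0 l \<rho> \<epsilon> c \<delta> \<Delta>f \<omega> n = Returned n y"

text \<open>
  This quantity is 0 if \<open>x0\<close> is a minimizer (or if the logarithm vanishes), whereas a run that
  returns always takes more than \<open>t_thres\<close> passes. An \<open>O\<close>-bound valid for all parameters can
  therefore only be a multiple of \<open>max iteration_bound t_thres\<close>; this is the same as a multiple of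
  \<open>iteration_bound\<close> whenever the latter is not below the length of a single perturbation epoch.
\<close>

definition iteration_bound ::
    "nat \<Rightarrow> (real vec \<Rightarrow> real) \<Rightarrow> real vec \<Rightarrow> real \<Rightarrow> real \<Rightarrow> real \<Rightarrow> real \<Rightarrow> real" where
  "iteration_bound d f x0 l \<epsilon> \<delta> \<Delta>f =
     l * (f x0 - fstar d f) / \<epsilon>\<^sup>2 * (ln (real d * l * \<Delta>f / (\<epsilon>\<^sup>2 * \<delta>))) ^ 4"

end

theory Submission
  imports Defs
begin

text \<open>
  Every pass outside a perturbation epoch, and every epoch that does not return, lowers \<open>f\<close> by at
  least a fixed amount per pass, so the run ends surely within the stated time; only the
  quality of the returned point is random. A point is returned wrongly only if an epoch started
  at a strict saddle gets stuck. Two stuck runs whose starting points differ by a multiple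
  of the eigenvector of the most negative eigenvalue both stay near the saddle, while their
  difference grows like \<open>(1 + \<eta> \<gamma>) ^ t\<close>; so stuck starting points form a set that is exponentially thin
  in that direction. Given the past and the signs, the perturbation is uniform on a cube, whatever
  the occupation times are, and a thin subset of a cube has small volume. Finally, a saddle at which an epoch
  starts forces \<open>f(x\<^sub>0) - f\<^sup>*\<close> to exceed the threshold, so the expected number of stuck
  epochs is at most \<open>\<delta>\<close>.
\<close>

section \<open>Gradient descent in an inner product space\<close>

text \<open>The law of a perturbation depends on the whole past through the occupation times, so
  there is no fixed perturbation law to integrate against. The dependence sits in the signs only;
  fixing them leaves a cube with a corner at the base point, and the volume estimate is uniform over
  all corners. Two time scales make the constants fit. With \<gamma> = sqrt(\<rho>\<epsilon>), the
  coupled runs are followed only for about 6\<chi>l/(c\<gamma>) steps, roughly a fraction 6c of an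
  epoch. This already yields growth exp(3\<chi>), while the accumulated linearization error stays
  below its allowance as soon as 288 sqrt(c) is at most 1; the bound c \<le> 1/100000 comes from
  there. The exponent 3\<chi> is then spent as follows: exp(\<chi>/3) pays for the quotient inside
  the logarithm that defines \<chi>, exp(\<chi>) pays for a factor \<chi>^4, and what remains, with
  \<chi> \<ge> 12, pays for all numerical constants.\<close>

locale smooth_function =
  fixes f :: "'a::real_inner \<Rightarrow> real" and g :: "'a \<Rightarrow> 'a" and H :: "'a \<Rightarrow> 'a \<Rightarrow> 'a" and l \<rho> :: real
  assumes f_deriv: "\<And>x. (f has_derivative (\<lambda>h. inner (g x) h)) (at x)"
    and g_deriv: "\<And>x. (g has_derivative H x) (at x)"
    and g_lip: "\<And>x y. norm (g x - g y) \<le> l * norm (x - y)"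
    and H_lip: "\<And>x y h. norm (H x h - H y h) \<le> \<rho> * norm (x - y) * norm h"
    and l_pos: "0 < l" and \<rho>_pos: "0 < \<rho>"
begin

section \<open>Symmetry and norm of the Hessian form\<close>

lemma bounded_linear_H: "bounded_linear (H x)"
  using g_deriv by (rule has_derivative_bounded_linear)

lemma linear_H: "linear (H x)"
  using bounded_linear_H by (rule bounded_linear.linear)

lemma f_line_deriv:
  "((\<lambda>s. f (x + s *\<^sub>R h)) has_real_derivative inner (g (x + s *\<^sub>R h)) h) (at s)"
proof -
  have "((\<lambda>s. x + s *\<^sub>R h) has_derivative (\<lambda>t. t *\<^sub>R h)) (at s)"
    by (auto intro!: derivative_eq_intros)
  from has_derivative_compose[OF this f_deriv[of "x + s *\<^sub>R h"]]
  show ?thesis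
    by (auto intro!: has_derivative_imp_has_field_derivative)
qed

lemma g_line_deriv:
  "((\<lambda>s. inner (g (x + s *\<^sub>R h)) k) has_real_derivative inner (H (x + s *\<^sub>R h) h) k) (at s)"
proof -
  have "((\<lambda>s. x + s *\<^sub>R h) has_derivative (\<lambda>t. t *\<^sub>R h)) (at s)"
    by (auto intro!: derivative_eq_intros)
  from has_derivative_compose[OF this g_deriv[of "x + s *\<^sub>R h"]]
  have "((\<lambda>s. g (x + s *\<^sub>R h)) has_derivative (\<lambda>t. t *\<^sub>R H (x + s *\<^sub>R h) h)) (at s)"
    by (simp add: linear_cmul[OF linear_H])
  from has_derivative_inner_left[OF this, of k]
  show ?thesis
    by (auto intro!: has_derivative_imp_has_field_derivative)
qed

text \<open>Both orders of differentiation are limits of the same second difference quotient.\<close>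

lemma second_difference:
  assumes e: "e > 0" and s: "s > 0"
    and approx: "\<And>y. norm y \<le> s * (norm h + norm k) \<Longrightarrow> norm (g (x + y) - g x - H x y) \<le> e * norm y"
  shows "\<bar>(f (x + s *\<^sub>R h + s *\<^sub>R k) - f (x + s *\<^sub>R h) - f (x + s *\<^sub>R k) + f x)
            - s\<^sup>2 * inner (H x k) h\<bar> \<le> 2 * e * s\<^sup>2 * (norm h + norm k)\<^sup>2"
proof -
  define M where "M = norm h + norm k"
  \<comment> \<open>\<open>\<phi>\<close> holds the \<open>k\<close>-difference and runs along
    \<open>h\<close>. The mean value theorem turns the second difference into a single difference of
    gradients, and both points lie where \<open>g\<close> is linearized at \<open>x\<close>.\<close>
  define \<phi> where "\<phi> t = f ((x + s *\<^sub>R k) + t *\<^sub>R (s *\<^sub>R h)) - f (x + t *\<^sub>R (s *\<^sub>R h))" for t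
  define \<phi>' where "\<phi>' t = inner (g ((x + s *\<^sub>R k) + t *\<^sub>R (s *\<^sub>R h))) (s *\<^sub>R h)
    - inner (g (x + t *\<^sub>R (s *\<^sub>R h))) (s *\<^sub>R h)" for t
  have d: "(\<phi> has_real_derivative \<phi>' t) (at t)" for t
    unfolding \<phi>_def \<phi>'_def by (intro DERIV_diff f_line_deriv)
  obtain t where t: "0 < t" "t < 1" "\<phi> 1 - \<phi> 0 = \<phi>' t"
    using MVT2[of 0 1 \<phi> \<phi>'] d by auto
  define y1 where "y1 = s *\<^sub>R k + t *\<^sub>R (s *\<^sub>R h)"
  define y2 where "y2 = t *\<^sub>R (s *\<^sub>R h)"
  have nt: "norm (t *\<^sub>R (s *\<^sub>R h)) \<le> s * norm h"
    using t s by (simp add: mult_left_le_one_le)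
  have n2: "norm y2 \<le> s * M"
    using nt s unfolding y2_def M_def by (smt (verit) distrib_left mult_nonneg_nonneg norm_ge_zero)
  have n1: "norm y1 \<le> s * M"
    using norm_triangle_ineq[of "s *\<^sub>R k" "t *\<^sub>R (s *\<^sub>R h)"] nt s
    unfolding y1_def M_def by (simp add: distrib_left)
  define e1 where "e1 = g (x + y1) - g x - H x y1"
  define e2 where "e2 = g (x + y2) - g x - H x y2"
  have b1: "norm e1 \<le> e * (s * M)" "norm e2 \<le> e * (s * M)"
    using approx[of y1] approx[of y2] n1 n2 e unfolding e1_def e2_def M_def
    by (smt (verit) mult_left_mono)+
  have "g (x + y1) - g (x + y2) = H x (s *\<^sub>R k) + (e1 - e2)"
    unfolding e1_def e2_def y1_def y2_def by (simp add: linear_add[OF linear_H])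
  moreover have "\<phi>' t = s * inner (g (x + y1) - g (x + y2)) h"
    unfolding \<phi>'_def y1_def y2_def by (simp add: inner_diff_left algebra_simps)
  ultimately have "\<phi>' t = s * inner (H x (s *\<^sub>R k) + (e1 - e2)) h"
    by simp
  also have "\<dots> = s\<^sup>2 * inner (H x k) h + s * inner (e1 - e2) h"
    by (simp add: linear_cmul[OF linear_H] inner_add_left power2_eq_square algebra_simps)
  finally have 1: "\<phi> 1 - \<phi> 0 - s\<^sup>2 * inner (H x k) h = s * inner (e1 - e2) h"
    using t by simp
  have "\<bar>inner (e1 - e2) h\<bar> \<le> norm (e1 - e2) * norm h"
    by (rule Cauchy_Schwarz_ineq2)
  also have "\<dots> \<le> (2 * e * (s * M)) * M"
  proof (rule mult_mono)
    show "norm (e1 - e2) \<le> 2 * e * (s * M)"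
      using norm_triangle_ineq4[of e1 e2] b1 by linarith
  qed (use e s in \<open>auto simp: M_def\<close>)
  finally have "s * \<bar>inner (e1 - e2) h\<bar> \<le> s * ((2 * e * (s * M)) * M)"
    using s by (intro mult_left_mono) auto
  then have "\<bar>\<phi> 1 - \<phi> 0 - s\<^sup>2 * inner (H x k) h\<bar> \<le> 2 * e * s\<^sup>2 * M\<^sup>2"
    unfolding 1 abs_mult using s by (simp add: power2_eq_square mult_ac)
  moreover have "\<phi> 1 - \<phi> 0 = f (x + s *\<^sub>R h + s *\<^sub>R k) - f (x + s *\<^sub>R h) - f (x + s *\<^sub>R k) + f x"
    unfolding \<phi>_def by (simp add: algebra_simps)
  ultimately show ?thesis unfolding M_def by simp
qed

text \<open>The second difference does not change when \<open>h\<close> and \<open>k\<close> are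
  swapped, so \<open>second_difference\<close> applied in both orders bounds the asymmetry by an
  arbitrary \<open>e\<close> times a fixed number, after division by
  \<open>s\<^sup>2\<close>.\<close>

lemma symmetric_H: "inner (H x h) k = inner h (H x k)"
proof -
  have *: "\<bar>inner (H x k) h - inner (H x h) k\<bar> \<le> e * (4 * (norm h + norm k)\<^sup>2)" if e: "e > 0" for e
  proof -
    define M where "M = norm h + norm k"
    have "\<exists>\<delta>>0. \<forall>y. norm (y - x) < \<delta> \<longrightarrow> norm (g y - g x - H x (y - x)) \<le> e * norm (y - x)"
      using g_deriv[of x] e unfolding has_derivative_at_alt by blast
    then obtain \<delta> where \<delta>: "\<delta> > 0"
      and app: "\<And>y. norm (y - x) < \<delta> \<Longrightarrow> norm (g y - g x - H x (y - x)) \<le> e * norm (y - x)"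
      by blast
    define s where "s = \<delta> / (2 * (M + 1))"
    have M: "M \<ge> 0" unfolding M_def by simp
    have s: "s > 0" using \<delta> M unfolding s_def by simp
    have "s * M \<le> \<delta> / 2" using M \<delta> unfolding s_def by (simp add: field_simps)
    then have sM: "s * M < \<delta>" using \<delta> by linarith
    have app': "norm (g (x + y) - g x - H x y) \<le> e * norm y" if "norm y \<le> s * M" for y
      using app[of "x + y"] that sM by simp
    have 1: "\<bar>(f (x + s *\<^sub>R h + s *\<^sub>R k) - f (x + s *\<^sub>R h) - f (x + s *\<^sub>R k) + f x)
            - s\<^sup>2 * inner (H x k) h\<bar> \<le> 2 * e * s\<^sup>2 * M\<^sup>2"
      unfolding M_def by (rule second_difference[OF e s]) (use app' M_def in auto)
    have 2: "\<bar>(f (x + s *\<^sub>R k + s *\<^sub>R h) - f (x + s *\<^sub>R k) - f (x + s *\<^sub>R h) + f x)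
            - s\<^sup>2 * inner (H x h) k\<bar> \<le> 2 * e * s\<^sup>2 * (norm k + norm h)\<^sup>2"
      by (rule second_difference[OF e s]) (use app' M_def in \<open>auto simp: add.commute\<close>)
    have cm: "x + s *\<^sub>R k + s *\<^sub>R h = x + s *\<^sub>R h + s *\<^sub>R k" by simp
    have "\<bar>s\<^sup>2 * inner (H x k) h - s\<^sup>2 * inner (H x h) k\<bar> \<le> 4 * e * s\<^sup>2 * M\<^sup>2"
      using 1 2[unfolded cm add.commute[of "norm k"]] unfolding M_def by linarith
    then have "s\<^sup>2 * \<bar>inner (H x k) h - inner (H x h) k\<bar> \<le> s\<^sup>2 * (e * (4 * M\<^sup>2))"
      unfolding right_diff_distrib[symmetric] abs_mult abs_power2 by (simp add: mult_ac)
    then show ?thesis using s unfolding M_def by simp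
  qed
  have "\<bar>inner (H x k) h - inner (H x h) k\<bar> \<le> 0"
  proof (rule field_le_epsilon)
    fix e :: real assume e: "e > 0"
    define M where "M = 4 * (norm h + norm k)\<^sup>2 + 1"
    have M: "M > 0" unfolding M_def by (simp add: add_nonneg_pos)
    have "\<bar>inner (H x k) h - inner (H x h) k\<bar> \<le> (e / M) * (4 * (norm h + norm k)\<^sup>2)"
      using *[of "e / M"] e M by simp
    also have "\<dots> \<le> (e / M) * M" using e M unfolding M_def by (intro mult_left_mono) auto
    also have "\<dots> = e" using M by simp
    finally show "\<bar>inner (H x k) h - inner (H x h) k\<bar> \<le> 0 + e" by simp
  qed
  then show ?thesis by (simp add: inner_commute)
qed

text \<open>The Lipschitz bound passes to the derivative as a limit of difference quotients.
  Dividing the slack by \<open>norm h + 1\<close> treats \<open>h = 0\<close> together with the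
  other vectors.\<close>

lemma norm_H_le: "norm (H x h) \<le> l * norm h"
proof (rule field_le_epsilon)
  fix e :: real assume e: "e > 0"
  define e' where "e' = e / (norm h + 1)"
  have e': "e' > 0" using e unfolding e'_def by (simp add: add_nonneg_pos)
  obtain \<delta> where \<delta>: "\<delta> > 0"
    and app: "\<And>y. norm (y - x) < \<delta> \<Longrightarrow> norm (g y - g x - H x (y - x)) \<le> e' * norm (y - x)"
    using g_deriv[of x] e' unfolding has_derivative_at_alt by blast
  define s where "s = \<delta> / (2 * (norm h + 1))"
  have s: "s > 0" using \<delta> unfolding s_def by (simp add: add_nonneg_pos)
  have "s * norm h \<le> s * (norm h + 1)" using s by simp
  also have "\<dots> = \<delta> / 2"
    using add_nonneg_pos[of "norm h" 1] unfolding s_def by (simp add: field_simps)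
  finally have "s * norm h \<le> \<delta> / 2" .
  then have "norm ((x + s *\<^sub>R h) - x) < \<delta>" using \<delta> s by simp
  from app[OF this] have "norm (g (x + s *\<^sub>R h) - g x - s *\<^sub>R H x h) \<le> e' * (s * norm h)"
    using s by (simp add: linear_cmul[OF linear_H])
  moreover have "norm (g (x + s *\<^sub>R h) - g x) \<le> l * (s * norm h)"
    using g_lip[of "x + s *\<^sub>R h" x] s by simp
  ultimately have "norm (s *\<^sub>R H x h) \<le> l * (s * norm h) + e' * (s * norm h)"
    using norm_triangle_ineq4[of "g (x + s *\<^sub>R h) - g x" "g (x + s *\<^sub>R h) - g x - s *\<^sub>R H x h"] by simp
  then have "s * norm (H x h) \<le> s * (l * norm h + e' * norm h)" using s by (simp add: algebra_simps)
  then have "norm (H x h) \<le> l * norm h + e' * norm h" using s by simp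
  moreover have "e' * norm h \<le> e"
  proof -
    have "e' * norm h \<le> e' * (norm h + 1)" using e' by simp
    also have "\<dots> = e" using add_nonneg_pos[of "norm h" 1] unfolding e'_def by simp
    finally show ?thesis .
  qed
  ultimately show "norm (H x h) \<le> l * norm h + e" by linarith
qed

section \<open>Descent, localization and separation of gradient descent runs\<close>

lemma descent_quadratic: "f (x + h) \<le> f x + inner (g x) h + l / 2 * (norm h)\<^sup>2"
proof -
  \<comment> \<open>The difference between \<open>f\<close> along the segment and its quadratic
    upper bound; the Lipschitz bound on the gradient makes its derivative nonpositive.\<close>
  define \<phi> where "\<phi> s = f (x + s *\<^sub>R h) - s * inner (g x) h - l / 2 * s\<^sup>2 * (norm h)\<^sup>2" for s
  have d: "(\<phi> has_real_derivative inner (g (x + s *\<^sub>R h)) h - inner (g x) h - l * s * (norm h)\<^sup>2) (at s)" for s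
    unfolding \<phi>_def by (auto intro!: derivative_eq_intros f_line_deriv)
  have neg: "inner (g (x + s *\<^sub>R h)) h - inner (g x) h - l * s * (norm h)\<^sup>2 \<le> 0" if "s \<ge> 0" for s
  proof -
    have "inner (g (x + s *\<^sub>R h) - g x) h \<le> norm (g (x + s *\<^sub>R h) - g x) * norm h"
      by (rule norm_cauchy_schwarz)
    also have "\<dots> \<le> (l * (s * norm h)) * norm h"
      using g_lip[of "x + s *\<^sub>R h" x] that by (intro mult_right_mono) auto
    finally show ?thesis by (simp add: inner_diff_left power2_eq_square mult_ac)
  qed
  have "\<phi> 1 \<le> \<phi> 0"
    by (rule DERIV_nonpos_imp_nonincreasing[of 0 1 \<phi>]) (use d neg in \<open>auto intro!: exI\<close>)
  then show ?thesis unfolding \<phi>_def by simp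
qed

lemma gradient_step_descent:
  assumes "0 \<le> \<eta>" "\<eta> * l \<le> 1"
  shows "f (x - \<eta> *\<^sub>R g x) \<le> f x - \<eta> / 2 * (norm (g x))\<^sup>2"
proof -
  have "f (x - \<eta> *\<^sub>R g x) \<le> f x - \<eta> * (norm (g x))\<^sup>2 + l / 2 * (\<eta> * norm (g x))\<^sup>2"
    using descent_quadratic[of x "- (\<eta> *\<^sub>R g x)"] assms by (simp add: power2_norm_eq_inner)
  also have "l / 2 * (\<eta> * norm (g x))\<^sup>2 = (\<eta> * l) * (\<eta> / 2 * (norm (g x))\<^sup>2)"
    by (simp add: power2_eq_square)
  \<comment> \<open>Because \<open>\<eta> * l \<le> 1\<close>, the second-order loss is at most half
    of the first-order gain.\<close>
  also have "\<dots> \<le> 1 * (\<eta> / 2 * (norm (g x))\<^sup>2)"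
    using assms by (intro mult_right_mono) auto
  finally show ?thesis by simp
qed

definition gd :: "real \<Rightarrow> 'a \<Rightarrow> 'a" where
  "gd \<eta> x = x - \<eta> *\<^sub>R g x"

lemma gd_pow_decreasing:
  assumes "0 \<le> \<eta>" "\<eta> * l \<le> 1" "m \<le> n"
  shows "f ((gd \<eta> ^^ n) x) \<le> f ((gd \<eta> ^^ m) x)"
  using assms(3)
proof (induction rule: dec_induct)
  case (step n)
  have "f (gd \<eta> ((gd \<eta> ^^ n) x)) \<le> f ((gd \<eta> ^^ n) x)"
    using gradient_step_descent[OF assms(1,2), of "(gd \<eta> ^^ n) x"] assms(1) unfolding gd_def
    by (smt (verit) divide_nonneg_pos mult_nonneg_nonneg zero_le_power2)
  then show ?case using step by simp
qed simp

text \<open>A run can go far only by lowering \<open>f\<close>: the squared length of each step is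
  at most \<open>2 * \<eta>\<close> times the decrease it causes, and Cauchy-Schwarz over the path
  costs the factor \<open>n\<close>. The induction carries out this Cauchy-Schwarz one step at a
  time.\<close>

lemma improve_or_localize:
  assumes "0 \<le> \<eta>" "\<eta> * l \<le> 1"
  shows "(norm ((gd \<eta> ^^ n) x - x))\<^sup>2 \<le> 2 * \<eta> * real n * (f x - f ((gd \<eta> ^^ n) x))"
proof (induction n)
  case (Suc n)
  define y where "y = (gd \<eta> ^^ n) x"
  define a where "a = norm (y - x)"
  define b where "b = \<eta> * norm (g y)"
  define D where "D = f x - f y"
  define E where "E = f y - f (gd \<eta> y)"
  have a: "a\<^sup>2 \<le> 2 * \<eta> * real n * D" using Suc unfolding a_def y_def D_def .
  have "\<eta> / 2 * (norm (g y))\<^sup>2 \<le> E"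
    using gradient_step_descent[OF assms, of y] unfolding E_def gd_def by simp
  then have "\<eta> * (2 * (\<eta> / 2 * (norm (g y))\<^sup>2)) \<le> \<eta> * (2 * E)"
    using assms by (intro mult_left_mono) auto
  then have b: "b\<^sup>2 \<le> 2 * \<eta> * E" unfolding b_def by (simp add: power2_eq_square mult_ac)
  have DE: "0 \<le> D" 
    using gd_pow_decreasing[OF assms, of 0 n x] unfolding D_def y_def by simp
  have E: "0 \<le> E" 
    using gd_pow_decreasing[OF assms, of n "Suc n" x] unfolding E_def y_def by simp
  have "norm (gd \<eta> y - x) \<le> a + b"
    unfolding a_def b_def gd_def using norm_triangle_ineq4[of "y - x" "\<eta> *\<^sub>R g y"] assms by (simp add: algebra_simps)
  then have "(norm (gd \<eta> y - x))\<^sup>2 \<le> (a + b)\<^sup>2" by (intro power_mono) auto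
  also have "\<dots> \<le> 2 * \<eta> * real (Suc n) * (D + E)"
  proof (cases "n = 0")
    case True
    then have "a = 0" unfolding a_def y_def by simp
    then show ?thesis using b DE True assms by (simp add: D_def y_def)
  next
    case False
    define N where "N = real n"
    have N: "N > 0" using False unfolding N_def by simp
    \<comment> \<open>The mixed term \<open>2 * a * b\<close> is split with weight \<open>N\<close>,
      the choice for which the factor grows from \<open>n\<close> to exactly
      \<open>Suc n\<close>.\<close>
    have "0 \<le> (a / N - b)\<^sup>2 * N" using N by simp
    also have "\<dots> = a\<^sup>2 / N - 2 * a * b + N * b\<^sup>2" using N by (simp add: power2_eq_square field_simps)
    finally have "2 * a * b \<le> a\<^sup>2 / N + N * b\<^sup>2" by simp
    moreover have "a\<^sup>2 / N \<le> 2 * \<eta> * D" using a N unfolding N_def by (simp add: field_simps)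
    moreover have "N * b\<^sup>2 \<le> N * (2 * \<eta> * E)" using b N by (intro mult_left_mono) auto
    ultimately have "(a + b)\<^sup>2 \<le> 2 * \<eta> * N * D + 2 * \<eta> * D + N * (2 * \<eta> * E) + 2 * \<eta> * E"
      using a b unfolding N_def power2_sum by linarith
    then show ?thesis unfolding N_def by (simp add: algebra_simps)
  qed
  finally show ?case unfolding y_def D_def E_def by (simp add: algebra_simps)
qed simp

text \<open>One fixed matrix, the Hessian at the centre \<open>z\<close>, serves for all pairs of
  points in the ball, at the price of a relative error \<open>\<rho> * R\<close>. By convexity the
  segment between the two points stays in the ball.\<close>

lemma gradient_linearization:
  assumes x: "norm (x - z) \<le> R" and y: "norm (y - z) \<le> R"
  shows "norm (g x - g y - H z (x - y)) \<le> \<rho> * R * norm (x - y)"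
proof (cases "g x - g y - H z (x - y) = 0")
  case True
  have "R \<ge> 0" using x norm_ge_zero order_trans by blast
  then show ?thesis using \<rho>_pos by (subst True) simp
next
  case False
  define w where "w = x - y"
  define v where "v = g x - g y - H z w"
  \<comment> \<open>Pairing with the error vector \<open>v\<close> itself gives a real function, to
    which the mean value theorem applies, and its increment is the squared norm of the
    error.\<close>
  define \<phi> where "\<phi> s = inner (g (y + s *\<^sub>R w)) v - s * inner (H z w) v" for s
  have d: "(\<phi> has_real_derivative inner (H (y + s *\<^sub>R w) w) v - inner (H z w) v) (at s)" for s
    unfolding \<phi>_def by (auto intro!: derivative_eq_intros g_line_deriv)
  obtain s where s: "0 < s" "s < 1" "\<phi> 1 - \<phi> 0 = inner (H (y + s *\<^sub>R w) w) v - inner (H z w) v"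
    using MVT2[of 0 1 \<phi> "\<lambda>s. inner (H (y + s *\<^sub>R w) w) v - inner (H z w) v"] d by auto
  have "(y + s *\<^sub>R w) - z = (1 - s) *\<^sub>R (y - z) + s *\<^sub>R (x - z)"
    unfolding w_def by (simp add: algebra_simps)
  then have "norm ((y + s *\<^sub>R w) - z) \<le> (1 - s) * norm (y - z) + s * norm (x - z)"
    using norm_triangle_ineq[of "(1 - s) *\<^sub>R (y - z)" "s *\<^sub>R (x - z)"] s by simp
  also have "\<dots> \<le> (1 - s) * R + s * R"
    using s x y by (intro add_mono mult_left_mono) auto
  finally have dist: "norm ((y + s *\<^sub>R w) - z) \<le> R" by (simp add: algebra_simps)
  have "(norm v)\<^sup>2 = \<phi> 1 - \<phi> 0"
    unfolding \<phi>_def power2_norm_eq_inner by (simp add: v_def w_def inner_diff_left)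
  also have "\<dots> = inner (H (y + s *\<^sub>R w) w - H z w) v" using s by (simp add: inner_diff_left)
  also have "\<dots> \<le> norm (H (y + s *\<^sub>R w) w - H z w) * norm v" by (rule norm_cauchy_schwarz)
  also have "\<dots> \<le> (\<rho> * R * norm w) * norm v"
  proof (rule mult_right_mono)
    have "norm (H (y + s *\<^sub>R w) w - H z w) \<le> \<rho> * norm ((y + s *\<^sub>R w) - z) * norm w" by (rule H_lip)
    also have "\<dots> \<le> \<rho> * R * norm w"
      using dist \<rho>_pos by (intro mult_right_mono mult_left_mono) auto
    finally show "norm (H (y + s *\<^sub>R w) w - H z w) \<le> \<rho> * R * norm w" .
  qed simp
  finally have "norm v * norm v \<le> (\<rho> * R * norm w) * norm v" by (simp add: power2_eq_square)
  moreover have "norm v > 0" using False unfolding v_def w_def by simp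
  ultimately show ?thesis unfolding v_def w_def by simp
qed

text \<open>Cauchy-Schwarz for the positive semidefinite form of \<open>I - \<eta> H\<close>, in place of a spectral decomposition.\<close>

lemma gd_linear_part_norm:
  assumes \<eta>: "0 \<le> \<eta>" "\<eta> * l \<le> 1" and G: "0 \<le> \<gamma>"
    and low: "\<And>v. - \<gamma> * (norm v)\<^sup>2 \<le> inner v (H z v)"
  shows "norm (v - \<eta> *\<^sub>R H z v) \<le> (1 + \<eta> * \<gamma>) * norm v"
proof -
  define A where "A v = v - \<eta> *\<^sub>R H z v" for v
  define M where "M = 1 + \<eta> * \<gamma>"
  define B where "B u w = inner u (A w)" for u w
  have M: "M \<ge> 1" using \<eta> G unfolding M_def by simp
  have lin: "A (u + w) = A u + A w" "A (t *\<^sub>R u) = t *\<^sub>R A u" for u w t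
    unfolding A_def by (simp_all add: linear_add[OF linear_H] linear_cmul[OF linear_H] algebra_simps)
  have sym: "B u w = B w u" for u w
    using symmetric_H[of z u w] unfolding B_def A_def by (simp add: inner_diff_right inner_commute)
  have upper: "B w w \<le> M * (norm w)\<^sup>2" for w
  proof -
    have "\<eta> * (- \<gamma> * (norm w)\<^sup>2) \<le> \<eta> * inner w (H z w)" using low \<eta> by (intro mult_left_mono)
    then show ?thesis unfolding B_def A_def M_def
      by (simp add: inner_diff_right power2_norm_eq_inner algebra_simps)
  qed
  have nonneg: "0 \<le> B w w" for w
  proof -
    have "inner w (H z w) \<le> norm w * norm (H z w)" by (rule norm_cauchy_schwarz)
    also have "\<dots> \<le> norm w * (l * norm w)" using norm_H_le by (intro mult_left_mono) auto
    finally have "\<eta> * inner w (H z w) \<le> \<eta> * (norm w * (l * norm w))"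
      using \<eta> by (intro mult_left_mono)
    also have "\<dots> = (\<eta> * l) * (norm w)\<^sup>2" by (simp add: power2_eq_square)
    also have "\<dots> \<le> (norm w)\<^sup>2" using \<eta> by (intro mult_left_le_one_le) (use l_pos in auto)
    finally show ?thesis unfolding B_def A_def by (simp add: inner_diff_right power2_norm_eq_inner)
  qed
  define u where "u = A v"
  have Bu: "B u v = (norm u)\<^sup>2" unfolding B_def u_def by (simp add: power2_norm_eq_inner)
  have quad: "B (v + t *\<^sub>R u) (v + t *\<^sub>R u) = B v v + 2 * (t * (norm u)\<^sup>2) + t * t * B u u" for t
  proof -
    have "B (v + t *\<^sub>R u) (v + t *\<^sub>R u) = B v v + t * B v u + t * B u v + t * t * B u u"
      unfolding B_def by (simp add: lin inner_add_left inner_add_right distrib_left)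
    then show ?thesis unfolding sym[of v u] Bu by simp
  qed
  define U where "U = (norm u)\<^sup>2"
  \<comment> \<open>The test vector is \<open>v - (1 / M) u\<close>: among all
    \<open>v + t u\<close>, the value \<open>t = - 1 / M\<close> minimizes the upper bound
    \<open>M |v|^2 + 2 t U + t^2 M U\<close>.\<close>
  have "0 \<le> B v v - 2 * (U / M) + (1 / M) * (1 / M) * B u u"
    using nonneg[of "v + (- (1 / M)) *\<^sub>R u"] unfolding quad U_def by simp
  also have "\<dots> \<le> M * (norm v)\<^sup>2 - 2 * (U / M) + (1 / M) * (1 / M) * (M * U)"
    using upper[of v] upper[of u] M unfolding U_def by (intro add_mono diff_mono mult_left_mono) auto
  also have "(1 / M) * (1 / M) * (M * U) = U / M" using M by simp
  finally have "U / M \<le> M * (norm v)\<^sup>2" by simp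
  then have "U \<le> (M * norm v)\<^sup>2"
    using M by (simp add: pos_divide_le_eq power_mult_distrib power2_eq_square[of M] mult_ac)
  then have "norm u \<le> M * norm v"
    unfolding U_def by (rule power2_le_imp_le) (use M in simp)
  then show ?thesis unfolding u_def A_def M_def .
qed

text \<open>The difference of the runs obeys the linear recursion with matrix
  \<open>I - \<eta> H\<close> up to linearization errors. Along the extremal eigenvector the linear
  part grows at the largest possible rate, so an error made early is never amplified faster than the
  main term; after \<open>t\<close> steps it is at most a fraction \<open>b * t\<close> of it. Since
  both runs stay in the ball, half of the main term is at most \<open>2 * R\<close>.\<close>

lemma coupled_runs_separate:
  assumes \<eta>: "0 \<le> \<eta>" "\<eta> * l \<le> 1" and G: "0 \<le> \<gamma>"
    and low: "\<And>v. - \<gamma> * (norm v)\<^sup>2 \<le> inner v (H z v)"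
    and u: "norm u = 1" "H z u = - \<gamma> *\<^sub>R u"
    and start: "x - y = \<mu> *\<^sub>R u"
    and locx: "\<And>t. t \<le> N \<Longrightarrow> norm ((gd \<eta> ^^ t) x - z) \<le> R"
    and locy: "\<And>t. t \<le> N \<Longrightarrow> norm ((gd \<eta> ^^ t) y - z) \<le> R"
    and small: "4 * \<eta> * \<rho> * R * real N \<le> 1"
  shows "(1 + \<eta> * \<gamma>) ^ N * \<bar>\<mu>\<bar> \<le> 4 * R"
proof -
  define M where "M = 1 + \<eta> * \<gamma>"
  define w where "w t = (gd \<eta> ^^ t) x - (gd \<eta> ^^ t) y" for t
  have M: "M \<ge> 1" using \<eta> G unfolding M_def by simp
  have R: "R \<ge> 0" using locx[of 0] norm_ge_zero order_trans by blast
  \<comment> \<open>New relative error per step: linearization contributes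
    \<open>\<eta> * \<rho> * R * norm (w t)\<close>, and \<open>norm (w t)\<close> is at most twice
    the main term as long as the accumulated error is at most half of it.\<close>
  define b where "b = 2 * \<eta> * \<rho> * R"
  have b: "b \<ge> 0" using \<eta> \<rho>_pos R unfolding b_def by simp
  have bt: "b * real t \<le> 1 / 2" if "t \<le> N" for t
  proof -
    have "b * real t \<le> b * real N" using b that by (intro mult_left_mono) auto
    also have "\<dots> \<le> 1 / 2" using small unfolding b_def by simp
    finally show ?thesis .
  qed
  have main: "norm (w t - (M ^ t * \<mu>) *\<^sub>R u) \<le> b * real t * (M ^ t * \<bar>\<mu>\<bar>)" if "t \<le> N" for t
    using that
  proof (induction t)
    case 0
    then show ?case by (simp add: w_def start)
  next
    case (Suc t)
    define p where "p = M ^ t * \<bar>\<mu>\<bar>"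
    have p: "p \<ge> 0" using M unfolding p_def by simp
    define q where "q = w t - (M ^ t * \<mu>) *\<^sub>R u"
    have q: "norm q \<le> b * real t * p" using Suc unfolding q_def p_def by simp
    define X where "X = (gd \<eta> ^^ t) x"
    define Y where "Y = (gd \<eta> ^^ t) y"
    define er where "er = g X - g Y - H z (X - Y)"
    have er: "norm er \<le> \<rho> * R * norm (w t)"
      unfolding er_def w_def X_def Y_def
      by (rule gradient_linearization) (use locx locy Suc.prems in auto)
    have "norm (w t) \<le> norm q + norm ((M ^ t * \<mu>) *\<^sub>R u)"
      using norm_triangle_ineq[of q "(M ^ t * \<mu>) *\<^sub>R u"] unfolding q_def by simp
    also have "\<dots> \<le> b * real t * p + p"
      using q M u unfolding p_def by (simp add: abs_mult power_abs)
    also have "\<dots> \<le> 1 / 2 * p + p"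
      using bt[of t] Suc.prems p by (intro add_right_mono mult_right_mono) auto
    finally have w: "norm (w t) \<le> 2 * p" using p by linarith
    have ws: "w (Suc t) = w t - \<eta> *\<^sub>R H z (w t) - \<eta> *\<^sub>R er"
      unfolding w_def er_def X_def Y_def by (simp add: gd_def algebra_simps)
    have "w t = q + (M ^ t * \<mu>) *\<^sub>R u" unfolding q_def by simp
    then have "w t - \<eta> *\<^sub>R H z (w t) = (q - \<eta> *\<^sub>R H z q) + (M ^ Suc t * \<mu>) *\<^sub>R u"
      by (simp add: linear_add[OF linear_H] linear_cmul[OF linear_H] u M_def algebra_simps)
    then have "w (Suc t) - (M ^ Suc t * \<mu>) *\<^sub>R u = (q - \<eta> *\<^sub>R H z q) - \<eta> *\<^sub>R er"
      unfolding ws by simp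
    then have "norm (w (Suc t) - (M ^ Suc t * \<mu>) *\<^sub>R u) \<le> norm (q - \<eta> *\<^sub>R H z q) + \<eta> * norm er"
      using norm_triangle_ineq4[of "q - \<eta> *\<^sub>R H z q" "\<eta> *\<^sub>R er"] \<eta> by simp
    also have "\<dots> \<le> M * norm q + \<eta> * (\<rho> * R * (2 * p))"
    proof (rule add_mono)
      show "norm (q - \<eta> *\<^sub>R H z q) \<le> M * norm q"
        unfolding M_def by (rule gd_linear_part_norm[OF \<eta> G low])
      show "\<eta> * norm er \<le> \<eta> * (\<rho> * R * (2 * p))"
        using er w \<eta> \<rho>_pos R by (intro mult_left_mono) (auto intro: order_trans[OF _ mult_left_mono])
    qed
    also have "\<dots> \<le> M * (b * real t * p) + b * p"
      using q M unfolding b_def by (intro add_mono mult_left_mono) auto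
    also have "\<dots> \<le> M * (b * real t * p) + M * (b * p)"
    proof -
      have "1 * (b * p) \<le> M * (b * p)" using M b p by (intro mult_right_mono) auto
      then show ?thesis by simp
    qed
    finally show ?case unfolding p_def by (simp add: algebra_simps)
  qed
  have "norm ((M ^ N * \<mu>) *\<^sub>R u) = M ^ N * \<bar>\<mu>\<bar>" using M u by (simp add: abs_mult power_abs)
  moreover have "norm ((M ^ N * \<mu>) *\<^sub>R u) \<le> norm (w N) + norm (w N - (M ^ N * \<mu>) *\<^sub>R u)"
    using norm_triangle_ineq4[of "w N" "w N - (M ^ N * \<mu>) *\<^sub>R u"] by simp
  moreover have "norm (w N - (M ^ N * \<mu>) *\<^sub>R u) \<le> 1 / 2 * (M ^ N * \<bar>\<mu>\<bar>)"
  proof -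
    have "b * real N * (M ^ N * \<bar>\<mu>\<bar>) \<le> 1 / 2 * (M ^ N * \<bar>\<mu>\<bar>)"
      using bt[of N] M by (intro mult_right_mono) auto
    then show ?thesis using main[of N] by linarith
  qed
  moreover have "norm (w N) \<le> 2 * R"
    using norm_triangle_ineq4[of "(gd \<eta> ^^ N) x - z" "(gd \<eta> ^^ N) y - z"] locx[of N] locy[of N]
    unfolding w_def by simp
  ultimately show ?thesis unfolding M_def by linarith
qed

text \<open>Along a direction of negative curvature that does not point uphill, the slope of
  \<open>f\<close> is at most \<open>- \<gamma> * s + \<rho> * s\<^sup>2\<close>. The point used is
  \<open>s = \<gamma> / \<rho>\<close>, where this bound returns to 0 and its integral is
  smallest.\<close>

lemma saddle_gap:
  assumes v: "norm v = 1" and neg: "inner v (H x v) \<le> - \<gamma>" and G: "0 \<le> \<gamma>"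
  shows "\<exists>z. f z \<le> f x - \<gamma> ^ 3 / (6 * \<rho>\<^sup>2)"
proof -
  \<comment> \<open>Reversing \<open>v\<close> keeps the quadratic form and flips the gradient term,
    so the latter can be made nonpositive.\<close>
  define u where "u = (if inner (g x) v \<le> 0 then v else - v)"
  have u: "norm u = 1" "inner (g x) u \<le> 0" "inner u (H x u) \<le> - \<gamma>"
    using v neg by (auto simp: u_def linear_neg[OF linear_H])
  define \<phi> where "\<phi> s = f (x + s *\<^sub>R u) + \<gamma> * s\<^sup>2 / 2 - \<rho> * s ^ 3 / 3" for s
  have d: "(\<phi> has_real_derivative inner (g (x + s *\<^sub>R u)) u + \<gamma> * s - \<rho> * s\<^sup>2) (at s)" for s
    unfolding \<phi>_def by (auto intro!: derivative_eq_intros f_line_deriv)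
  have neg: "inner (g (x + s *\<^sub>R u)) u + \<gamma> * s - \<rho> * s\<^sup>2 \<le> 0" if s: "s \<ge> 0" for s
  proof -
    have "norm (g (x + s *\<^sub>R u) - g x - H x ((x + s *\<^sub>R u) - x)) \<le> \<rho> * s * norm ((x + s *\<^sub>R u) - x)"
      by (rule gradient_linearization) (use s u in auto)
    then have n: "norm (g (x + s *\<^sub>R u) - g x - s *\<^sub>R H x u) \<le> \<rho> * s\<^sup>2"
      using s u by (simp add: linear_cmul[OF linear_H] power2_eq_square)
    have "inner (g (x + s *\<^sub>R u) - g x - s *\<^sub>R H x u) u \<le> \<rho> * s\<^sup>2"
      using norm_cauchy_schwarz[of "g (x + s *\<^sub>R u) - g x - s *\<^sub>R H x u" u] n u by simp
    then have "inner (g (x + s *\<^sub>R u)) u \<le> inner (g x) u + s * inner u (H x u) + \<rho> * s\<^sup>2"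
      by (simp add: inner_diff_left inner_commute[of u])
    moreover have "s * inner u (H x u) \<le> s * (- \<gamma>)" using u s by (intro mult_left_mono)
    ultimately show ?thesis using u by (simp add: mult.commute)
  qed
  have "\<phi> (\<gamma> / \<rho>) \<le> \<phi> 0"
    by (rule DERIV_nonpos_imp_nonincreasing[of 0 _ \<phi>])
      (use d neg G \<rho>_pos in \<open>auto intro!: exI\<close>)
  then have "f (x + (\<gamma> / \<rho>) *\<^sub>R u) \<le> f x - (\<gamma> * (\<gamma> / \<rho>)\<^sup>2 / 2 - \<rho> * (\<gamma> / \<rho>) ^ 3 / 3)"
    unfolding \<phi>_def by simp
  also have "\<gamma> * (\<gamma> / \<rho>)\<^sup>2 / 2 - \<rho> * (\<gamma> / \<rho>) ^ 3 / 3 = \<gamma> ^ 3 / (6 * \<rho>\<^sup>2)"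
    using \<rho>_pos by (simp add: power2_eq_square power3_eq_cube field_simps)
  finally show ?thesis by blast
qed

end

section \<open>Finitely supported sequences\<close>

text \<open>
  All spaces \<open>\<real>\<^sup>d\<close> embed isometrically into this one inner product space, which gives access to the
  calculus of the library although \<open>d\<close> is not a type.
\<close>

typedef fseq = "{a :: nat \<Rightarrow> real. finite {i. a i \<noteq> 0}}"
  morphisms coord Abs_fseq
  by (rule exI[of _ "\<lambda>_. 0"]) simp

lemma finite_support: "finite {i. coord a i \<noteq> 0}"
  using coord[of a] by simp

lemma fseq_eqI: "(\<And>i. coord a i = coord b i) \<Longrightarrow> a = b"
  by (simp add: coord_inject[symmetric] fun_eq_iff)

instantiation fseq :: real_vector
begin

definition zero_fseq where "0 = Abs_fseq (\<lambda>_. 0)"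
definition plus_fseq where "a + b = Abs_fseq (\<lambda>i. coord a i + coord b i)"
definition minus_fseq where "a - b = Abs_fseq (\<lambda>i. coord a i - coord b i)"
definition uminus_fseq where "- a = Abs_fseq (\<lambda>i. - coord a i)"
definition scaleR_fseq where "r *\<^sub>R a = Abs_fseq (\<lambda>i. r * coord a i)"

lemma coord_simps:
  "coord 0 i = 0"
  "coord (a + b) i = coord a i + coord b i"
  "coord (a - b) i = coord a i - coord b i"
  "coord (- a) i = - coord a i"
  "coord (r *\<^sub>R a) i = r * coord a i"
proof -
  show "coord 0 i = 0" unfolding zero_fseq_def by (subst Abs_fseq_inverse) auto
  show "coord (a + b) i = coord a i + coord b i" unfolding plus_fseq_def
    by (subst Abs_fseq_inverse)
      (auto intro: finite_subset[OF _ finite_UnI[OF finite_support[of a] finite_support[of b]]])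
  show "coord (a - b) i = coord a i - coord b i" unfolding minus_fseq_def
    by (subst Abs_fseq_inverse)
      (auto intro: finite_subset[OF _ finite_UnI[OF finite_support[of a] finite_support[of b]]])
  show "coord (- a) i = - coord a i" unfolding uminus_fseq_def
    by (subst Abs_fseq_inverse) (use finite_support[of a] in auto)
  show "coord (r *\<^sub>R a) i = r * coord a i" unfolding scaleR_fseq_def
    by (subst Abs_fseq_inverse) (auto intro: finite_subset[OF _ finite_support[of a]])
qed

instance
  by standard (auto intro!: fseq_eqI simp: coord_simps algebra_simps)

end

instantiation fseq :: real_inner
begin

definition inner_fseq where "inner a b = (\<Sum>i | coord a i \<noteq> 0. coord a i * coord b i)"
definition norm_fseq where "norm (a::fseq) = sqrt (inner a a)"
definition sgn_fseq where "sgn (a::fseq) = inverse (norm a) *\<^sub>R a"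
definition dist_fseq where "dist (a::fseq) b = norm (a - b)"
definition uniformity_fseq where
  "(uniformity :: (fseq \<times> fseq) filter) = (INF e\<in>{0<..}. principal {(x, y). dist x y < e})"
definition open_fseq where
  "open (U :: fseq set) \<longleftrightarrow> (\<forall>x\<in>U. \<forall>\<^sub>F (x', y) in uniformity. x' = x \<longrightarrow> y \<in> U)"

text \<open>The defining sum ranges over the support of the left argument. With the summation set
  exchangeable, all terms of a linearity law in the left argument can be summed over the support of
  the right one.\<close>

lemma inner_fseq_eq:
  assumes "finite A" "\<And>i. coord a i \<noteq> 0 \<Longrightarrow> coord b i \<noteq> 0 \<Longrightarrow> i \<in> A"
  shows "inner a b = (\<Sum>i\<in>A. coord a i * coord b i)"
proof -
  have "inner a b = (\<Sum>i\<in>{i. coord a i \<noteq> 0} \<inter> A. coord a i * coord b i)"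
    unfolding inner_fseq_def by (rule sum.mono_neutral_right) (use assms finite_support in auto)
  also have "\<dots> = (\<Sum>i\<in>A. coord a i * coord b i)"
    by (rule sum.mono_neutral_left) (use assms in auto)
  finally show ?thesis .
qed

instance
proof
  fix a b c :: fseq and r :: real
  show "inner a b = inner b a"
    using inner_fseq_eq[OF finite_support[of a], of a b] inner_fseq_eq[OF finite_support[of a], of b a]
    by (simp add: mult.commute)
  show "inner (a + b) c = inner a c + inner b c"
    by (subst (1 2 3) inner_fseq_eq[OF finite_support[of c]])
      (simp_all add: coord_simps sum.distrib algebra_simps)
  show "inner (r *\<^sub>R a) b = r * inner a b"
    by (subst (1 2) inner_fseq_eq[OF finite_support[of b]])
      (simp_all add: coord_simps sum_distrib_left algebra_simps)
  show "0 \<le> inner a a" unfolding inner_fseq_def by (intro sum_nonneg) simp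
  show "inner a a = 0 \<longleftrightarrow> a = 0"
  proof
    assume "inner a a = 0"
    then have "\<forall>i\<in>{i. coord a i \<noteq> 0}. coord a i * coord a i = 0"
      unfolding inner_fseq_def by (subst (asm) sum_nonneg_eq_0_iff) (use finite_support in auto)
    then show "a = 0" by (intro fseq_eqI) (auto simp: coord_simps)
  qed (simp add: inner_fseq_def coord_simps)
  show "norm a = sqrt (inner a a)" by (rule norm_fseq_def)
  show "sgn a = a /\<^sub>R norm a" by (rule sgn_fseq_def)
  show "dist a b = norm (a - b)" by (rule dist_fseq_def)
  show "uniformity = (INF e\<in>{0<..}. principal {(x, y :: fseq). dist x y < e})"
    by (rule uniformity_fseq_def)
  show "open U \<longleftrightarrow> (\<forall>x\<in>U. \<forall>\<^sub>F (x', y) in uniformity. x' = x \<longrightarrow> y \<in> U)" for U :: "fseq set"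
    by (rule open_fseq_def)
qed

end

section \<open>Zero padding and truncation between R^d and finitely supported sequences\<close>

definition emb :: "real vec \<Rightarrow> fseq" where
  "emb v = Abs_fseq (\<lambda>i. if i < dim_vec v then v $ i else 0)"

text \<open>Precomposition with this truncation extends a function on \<open>carrier_vec d\<close>
  to the whole space.\<close>

definition proj :: "nat \<Rightarrow> fseq \<Rightarrow> real vec" where
  "proj d a = vec d (coord a)"

lemma coord_emb: "coord (emb v) i = (if i < dim_vec v then v $ i else 0)"
  unfolding emb_def by (subst Abs_fseq_inverse) (auto intro: finite_subset[of _ "{..<dim_vec v}"])

lemma proj_carrier [simp]: "proj d a \<in> carrier_vec d"
  unfolding proj_def by simp

lemma proj_emb [simp]: "v \<in> carrier_vec d \<Longrightarrow> proj d (emb v) = v"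
  by (auto simp: proj_def coord_emb)

lemma proj_arith:
  "proj d (a + b) = proj d a + proj d b"
  "proj d (a - b) = proj d a - proj d b"
  "proj d (r *\<^sub>R a) = r \<cdot>\<^sub>v proj d a"
  by (auto simp: proj_def coord_simps)

lemma emb_arith:
  "dim_vec u = dim_vec v \<Longrightarrow> emb (u + v) = emb u + emb v"
  "dim_vec u = dim_vec v \<Longrightarrow> emb (u - v) = emb u - emb v"
  "emb (r \<cdot>\<^sub>v v) = r *\<^sub>R emb v"
  by (auto intro!: fseq_eqI simp: coord_emb coord_simps)

lemma inner_emb_left: "u \<in> carrier_vec d \<Longrightarrow> inner (emb u) a = u \<bullet> proj d a"
  by (subst inner_fseq_eq[of "{0..<d}"])
    (auto simp: coord_emb scalar_prod_def proj_def split: if_splits)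

lemma inner_emb: "u \<in> carrier_vec d \<Longrightarrow> v \<in> carrier_vec d \<Longrightarrow> inner (emb u) (emb v) = u \<bullet> v"
  by (simp add: inner_emb_left)

lemma norm_emb [simp]: "norm (emb v) = vnorm v"
  by (simp add: norm_eq_sqrt_inner vnorm_def inner_emb[of v "dim_vec v" v])

lemma emb_inject: "u \<in> carrier_vec d \<Longrightarrow> v \<in> carrier_vec d \<Longrightarrow> emb u = emb v \<longleftrightarrow> u = v"
  by (metis proj_emb)

text \<open>Cauchy-Schwarz against the truncation, whose inner product with \<open>a\<close> is its
  own squared norm.\<close>

lemma vnorm_proj_le: "vnorm (proj d a) \<le> norm a"
proof -
  have "(vnorm (proj d a))\<^sup>2 = inner (emb (proj d a)) a"
    by (simp add: inner_emb_left[of "proj d a" d a] norm_emb[symmetric] power2_norm_eq_inner inner_emb_left[of "proj d a" d] del: norm_emb)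
  also have "\<dots> \<le> vnorm (proj d a) * norm a"
    using norm_cauchy_schwarz[of "emb (proj d a)" a] by simp
  finally have "vnorm (proj d a) * vnorm (proj d a) \<le> vnorm (proj d a) * norm a"
    by (simp add: power2_eq_square)
  moreover have "vnorm (proj d a) \<ge> 0" using norm_ge_zero[of "emb (proj d a)"] by simp
  ultimately show ?thesis by (cases "vnorm (proj d a) = 0") auto
qed

lemma vnorm_nonneg [simp]: "0 \<le> vnorm v"
  using norm_ge_zero[of "emb v"] by simp

lemma vnorm_eq_L2: "v \<in> carrier_vec d \<Longrightarrow> vnorm v = L2_set (\<lambda>i. v $ i) {0..<d}"
  by (auto simp: vnorm_def L2_set_def scalar_prod_def power2_eq_square)

lemma vnorm_pos: "v \<in> carrier_vec d \<Longrightarrow> v \<noteq> 0\<^sub>v d \<Longrightarrow> 0 < vnorm v"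
  by (smt (verit) L2_set_eq_0_iff atLeast0LessThan eq_vecI finite_lessThan index_zero_vec(1) index_zero_vec(2)
      lessThan_iff vnorm_eq_L2 vnorm_nonneg carrier_vecD)

lemma scalar_prod_le_vnorm: "u \<in> carrier_vec d \<Longrightarrow> v \<in> carrier_vec d \<Longrightarrow> \<bar>u \<bullet> v\<bar> \<le> vnorm u * vnorm v"
  using Cauchy_Schwarz_ineq2[of "emb u" "emb v"] by (simp add: inner_emb)

lemma vnorm_smult: "vnorm (r \<cdot>\<^sub>v v) = \<bar>r\<bar> * vnorm v"
  using norm_scaleR[of r "emb v"] by (simp add: emb_arith[symmetric])

text \<open>A real supremum such as the one in \<open>spectral_norm\<close> can be used only once
  the set is known to be bounded above. The crude bound by the row norms is enough for that, and
  also for the continuity of the linear map.\<close>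

lemma mult_mat_vec_bounded:
  assumes A: "A \<in> carrier_mat n d"
  shows "\<exists>K\<ge>0. \<forall>v\<in>carrier_vec d. vnorm (A *\<^sub>v v) \<le> K * vnorm v"
proof (intro exI[of _ "\<Sum>i<n. vnorm (row A i)"] conjI ballI)
  fix v :: "real vec" assume v: "v \<in> carrier_vec d"
  have "vnorm (A *\<^sub>v v) \<le> (\<Sum>i\<in>{0..<n}. \<bar>(A *\<^sub>v v) $ i\<bar>)"
    using L2_set_le_sum_abs[of "($) (A *\<^sub>v v)" "{0..<n}"] vnorm_eq_L2[of "A *\<^sub>v v" n] A v by simp
  also have "\<dots> \<le> (\<Sum>i\<in>{0..<n}. vnorm (row A i) * vnorm v)"
    using A v by (intro sum_mono) (auto intro!: scalar_prod_le_vnorm)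
  finally show "vnorm (A *\<^sub>v v) \<le> (\<Sum>i<n. vnorm (row A i)) * vnorm v"
    by (simp add: sum_distrib_right atLeast0LessThan)
qed (auto intro: sum_nonneg)

lemma vnorm_mult_mat_vec_le:
  assumes A: "A \<in> carrier_mat n d" and v: "v \<in> carrier_vec d"
  shows "vnorm (A *\<^sub>v v) \<le> spectral_norm A * vnorm v"
proof (cases "v = 0\<^sub>v d")
  case True
  have "A *\<^sub>v 0\<^sub>v d = 0\<^sub>v n" using A by (auto simp: scalar_prod_def)
  then show ?thesis using True by (simp add: vnorm_def)
next
  case False
  then have pos: "vnorm v > 0" using v vnorm_pos by blast
  obtain K where K: "K \<ge> 0" "\<And>v. v\<in>carrier_vec d \<Longrightarrow> vnorm (A *\<^sub>v v) \<le> K * vnorm v"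
    using mult_mat_vec_bounded[OF A] by blast
  define w where "w = (1 / vnorm v) \<cdot>\<^sub>v v"
  have w: "w \<in> carrier_vec d" "vnorm w = 1" "v = vnorm v \<cdot>\<^sub>v w"
    using v pos unfolding w_def by (auto simp: vnorm_smult)
  have "vnorm (A *\<^sub>v w) \<le> spectral_norm A"
    unfolding spectral_norm_def
  proof (rule cSUP_upper)
    show "w \<in> {v \<in> carrier_vec (dim_col A). vnorm v \<le> 1}" using w A by auto
    show "bdd_above ((\<lambda>v. vnorm (A *\<^sub>v v)) ` {v \<in> carrier_vec (dim_col A). vnorm v \<le> 1})"
    proof (rule bdd_aboveI2)
      fix u assume u: "u \<in> {v \<in> carrier_vec (dim_col A). vnorm v \<le> 1}"
      then have "vnorm (A *\<^sub>v u) \<le> K * vnorm u" using K A by auto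
      also have "\<dots> \<le> K * 1" using K u by (intro mult_left_mono) auto
      finally show "vnorm (A *\<^sub>v u) \<le> K" by simp
    qed
  qed
  moreover have "A *\<^sub>v v = vnorm v \<cdot>\<^sub>v (A *\<^sub>v w)"
    using mult_mat_vec[OF A w(1), of "vnorm v"] w(3) by simp
  ultimately show ?thesis using pos by (simp add: vnorm_smult mult.commute)
qed

section \<open>Gradients and Hessians as Frechet derivatives\<close>

lemma has_gradient_imp_has_derivative:
  assumes "has_gradient d f (proj d a) g"
  shows "((f \<circ> proj d) has_derivative (\<lambda>h. inner (emb g) h)) (at a)"
  unfolding has_derivative_at_alt
proof (intro conjI allI impI)
  fix e :: real assume "e > 0"
  with assms obtain s where s: "s > 0"
    and app: "\<And>h. h\<in>carrier_vec d \<Longrightarrow> vnorm h < s \<Longrightarrow>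
        \<bar>f (proj d a + h) - f (proj d a) - g \<bullet> h\<bar> \<le> e * vnorm h"
    and g: "g \<in> carrier_vec d"
    unfolding has_gradient_def by blast
  show "\<exists>s>0. \<forall>y. norm (y - a) < s \<longrightarrow>
    norm ((f \<circ> proj d) y - (f \<circ> proj d) a - inner (emb g) (y - a)) \<le> e * norm (y - a)"
  proof (intro exI[of _ s] conjI s allI impI)
    fix y assume y: "norm (y - a) < s"
    have "vnorm (proj d (y - a)) \<le> norm (y - a)" by (rule vnorm_proj_le)
    moreover have "proj d a + proj d (y - a) = proj d y" by (auto simp: proj_def coord_simps)
    ultimately have "\<bar>f (proj d y) - f (proj d a) - g \<bullet> proj d (y - a)\<bar> \<le> e * vnorm (proj d (y - a))"
      using app[of "proj d (y - a)"] y by simp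
    also have "\<dots> \<le> e * norm (y - a)" using \<open>e > 0\<close> vnorm_proj_le by simp
    finally show "norm ((f \<circ> proj d) y - (f \<circ> proj d) a - inner (emb g) (y - a)) \<le> e * norm (y - a)"
      using g by (simp add: inner_emb_left)
  qed
qed (rule bounded_linear_inner_right)

text \<open>Makes the description in \<open>grad\<close> denote; uniqueness is inherited from
  Frechet derivatives of the extended function.\<close>

lemma has_gradient_unique:
  assumes x: "x \<in> carrier_vec d" and g: "has_gradient d f x g" and g': "has_gradient d f x g'"
  shows "g = g'"
proof -
  have "((f \<circ> proj d) has_derivative (\<lambda>h. inner (emb g) h)) (at (emb x))"
       "((f \<circ> proj d) has_derivative (\<lambda>h. inner (emb g') h)) (at (emb x))"
    using x g g' by (auto intro!: has_gradient_imp_has_derivative)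
  then have "(\<lambda>h. inner (emb g) h) = (\<lambda>h. inner (emb g') h)" by (rule has_derivative_unique)
  then have "emb g = emb g'" by (metis inner_eq_zero_iff inner_diff_left right_minus_eq)
  then show ?thesis using g g' emb_inject unfolding has_gradient_def by blast
qed

lemma has_gradient_grad:
  assumes "differentiable_Rd d f" "x \<in> carrier_vec d"
  shows "has_gradient d f x (grad d f x)"
proof -
  obtain g where "has_gradient d f x g" using assms unfolding differentiable_Rd_def by blast
  then show ?thesis unfolding grad_def by (rule theI) (use has_gradient_unique assms(2) \<open>has_gradient d f x g\<close> in blast)
qed

lemma grad_carrier:
  "differentiable_Rd d f \<Longrightarrow> x \<in> carrier_vec d \<Longrightarrow> grad d f x \<in> carrier_vec d"
  using has_gradient_grad unfolding has_gradient_def by blast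

lemma has_hessian_imp_has_derivative:
  assumes f: "differentiable_Rd d f" and H: "has_hessian d f (proj d a) H"
  shows "((\<lambda>a. emb (grad d f (proj d a))) has_derivative (\<lambda>h. emb (H *\<^sub>v proj d h))) (at a)"
  unfolding has_derivative_at_alt
proof (intro conjI allI impI)
  have Hc: "H \<in> carrier_mat d d" using H unfolding has_hessian_def by blast
  obtain K where K: "K \<ge> 0" "\<And>v. v\<in>carrier_vec d \<Longrightarrow> vnorm (H *\<^sub>v v) \<le> K * vnorm v"
    using mult_mat_vec_bounded[OF Hc] by blast
  show "bounded_linear (\<lambda>h. emb (H *\<^sub>v proj d h))"
  proof (rule bounded_linear_intro[of _ K])
    fix x y :: fseq and r :: real
    show "emb (H *\<^sub>v proj d (x + y)) = emb (H *\<^sub>v proj d x) + emb (H *\<^sub>v proj d y)"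
      using mult_add_distrib_mat_vec[OF Hc, of "proj d x" "proj d y"] by (simp add: proj_arith emb_arith)
    show "emb (H *\<^sub>v proj d (r *\<^sub>R x)) = r *\<^sub>R emb (H *\<^sub>v proj d x)"
      using mult_mat_vec[OF Hc, of "proj d x"] by (simp add: proj_arith emb_arith)
    have "vnorm (H *\<^sub>v proj d x) \<le> K * vnorm (proj d x)" using K by simp
    also have "\<dots> \<le> K * norm x" using K vnorm_proj_le by (intro mult_left_mono)
    finally show "norm (emb (H *\<^sub>v proj d x)) \<le> norm x * K" by (simp add: mult.commute)
  qed
  fix e :: real assume "e > 0"
  with H obtain s where s: "s > 0"
    and app: "\<And>h. h\<in>carrier_vec d \<Longrightarrow> vnorm h < s \<Longrightarrow>
        vnorm (grad d f (proj d a + h) - grad d f (proj d a) - H *\<^sub>v h) \<le> e * vnorm h"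
    unfolding has_hessian_def by blast
  have gc: "grad d f (proj d y) \<in> carrier_vec d" for y using grad_carrier[OF f] by simp
  show "\<exists>s>0. \<forall>y. norm (y - a) < s \<longrightarrow>
    norm (emb (grad d f (proj d y)) - emb (grad d f (proj d a)) - emb (H *\<^sub>v proj d (y - a)))
      \<le> e * norm (y - a)"
  proof (intro exI[of _ s] conjI s allI impI)
    fix y assume y: "norm (y - a) < s"
    have "vnorm (proj d (y - a)) \<le> norm (y - a)" by (rule vnorm_proj_le)
    moreover have "proj d a + proj d (y - a) = proj d y" by (auto simp: proj_def coord_simps)
    ultimately have "vnorm (grad d f (proj d y) - grad d f (proj d a) - H *\<^sub>v proj d (y - a))
        \<le> e * vnorm (proj d (y - a))"
      using app[of "proj d (y - a)"] y by simp
    also have "\<dots> \<le> e * norm (y - a)" using \<open>e > 0\<close> vnorm_proj_le by simp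
    finally show "norm (emb (grad d f (proj d y)) - emb (grad d f (proj d a)) - emb (H *\<^sub>v proj d (y - a)))
      \<le> e * norm (y - a)"
      using gc[of y] gc[of a] Hc by (simp add: emb_arith[symmetric])
  qed
qed

lemma has_hessian_unique:
  assumes f: "differentiable_Rd d f" and x: "x \<in> carrier_vec d"
    and H: "has_hessian d f x H" and H': "has_hessian d f x H'"
  shows "H = H'"
proof -
  have c: "H \<in> carrier_mat d d" "H' \<in> carrier_mat d d" using H H' unfolding has_hessian_def by auto
  have "((\<lambda>a. emb (grad d f (proj d a))) has_derivative (\<lambda>h. emb (H *\<^sub>v proj d h))) (at (emb x))"
       "((\<lambda>a. emb (grad d f (proj d a))) has_derivative (\<lambda>h. emb (H' *\<^sub>v proj d h))) (at (emb x))"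
    using x H H' by (auto intro!: has_hessian_imp_has_derivative f)
  then have eq: "(\<lambda>h. emb (H *\<^sub>v proj d h)) = (\<lambda>h. emb (H' *\<^sub>v proj d h))" by (rule has_derivative_unique)
  have "H *\<^sub>v v = H' *\<^sub>v v" if "v \<in> carrier_vec d" for v
    using fun_cong[OF eq, of "emb v"] that c emb_inject[of "H *\<^sub>v v" d "H' *\<^sub>v v"] by simp
  then have "(H *\<^sub>v unit_vec d j) $ i = (H' *\<^sub>v unit_vec d j) $ i" for i j by simp
  moreover have "(A *\<^sub>v unit_vec d j) $ i = A $$ (i, j)" if "A \<in> carrier_mat d d" "i < d" "j < d"
    for A :: "real mat" and i j
    using that scalar_prod_right_unit[of j d "row A i"] by simp
  ultimately show ?thesis using c by (intro eq_matI) (metis carrier_matD)+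
qed

lemma has_hessian_hessian:
  assumes "twice_differentiable_Rd d f" "x \<in> carrier_vec d"
  shows "has_hessian d f x (hessian d f x)"
proof -
  obtain H where "has_hessian d f x H" using assms unfolding twice_differentiable_Rd_def by blast
  then show ?thesis unfolding hessian_def
    by (rule theI) (use has_hessian_unique assms \<open>has_hessian d f x H\<close> in \<open>auto simp: twice_differentiable_Rd_def\<close>)
qed

lemma hessian_carrier:
  "twice_differentiable_Rd d f \<Longrightarrow> x \<in> carrier_vec d \<Longrightarrow> hessian d f x \<in> carrier_mat d d"
  using has_hessian_hessian unfolding has_hessian_def by blast

text \<open>All maps depend on a sequence only through its truncation, which is linear and does not
  increase norms, so the constants \<open>l\<close> and \<open>\<rho>\<close> survive
  unchanged.\<close>

lemma smooth_function_embedded: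
  assumes g: "gradient_Lipschitz d l f" and h: "hessian_Lipschitz d \<rho> f" and pos: "0 < l" "0 < \<rho>"
  shows "smooth_function (f \<circ> proj d) (\<lambda>a. emb (grad d f (proj d a)))
           (\<lambda>a h. emb (hessian d f (proj d a) *\<^sub>v proj d h)) l \<rho>"
proof
  have f: "differentiable_Rd d f" using g unfolding gradient_Lipschitz_def by blast
  have f2: "twice_differentiable_Rd d f" using h unfolding hessian_Lipschitz_def by blast
  have gc: "grad d f (proj d y) \<in> carrier_vec d" for y using grad_carrier[OF f] by simp
  have hc: "hessian d f (proj d y) \<in> carrier_mat d d" for y using hessian_carrier[OF f2] by simp
  show "0 < l" "0 < \<rho>" by fact+
  fix x y h :: fseq
  show "((f \<circ> proj d) has_derivative (\<lambda>h. inner (emb (grad d f (proj d x))) h)) (at x)"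
    by (intro has_gradient_imp_has_derivative has_gradient_grad f) simp
  show "((\<lambda>a. emb (grad d f (proj d a))) has_derivative (\<lambda>h. emb (hessian d f (proj d x) *\<^sub>v proj d h))) (at x)"
    by (intro has_hessian_imp_has_derivative has_hessian_hessian f f2) simp
  have "norm (emb (grad d f (proj d x)) - emb (grad d f (proj d y))) = vnorm (grad d f (proj d x) - grad d f (proj d y))"
    using gc[of x] gc[of y] by (simp add: emb_arith[symmetric])
  also have "\<dots> \<le> l * vnorm (proj d (x - y))"
    using g unfolding gradient_Lipschitz_def by (simp add: proj_arith)
  also have "\<dots> \<le> l * norm (x - y)" using pos vnorm_proj_le by simp
  finally show "norm (emb (grad d f (proj d x)) - emb (grad d f (proj d y))) \<le> l * norm (x - y)" .
  let ?D = "hessian d f (proj d x) - hessian d f (proj d y)"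
  have "norm (emb (hessian d f (proj d x) *\<^sub>v proj d h) - emb (hessian d f (proj d y) *\<^sub>v proj d h))
    = vnorm (?D *\<^sub>v proj d h)"
    using minus_mult_distrib_mat_vec[OF hc[of x] hc[of y], of "proj d h"] hc[of x] hc[of y]
    by (simp add: emb_arith[symmetric])
  also have "\<dots> \<le> spectral_norm ?D * vnorm (proj d h)"
    by (rule vnorm_mult_mat_vec_le[of _ d d]) (use hc[of x] hc[of y] in auto)
  also have "\<dots> \<le> (\<rho> * vnorm (proj d (x - y))) * vnorm (proj d h)"
    using h unfolding hessian_Lipschitz_def by (intro mult_right_mono) (auto simp: proj_arith)
  also have "\<dots> \<le> (\<rho> * norm (x - y)) * norm h"
    using pos vnorm_proj_le by (intro mult_mono) auto
  finally show "norm (emb (hessian d f (proj d x) *\<^sub>v proj d h) - emb (hessian d f (proj d y) *\<^sub>v proj d h))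
    \<le> \<rho> * norm (x - y) * norm h" .
qed

section \<open>The minimum eigenvalue\<close>

text \<open>At \<open>t = 0\<close> the quadratic has value 0 and slope \<open>2 * c\<close>, so it
  can stay nonnegative only if the slope vanishes.\<close>

lemma linear_form_zero:
  fixes b c :: real
  assumes "\<And>t. 0 \<le> 2 * t * c + t\<^sup>2 * b"
  shows "c = 0"
proof (rule ccontr)
  assume c: "c \<noteq> 0"
  define B where "B = \<bar>b\<bar> + 1"
  have B: "B > 0" "b \<le> B" unfolding B_def by auto
  \<comment> \<open>With a positive \<open>B\<close> above \<open>b\<close>, the point
    \<open>t = - c / B\<close> makes the value at most \<open>- c\<^sup>2 / B\<close>.\<close>
  have "0 \<le> 2 * (- c / B) * c + (- c / B)\<^sup>2 * b" by (rule assms)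
  also have "\<dots> \<le> 2 * (- c / B) * c + (- c / B)\<^sup>2 * B" using B by (intro add_left_mono mult_left_mono) auto
  also have "\<dots> = - (c\<^sup>2 / B)" using B by (simp add: power2_eq_square field_simps)
  also have "\<dots> < 0" using B c by simp
  finally show False by simp
qed

text \<open>It suffices to vary \<open>u\<close> in the direction of its own residual
  \<open>L u - m u\<close>: the first-order term of this variation is twice the squared norm of the
  residual.\<close>

lemma Rayleigh_minimizer_is_eigenvector:
  fixes L :: "'a::real_inner \<Rightarrow> 'a"
  assumes L: "linear L" and sym: "\<And>u v. inner u (L v) = inner (L u) v"
    and m: "inner u (L u) = m * (norm u)\<^sup>2"
    and min: "\<And>t. m * (norm (u + t *\<^sub>R (L u - m *\<^sub>R u)))\<^sup>2
        \<le> inner (u + t *\<^sub>R (L u - m *\<^sub>R u)) (L (u + t *\<^sub>R (L u - m *\<^sub>R u)))"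
  shows "L u = m *\<^sub>R u"
proof -
  define r where "r = L u - m *\<^sub>R u"
  have "0 \<le> 2 * t * (norm r)\<^sup>2 + t\<^sup>2 * (inner r (L r) - m * (norm r)\<^sup>2)" for t
  proof -
    have "inner u (L r) = inner r (L u)" using sym[of u r] by (simp add: inner_commute)
    then have "inner (u + t *\<^sub>R r) (L (u + t *\<^sub>R r)) = inner u (L u) + 2 * t * inner r (L u) + t\<^sup>2 * inner r (L r)"
      by (simp add: linear_add[OF L] linear_cmul[OF L] inner_add_left inner_add_right power2_eq_square algebra_simps)
    moreover have "(norm (u + t *\<^sub>R r))\<^sup>2 = (norm u)\<^sup>2 + 2 * t * inner r u + t\<^sup>2 * (norm r)\<^sup>2"
      by (simp add: power2_norm_eq_inner inner_add_left inner_add_right inner_commute[of u r]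
          power2_eq_square[of t] algebra_simps)
    moreover have "inner r (L u) - m * inner r u = (norm r)\<^sup>2"
      by (simp add: power2_norm_eq_inner r_def inner_diff_right)
    ultimately have "inner (u + t *\<^sub>R r) (L (u + t *\<^sub>R r)) - m * (norm (u + t *\<^sub>R r))\<^sup>2
        = 2 * t * (inner r (L u) - m * inner r u) + t\<^sup>2 * (inner r (L r) - m * (norm r)\<^sup>2)"
      using m by (simp add: algebra_simps)
    then show ?thesis using min[of t] \<open>inner r (L u) - m * inner r u = (norm r)\<^sup>2\<close>
      unfolding r_def[symmetric] by simp
  qed
  then have "(norm r)\<^sup>2 = 0" by (rule linear_form_zero)
  then show ?thesis unfolding r_def by simp
qed

text \<open>The unit sphere of R^d as a set of sequences, with all coordinates from \<open>d\<close>
  on pinned to 0. It is a closed subset of a product of compact intervals, hence compact for the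
  product topology.\<close>

lemma compact_sphere_sequences:
  "compact {a :: nat \<Rightarrow> real. (\<forall>i. a i \<in> (if i < d then {-1..1} else {0})) \<and> (\<Sum>i<d. (a i)\<^sup>2) = 1}"
proof -
  define S where "S i = (if i < d then {-1..1} else {0::real})" for i
  have "compactin (product_topology (\<lambda>_. euclidean) UNIV) (PiE UNIV S)"
    unfolding compactin_PiE S_def by (auto simp: compactin_euclidean_iff)
  then have c: "compact (PiE UNIV S)"
    by (simp add: euclidean_product_topology compactin_euclidean_iff)
  have "closed {a :: nat \<Rightarrow> real. (\<Sum>i<d. (a i)\<^sup>2) = 1}"
    by (auto intro!: closed_Collect_eq continuous_intros)
  from compact_Int_closed[OF c this] show ?thesis
    by (rule back_subst[of compact]) (auto simp: S_def PiE_def Pi_def)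
qed

text \<open>The Rayleigh quotient attains its minimum on the sphere, and the minimizer is an
  eigenvector. Conversely every eigenvalue is a value of the quotient, so the minimum is the least
  eigenvalue.\<close>

lemma lambda_min_Rayleigh:
  assumes A: "A \<in> carrier_mat d d" and d: "d \<ge> 1"
    and sym: "\<And>u v. u \<in> carrier_vec d \<Longrightarrow> v \<in> carrier_vec d \<Longrightarrow> u \<bullet> (A *\<^sub>v v) = (A *\<^sub>v u) \<bullet> v"
  shows "\<exists>u\<in>carrier_vec d. vnorm u = 1 \<and> A *\<^sub>v u = lambda_min A \<cdot>\<^sub>v u"
    and "v \<in> carrier_vec d \<Longrightarrow> lambda_min A * (vnorm v)\<^sup>2 \<le> v \<bullet> (A *\<^sub>v v)"
proof -
  define K where "K = {a :: nat \<Rightarrow> real. (\<forall>i. a i \<in> (if i < d then {-1..1} else {0})) \<and> (\<Sum>i<d. (a i)\<^sup>2) = 1}"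
  define q where "q a = vec d a \<bullet> (A *\<^sub>v vec d a)" for a
  have q_eq: "q a = (\<Sum>i\<in>{0..<d}. a i * (\<Sum>j\<in>{0..<d}. A $$ (i, j) * a j))" for a
    unfolding q_def using A by (simp add: scalar_prod_def)
  have "continuous_on K q" unfolding q_eq[abs_def]
    by (intro continuous_intros continuous_on_product_then_coordinatewise[OF continuous_on_id])
  moreover have "compact K" unfolding K_def by (rule compact_sphere_sequences)
  moreover have "K \<noteq> {}"
  proof -
    have "(\<Sum>i<d. (if i = 0 then 1 else 0 :: real)\<^sup>2) = (\<Sum>i<d. (if i = 0 then 1 else 0 :: real))"
      by (rule sum.cong) auto
    also have "\<dots> = 1" using d by (simp add: sum.delta)
    finally have "(\<lambda>i. if i = 0 then 1 else 0) \<in> K" unfolding K_def using d by auto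
    then show ?thesis by blast
  qed
  ultimately obtain a0 where a0: "a0 \<in> K" "\<And>a. a \<in> K \<Longrightarrow> q a0 \<le> q a"
    using continuous_attains_inf by metis
  define u where "u = vec d a0"
  define m where "m = q a0"
  have u: "u \<in> carrier_vec d" unfolding u_def by simp
  have nu: "vnorm u = 1"
    using a0(1) unfolding u_def K_def by (simp add: vnorm_eq_L2[of _ d] L2_set_def atLeast0LessThan)
  have m_le: "m * (vnorm v)\<^sup>2 \<le> v \<bullet> (A *\<^sub>v v)" if v: "v \<in> carrier_vec d" for v
  proof (cases "v = 0\<^sub>v d")
    case True
    then show ?thesis using A by (simp add: vnorm_def scalar_prod_def)
  next
    case False
    then have pos: "vnorm v > 0" using v vnorm_pos by blast
    define w where "w = (1 / vnorm v) \<cdot>\<^sub>v v"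
    have w: "w \<in> carrier_vec d" "vnorm w = 1" "v = vnorm v \<cdot>\<^sub>v w"
      using v pos unfolding w_def by (auto simp: vnorm_smult)
    define a where "a i = (if i < d then w $ i else 0)" for i
    have vw: "vec d a = w" using w unfolding a_def by auto
    have s1: "(\<Sum>i<d. (a i)\<^sup>2) = 1"
    proof -
      have "sqrt (\<Sum>i<d. (w $ i)\<^sup>2) = 1" using w by (simp add: vnorm_eq_L2[of _ d] L2_set_def atLeast0LessThan)
      then show ?thesis unfolding a_def by simp
    qed
    have "\<bar>a i\<bar> \<le> 1" if "i < d" for i
    proof -
      have "(a i)\<^sup>2 \<le> (\<Sum>i<d. (a i)\<^sup>2)" by (rule member_le_sum) (use that in auto)
      then show ?thesis using s1 by (simp add: abs_square_le_1)
    qed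
    then have "a \<in> K" using s1 unfolding K_def by (auto simp: a_def abs_le_iff)
    then have "m \<le> w \<bullet> (A *\<^sub>v w)" using a0(2)[of a] unfolding m_def q_def vw by simp
    moreover have "v \<bullet> (A *\<^sub>v v) = (vnorm v)\<^sup>2 * (w \<bullet> (A *\<^sub>v w))"
    proof -
      have "(c \<cdot>\<^sub>v w) \<bullet> (A *\<^sub>v (c \<cdot>\<^sub>v w)) = c\<^sup>2 * (w \<bullet> (A *\<^sub>v w))" for c
        using A w by (simp add: mult_mat_vec[OF A w(1)] power2_eq_square)
      from this[of "vnorm v"] show ?thesis unfolding w(3)[symmetric] .
    qed
    ultimately show ?thesis by (simp add: mult.commute mult_left_mono[of m "w \<bullet> (A *\<^sub>v w)" "(vnorm v)\<^sup>2", unfolded mult.commute[of "(vnorm v)\<^sup>2"]])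
  qed
  have mu: "u \<bullet> (A *\<^sub>v u) = m" unfolding m_def q_def u_def ..
  define L where "L a = emb (A *\<^sub>v proj d a)" for a
  have L: "linear L"
    by (rule linearI)
      (simp_all add: L_def proj_arith emb_arith mult_add_distrib_mat_vec[OF A] mult_mat_vec[OF A])
  have innerL: "inner a (L b) = proj d a \<bullet> (A *\<^sub>v proj d b)" for a b
    using A unfolding L_def by (subst inner_commute) (simp add: inner_emb_left[of _ d] comm_scalar_prod[of _ d])
  have symL: "inner a (L b) = inner (L a) b" for a b
    using sym[of "proj d a" "proj d b"] A unfolding innerL inner_commute[of "L a"]
    by (simp add: comm_scalar_prod[of _ d])
  have "L (emb u) = m *\<^sub>R emb u"
  proof (rule Rayleigh_minimizer_is_eigenvector[OF L symL])
    show "inner (emb u) (L (emb u)) = m * (norm (emb u))\<^sup>2" using u nu mu by (simp add: innerL)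
    fix t
    define w where "w = emb u + t *\<^sub>R (L (emb u) - m *\<^sub>R emb u)"
    have "w = emb (u + t \<cdot>\<^sub>v (A *\<^sub>v u - m \<cdot>\<^sub>v u))"
      unfolding w_def L_def using u A by (simp add: emb_arith)
    \<comment> \<open>The test vector lies in the image of \<open>emb\<close>. There its norm agrees
      with the norm of its truncation, so that \<open>m_le\<close> applies.\<close>
    then have "w = emb (proj d w)" using u A by simp
    then have "m * (norm w)\<^sup>2 \<le> inner w (L w)" using m_le[of "proj d w"] unfolding innerL by (metis norm_emb proj_carrier)
    then show "m * (norm (emb u + t *\<^sub>R (L (emb u) - m *\<^sub>R emb u)))\<^sup>2
      \<le> inner (emb u + t *\<^sub>R (L (emb u) - m *\<^sub>R emb u)) (L (emb u + t *\<^sub>R (L (emb u) - m *\<^sub>R emb u)))"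
      unfolding w_def .
  qed
  then have Au: "A *\<^sub>v u = m \<cdot>\<^sub>v u"
    using u A emb_inject[of "A *\<^sub>v u" d "m \<cdot>\<^sub>v u"] unfolding L_def by (simp add: emb_arith)
  have "lambda_min A = m" unfolding lambda_min_def
  proof (rule Min_eqI)
    \<comment> \<open>\<open>Min\<close> has its meaning on finite nonempty sets: finiteness comes
      from the characteristic polynomial, nonemptiness from \<open>u\<close>.\<close>
    have "char_poly A \<noteq> 0" using degree_monic_char_poly[OF A] by auto
    then show "finite {k. eigenvalue A k}"
      using poly_roots_finite[of "char_poly A"] unfolding eigenvalue_root_char_poly[OF A] by simp
    have "u \<noteq> 0\<^sub>v d" using nu by (auto simp: vnorm_def)
    then show "m \<in> {k. eigenvalue A k}"
      using Au u A unfolding eigenvalue_def eigenvector_def by auto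
    fix k assume "k \<in> {k. eigenvalue A k}"
    then obtain v where v: "v \<in> carrier_vec d" "v \<noteq> 0\<^sub>v d" "A *\<^sub>v v = k \<cdot>\<^sub>v v"
      using A unfolding eigenvalue_def eigenvector_def by auto
    have "v \<bullet> (A *\<^sub>v v) = k * (vnorm v)\<^sup>2"
      using v inner_emb[of v d v] by (simp add: norm_emb[symmetric] power2_norm_eq_inner del: norm_emb)
    then have "m * (vnorm v)\<^sup>2 \<le> k * (vnorm v)\<^sup>2" using m_le[OF v(1)] by simp
    then show "m \<le> k" using vnorm_pos[OF v(1,2)] by simp
  qed
  then show "\<exists>u\<in>carrier_vec d. vnorm u = 1 \<and> A *\<^sub>v u = lambda_min A \<cdot>\<^sub>v u"
    and "v \<in> carrier_vec d \<Longrightarrow> lambda_min A * (vnorm v)\<^sup>2 \<le> v \<bullet> (A *\<^sub>v v)"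
    using u nu Au m_le by auto
qed

text \<open>Replaces a bound on an eigenvalue by inequalities each of which is continuous in the
  matrix; the measurability of the set of saddles rests on this form.\<close>

lemma lambda_min_ge_iff:
  assumes A: "A \<in> carrier_mat d d" and d: "d \<ge> 1"
    and sym: "\<And>u v. u \<in> carrier_vec d \<Longrightarrow> v \<in> carrier_vec d \<Longrightarrow> u \<bullet> (A *\<^sub>v v) = (A *\<^sub>v u) \<bullet> v"
  shows "k \<le> lambda_min A \<longleftrightarrow> (\<forall>v\<in>carrier_vec d. k * (vnorm v)\<^sup>2 \<le> v \<bullet> (A *\<^sub>v v))"
proof
  assume k: "k \<le> lambda_min A"
  show "\<forall>v\<in>carrier_vec d. k * (vnorm v)\<^sup>2 \<le> v \<bullet> (A *\<^sub>v v)"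
  proof
    fix v :: "real vec" assume "v \<in> carrier_vec d"
    from lambda_min_Rayleigh(2)[OF A d sym this] k
    show "k * (vnorm v)\<^sup>2 \<le> v \<bullet> (A *\<^sub>v v)" by (smt (verit) mult_right_mono zero_le_power2)
  qed
next
  assume *: "\<forall>v\<in>carrier_vec d. k * (vnorm v)\<^sup>2 \<le> v \<bullet> (A *\<^sub>v v)"
  obtain u where u: "u \<in> carrier_vec d" "vnorm u = 1" "A *\<^sub>v u = lambda_min A \<cdot>\<^sub>v u"
    using lambda_min_Rayleigh(1)[OF A d sym] by blast
  have "u \<bullet> (A *\<^sub>v u) = lambda_min A"
    using u inner_emb[of u d u] by (simp add: norm_emb[symmetric] norm_eq_sqrt_inner del: norm_emb)
  then show "k \<le> lambda_min A" using * u by force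
qed

lemma hessian_symmetric:
  assumes g: "gradient_Lipschitz d l f" and h: "hessian_Lipschitz d \<rho> f" and pos: "0 < l" "0 < \<rho>"
    and x: "x \<in> carrier_vec d" and u: "u \<in> carrier_vec d" and v: "v \<in> carrier_vec d"
  shows "u \<bullet> (hessian d f x *\<^sub>v v) = (hessian d f x *\<^sub>v u) \<bullet> v"
proof -
  interpret smooth_function "f \<circ> proj d" "\<lambda>a. emb (grad d f (proj d a))"
    "\<lambda>a h. emb (hessian d f (proj d a) *\<^sub>v proj d h)" l \<rho>
    by (rule smooth_function_embedded[OF g h pos])
  have "hessian d f x \<in> carrier_mat d d"
    using hessian_carrier h x unfolding hessian_Lipschitz_def by blast
  then show ?thesis using symmetric_H[of "emb x" "emb u" "emb v"] x u v by (simp add: inner_emb[of _ d])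
qed

section \<open>Sets that are thin in one direction\<close>

text \<open>The packing argument shifts sets out of the cube. It therefore needs a translation
  invariant measure, of which the product of the uniform measures is only the restriction to the
  cube.\<close>

lemma uniform_cube_eq:
  assumes J: "finite J"
  shows "(\<Pi>\<^sub>M j\<in>J. uniform_measure lborel {0..1::real})
    = uniform_measure (\<Pi>\<^sub>M j\<in>J. lborel) (PiE J (\<lambda>_. {0..1}))"
proof -
  interpret U: product_prob_space "\<lambda>_. uniform_measure lborel {0..1::real}" J
    by (intro product_prob_spaceI prob_space_uniform_measure) auto
  interpret L: product_sigma_finite "\<lambda>_. lborel :: real measure" by standard
  have Q: "PiE J (\<lambda>_. {0..1::real}) \<in> sets (\<Pi>\<^sub>M j\<in>J. lborel)" using J by (intro sets_PiM_I_finite) auto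
  have e1: "emeasure (\<Pi>\<^sub>M j\<in>J. lborel) (PiE J (\<lambda>_. {0..1::real})) = 1"
    using J by (subst L.emeasure_PiM) auto
  show ?thesis
  proof (rule sym, rule U.PiM_eqI[OF J])
    show "sets (uniform_measure (\<Pi>\<^sub>M j\<in>J. lborel) (PiE J (\<lambda>_. {0..1})))
      = sets (\<Pi>\<^sub>M j\<in>J. uniform_measure lborel {0..1::real})"
      unfolding sets_uniform_measure by (rule sets_PiM_cong) simp_all
    fix A assume "\<And>j. j \<in> J \<Longrightarrow> A j \<in> sets (uniform_measure lborel {0..1::real})"
    then have A: "\<And>j. j \<in> J \<Longrightarrow> A j \<in> sets borel" by simp
    have "PiE J A \<in> sets (\<Pi>\<^sub>M j\<in>J. lborel)" using J A by (intro sets_PiM_I_finite) auto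
    then have "emeasure (uniform_measure (\<Pi>\<^sub>M j\<in>J. lborel) (PiE J (\<lambda>_. {0..1}))) (PiE J A)
      = emeasure (\<Pi>\<^sub>M j\<in>J. lborel) (PiE J (\<lambda>_. {0..1}) \<inter> PiE J A)"
      using Q e1 by (simp add: divide_ennreal_def)
    also have "PiE J (\<lambda>_. {0..1}) \<inter> PiE J A = PiE J (\<lambda>j. {0..1} \<inter> A j)" by (rule PiE_Int)
    also have "emeasure (\<Pi>\<^sub>M j\<in>J. lborel) \<dots> = (\<Prod>j\<in>J. emeasure lborel ({0..1} \<inter> A j))"
      using J A by (subst L.emeasure_PiM) auto
    also have "\<dots> = (\<Prod>j\<in>J. emeasure (uniform_measure lborel {0..1}) (A j))"
      using A by (intro prod.cong refl) (simp add: divide_ennreal_def)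
    finally show "emeasure (uniform_measure (\<Pi>\<^sub>M j\<in>J. lborel) (PiE J (\<lambda>_. {0..1}))) (PiE J A)
      = (\<Prod>j\<in>J. emeasure (uniform_measure lborel {0..1}) (A j))" .
  qed
qed

lemma measurable_translate:
  "(\<lambda>u. \<lambda>j\<in>J. u j + c j) \<in> measurable (\<Pi>\<^sub>M j\<in>J. lborel) (\<Pi>\<^sub>M j\<in>J. lborel :: real measure)"
  by (rule measurable_restrict) (auto simp: measurable_lborel1)

text \<open>Invariance is checked on boxes, which determine the product measure.\<close>

lemma distr_PiM_lborel_translate:
  assumes J: "finite J"
  shows "distr (\<Pi>\<^sub>M j\<in>J. lborel) (\<Pi>\<^sub>M j\<in>J. lborel) (\<lambda>u. \<lambda>j\<in>J. u j + c j) = (\<Pi>\<^sub>M j\<in>J. lborel :: real measure)"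
proof -
  interpret L: product_sigma_finite "\<lambda>_. lborel :: real measure" by standard
  show ?thesis
  proof (rule L.PiM_eqI[OF J])
    fix A assume "\<And>j. j \<in> J \<Longrightarrow> A j \<in> sets (lborel :: real measure)"
    then have A: "\<And>j. j \<in> J \<Longrightarrow> A j \<in> sets borel" by simp
    have PA: "PiE J A \<in> sets (\<Pi>\<^sub>M j\<in>J. lborel)" using J A by (intro sets_PiM_I_finite) auto
    have pre: "(\<lambda>x. c j + x) -` A j \<in> sets borel" if "j \<in> J" for j
      using measurable_sets[of "\<lambda>x. c j + x" borel borel "A j"] A[OF that] by simp
    have "(\<lambda>u. \<lambda>j\<in>J. u j + c j) -` PiE J A \<inter> space (\<Pi>\<^sub>M j\<in>J. lborel) = PiE J (\<lambda>j. (\<lambda>x. c j + x) -` A j)"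
      by (auto simp: space_PiM PiE_iff add.commute)
    then have "emeasure (distr (\<Pi>\<^sub>M j\<in>J. lborel) (\<Pi>\<^sub>M j\<in>J. lborel) (\<lambda>u. \<lambda>j\<in>J. u j + c j)) (PiE J A)
      = emeasure (\<Pi>\<^sub>M j\<in>J. lborel) (PiE J (\<lambda>j. (\<lambda>x. c j + x) -` A j))"
      using PA by (simp add: emeasure_distr[OF measurable_translate])
    also have "\<dots> = (\<Prod>j\<in>J. emeasure lborel ((\<lambda>x. c j + x) -` A j))"
      using pre by (subst L.emeasure_PiM[OF J]) auto
    also have "\<dots> = (\<Prod>j\<in>J. emeasure lborel (A j))"
    proof (rule prod.cong[OF refl])
      fix j assume "j \<in> J"
      then have "emeasure (distr lborel borel ((+) (c j))) (A j) = emeasure lborel ((\<lambda>x. c j + x) -` A j)"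
        using A by (subst emeasure_distr) auto
      then show "emeasure lborel ((\<lambda>x. c j + x) -` A j) = emeasure lborel (A j)"
        by (simp add: lborel_distr_plus)
    qed
    finally show "emeasure (distr (\<Pi>\<^sub>M j\<in>J. lborel) (\<Pi>\<^sub>M j\<in>J. lborel) (\<lambda>u. \<lambda>j\<in>J. u j + c j)) (PiE J A)
      = (\<Prod>j\<in>J. emeasure lborel (A j))" .
  qed simp
qed

text \<open>
  Disjoint translates of a thin set along the given direction pack into a slightly enlarged cube;
  a total shift of \<open>1 / sqrt (card J)\<close> enlarges the volume by a factor of at most \<open>e\<close>.
\<close>

lemma emeasure_thin_set_le:
  fixes v :: "'i \<Rightarrow> real"
  assumes J: "finite J" "J \<noteq> {}" and S: "S \<in> sets (\<Pi>\<^sub>M j\<in>J. lborel)" "S \<subseteq> PiE J (\<lambda>_. {0..1})"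
    and v: "(\<Sum>j\<in>J. (v j)\<^sup>2) \<le> 1" and \<theta>: "\<theta> > 0"
    and thin: "\<And>u s. u \<in> S \<Longrightarrow> (\<lambda>j\<in>J. u j + s * v j) \<in> S \<Longrightarrow> \<bar>s\<bar> < \<theta>"
  shows "emeasure (\<Pi>\<^sub>M j\<in>J. lborel) S \<le> ennreal (exp 1 * sqrt (card J) * \<theta>)"
proof -
  interpret L: product_sigma_finite "\<lambda>_. lborel :: real measure" by standard
  let ?L = "\<Pi>\<^sub>M j\<in>J. lborel :: real measure"
  \<comment> \<open>By Cauchy-Schwarz the numbers \<open>\<bar>B * v j\<bar>\<close> then sum to at
    most 1, so the product of the side lengths \<open>1 + \<bar>B * v j\<bar>\<close> is at most
    \<open>exp 1\<close>.\<close>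
  define B where "B = 1 / sqrt (card J)"
  have cJ: "card J > 0" using J by (simp add: card_gt_0_iff)
  have B: "B > 0" unfolding B_def using cJ by simp
  \<comment> \<open>There are \<open>N + 1\<close> translates, the unshifted set included. The last
    shift is at most \<open>B\<close>, and \<open>N + 1\<close> is at least
    \<open>B / \<theta>\<close>, so the rounding costs nothing.\<close>
  define N where "N = nat \<lfloor>B / \<theta>\<rfloor>"
  have N1: "real N * \<theta> \<le> B"
  proof -
    have "real N \<le> B / \<theta>" unfolding N_def using B \<theta> by simp
    then show ?thesis using \<theta> by (simp add: pos_le_divide_eq)
  qed
  have N2: "B / \<theta> \<le> real (Suc N)"
  proof -
    have "B / \<theta> \<ge> 0" using B \<theta> by simp
    then show ?thesis unfolding N_def by linarith
  qed
  \<comment> \<open>Preimages under the shift by \<open>- k \<theta> v\<close> are the translates by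
    \<open>+ k \<theta> v\<close>.\<close>
  define sh where "sh k u = (\<lambda>j\<in>J. u j + - (real k * \<theta> * v j))" for k :: nat and u :: "'i \<Rightarrow> real"
  define T where "T k = sh k -` S \<inter> space ?L" for k
  have shm: "sh k \<in> measurable ?L ?L" for k unfolding sh_def by (rule measurable_translate)
  have Tm: "T k \<in> sets ?L" for k unfolding T_def using shm S(1) by (rule measurable_sets)
  have ST: "emeasure ?L (T k) = emeasure ?L S" for k
    using emeasure_distr[OF shm S(1), of k] distr_PiM_lborel_translate[OF J(1), of "\<lambda>j. - (real k * \<theta> * v j)"]
    unfolding T_def sh_def by simp
  have disj: "disjoint_family_on T {..N}"
    unfolding disjoint_family_on_def
  proof (intro ballI impI equals0I)
    fix k m u assume km: "k \<in> {..N}" "m \<in> {..N}" "k \<noteq> m" and u: "u \<in> T k \<inter> T m"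
    define p where "p = sh k u"
    have p: "p \<in> S" using u unfolding p_def T_def by simp
    have "(\<lambda>j\<in>J. p j + ((real k - real m) * \<theta>) * v j) = sh m u"
      unfolding p_def sh_def by (auto simp: algebra_simps)
    then have "\<bar>(real k - real m) * \<theta>\<bar> < \<theta>" using u thin[OF p, of "(real k - real m) * \<theta>"] unfolding T_def by simp
    then have "\<bar>real k - real m\<bar> < 1" using \<theta> by (simp add: abs_mult)
    then show False using km by linarith
  qed
  define Q where "Q = PiE J (\<lambda>j. {min 0 (B * v j) .. 1 + max 0 (B * v j)})"
  have Qm: "Q \<in> sets ?L" unfolding Q_def using J by (intro sets_PiM_I_finite) auto
  have TQ: "T k \<subseteq> Q" if "k \<le> N" for k
  proof
    fix u assume u: "u \<in> T k"
    define r where "r = real k * \<theta>"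
    have rN: "r \<le> real N * \<theta>" unfolding r_def using that \<theta> by (intro mult_right_mono) auto
    have r: "0 \<le> r" using \<theta> unfolding r_def by simp
    have rB: "r \<le> B" using rN N1 by linarith
    have "u j \<in> {min 0 (B * v j) .. 1 + max 0 (B * v j)}" if j: "j \<in> J" for j
    proof -
      have "sh k u \<in> PiE J (\<lambda>_. {0..1})" using u S(2) unfolding T_def by auto
      then have "sh k u j \<in> {0..1}" using j by auto
      then have 1: "0 \<le> u j - r * v j" "u j - r * v j \<le> 1" using j unfolding sh_def r_def by auto
      have "min 0 (B * v j) \<le> r * v j \<and> r * v j \<le> max 0 (B * v j)"
      proof (cases "v j \<ge> 0")
        case True
        then show ?thesis using r rB mult_right_mono[of r B "v j"] by (auto simp: min_def max_def)
      next
        case False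
        then show ?thesis using r rB mult_right_mono_neg[of r B "v j"] mult_nonneg_nonpos[of r "v j"] mult_pos_neg[of B "v j"] B
          by (auto simp: min_def max_def)
      qed
      then show ?thesis using 1 by auto
    qed
    then show "u \<in> Q" using u unfolding Q_def T_def by (auto simp: space_PiM PiE_iff)
  qed
  have "emeasure ?L Q = (\<Prod>j\<in>J. ennreal (1 + \<bar>B * v j\<bar>))"
    unfolding Q_def by (subst L.emeasure_PiM[OF J(1)]) (auto intro!: prod.cong simp: min_def max_def simp del: ennreal_plus)
  also have "\<dots> = ennreal (\<Prod>j\<in>J. 1 + \<bar>B * v j\<bar>)" by (rule prod_ennreal) simp
  also have "\<dots> \<le> ennreal (exp 1)"
  proof (rule ennreal_leI)
    have "(\<Prod>j\<in>J. 1 + \<bar>B * v j\<bar>) \<le> (\<Prod>j\<in>J. exp \<bar>B * v j\<bar>)"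
      by (rule prod_mono) (auto intro: exp_ge_add_one_self)
    also have "\<dots> = exp (\<Sum>j\<in>J. \<bar>B\<bar> * \<bar>v j\<bar>)" using J by (simp add: exp_sum abs_mult)
    also have "\<dots> \<le> exp 1"
    proof -
      have "(\<Sum>j\<in>J. \<bar>B\<bar> * \<bar>v j\<bar>) \<le> L2_set (\<lambda>_. B) J * L2_set v J" by (rule L2_set_mult_ineq)
      also have "\<dots> \<le> L2_set (\<lambda>_. B) J * 1"
        using v by (intro mult_left_mono) (auto simp: L2_set_def)
      also have "\<dots> = 1" using cJ unfolding L2_set_def B_def by (simp add: power_divide)
      finally show ?thesis by simp
    qed
    finally show "(\<Prod>j\<in>J. 1 + \<bar>B * v j\<bar>) \<le> exp 1" .
  qed
  finally have Qe: "emeasure ?L Q \<le> ennreal (exp 1)" .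
  have "(\<Sum>k\<in>{..N}. emeasure ?L (T k)) = emeasure ?L (\<Union>k\<in>{..N}. T k)"
    by (rule sum_emeasure) (use Tm disj in auto)
  also have "\<dots> \<le> emeasure ?L Q" by (rule emeasure_mono) (use TQ Qm in auto)
  finally have main: "of_nat (Suc N) * emeasure ?L S \<le> ennreal (exp 1)" using Qe ST by simp
  \<comment> \<open>Rules out an infinite measure, so that the division by the number of translates
    can take place in the reals.\<close>
  have "emeasure ?L S \<le> of_nat (Suc N) * emeasure ?L S"
    using mult_right_mono[of 1 "of_nat (Suc N)" "emeasure ?L S"] by simp
  also have "\<dots> < \<infinity>" using order_le_less_trans[OF main, of \<infinity>] by simp
  finally obtain x where x: "x \<ge> 0" "emeasure ?L S = ennreal x" by (cases "emeasure ?L S") auto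
  have "ennreal (real (Suc N) * x) \<le> ennreal (exp 1)"
    using main x by (simp add: ennreal_mult' ennreal_of_nat_eq_real_of_nat del: of_nat_Suc)
  then have "real (Suc N) * x \<le> exp 1" by (simp add: ennreal_le_iff)
  moreover have "B / \<theta> * x \<le> real (Suc N) * x" using N2 x by (intro mult_right_mono) auto
  ultimately have "B / \<theta> * x \<le> exp 1" by linarith
  then have "x \<le> exp 1 * sqrt (card J) * \<theta>"
    using \<theta> cJ unfolding B_def by (simp add: field_simps)
  then show ?thesis unfolding x by (rule ennreal_leI)
qed

text \<open>Only the part of \<open>S\<close> inside the cube has mass, so thinness needs to be
  checked only for pairs of points of the cube. In the application this keeps both starting points
  within distance \<open>r\<close> of the base point.\<close>

lemma emeasure_uniform_cube_thin_set_le: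
  fixes v :: "'i \<Rightarrow> real"
  assumes J: "finite J" "J \<noteq> {}" and S: "S \<in> sets (\<Pi>\<^sub>M j\<in>J. uniform_measure lborel {0..1})"
    and v: "(\<Sum>j\<in>J. (v j)\<^sup>2) \<le> 1" and \<theta>: "\<theta> > 0"
    and thin: "\<And>u s. u \<in> S \<Longrightarrow> (\<lambda>j\<in>J. u j + s * v j) \<in> S \<Longrightarrow> (\<forall>j\<in>J. u j \<in> {0..1}) \<Longrightarrow>
      (\<forall>j\<in>J. u j + s * v j \<in> {0..1}) \<Longrightarrow> \<bar>s\<bar> < \<theta>"
  shows "emeasure (\<Pi>\<^sub>M j\<in>J. uniform_measure lborel {0..1}) S \<le> ennreal (exp 1 * sqrt (card J) * \<theta>)"
proof -
  interpret L: product_sigma_finite "\<lambda>_. lborel :: real measure" by standard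
  let ?L = "\<Pi>\<^sub>M j\<in>J. lborel :: real measure"
  let ?Q = "PiE J (\<lambda>_. {0..1::real})"
  have Q: "?Q \<in> sets ?L" using J by (intro sets_PiM_I_finite) auto
  have e1: "emeasure ?L ?Q = 1" using J by (subst L.emeasure_PiM) auto
  have S': "S \<in> sets ?L" using S by (simp cong: sets_PiM_cong)
  have "emeasure (\<Pi>\<^sub>M j\<in>J. uniform_measure lborel {0..1}) S = emeasure ?L (?Q \<inter> S)"
    unfolding uniform_cube_eq[OF J(1)] using Q S' e1 by (simp add: divide_ennreal_def)
  also have "\<dots> \<le> ennreal (exp 1 * sqrt (card J) * \<theta>)"
  proof (rule emeasure_thin_set_le[OF J _ _ v \<theta>])
    fix u s assume "u \<in> ?Q \<inter> S" "(\<lambda>j\<in>J. u j + s * v j) \<in> ?Q \<inter> S"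
    then show "\<bar>s\<bar> < \<theta>" by (intro thin[of u s]) (auto simp: PiE_iff)
  qed (use Q S' in auto)
  finally show ?thesis .
qed

section \<open>Resampling finitely many coordinates of a product measure\<close>

text \<open>The coordinates in \<open>J\<close> are independent of the others, so overwriting them
  with a fresh sample preserves the law; the formula is Fubini for the two groups. Integrating over
  the full \<open>\<omega>\<close>, whose \<open>J\<close>-coordinates are overwritten, avoids
  functions on the complement of \<open>J\<close> in the statement.\<close>

lemma emeasure_PiM_resample:
  fixes M :: "'i \<Rightarrow> 'a measure"
  assumes M: "\<And>i. prob_space (M i)" and J: "finite J" and A: "A \<in> sets (PiM UNIV M)"
  shows "emeasure (PiM UNIV M) A
    = (\<integral>\<^sup>+\<omega>. emeasure (PiM J M) {u \<in> space (PiM J M). (\<lambda>i. if i \<in> J then u i else \<omega> i) \<in> A} \<partial>PiM UNIV M)"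
    and "\<And>\<omega>. \<omega> \<in> space (PiM UNIV M) \<Longrightarrow>
      {u \<in> space (PiM J M). (\<lambda>i. if i \<in> J then u i else \<omega> i) \<in> A} \<in> sets (PiM J M)"
proof -
  interpret N: product_prob_space M UNIV by (intro product_prob_spaceI M)
  interpret PJ: prob_space "PiM J M" by (rule prob_space_PiM[OF M])
  let ?N = "PiM UNIV M"
  let ?X = "\<lambda>\<omega>. restrict \<omega> J" and ?Y = "\<lambda>\<omega>. restrict \<omega> (- J)"
  have "N.P.indep_vars M (\<lambda>i \<omega>. \<omega> i) UNIV"
  proof (subst N.P.indep_vars_iff_distr_eq_PiM)
    have "distr ?N ?N (\<lambda>x. \<lambda>i\<in>UNIV. x i) = ?N" by (simp add: restrict_UNIV)
    also have "\<dots> = (\<Pi>\<^sub>M i\<in>UNIV. distr ?N (M i) (\<lambda>\<omega>. \<omega> i))" by (simp add: N.PiM_component)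
    finally show "distr ?N ?N (\<lambda>x. \<lambda>i\<in>UNIV. x i) = (\<Pi>\<^sub>M i\<in>UNIV. distr ?N (M i) (\<lambda>\<omega>. \<omega> i))" .
  qed auto
  from N.P.indep_var_restrict[OF this, of J "- J"]
  have ind: "N.P.indep_var (PiM J M) ?X (PiM (- J) M) ?Y" by simp
  let ?T = "distr ?N (PiM (- J) M) ?Y"
  have XJ: "distr ?N (PiM J M) ?X = PiM J M" by (rule N.distr_PiM_restrict_finite[OF J]) simp
  have Ym: "?Y \<in> measurable ?N (PiM (- J) M)" by (rule measurable_restrict_subset) simp
  have Xm: "?X \<in> measurable ?N (PiM J M)" by (rule measurable_restrict_subset) simp
  interpret T: prob_space ?T by (rule N.P.prob_space_distr[OF Ym])
  interpret JT: pair_prob_space "PiM J M" ?T ..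
  have joint: "PiM J M \<Otimes>\<^sub>M ?T = distr ?N (PiM J M \<Otimes>\<^sub>M PiM (- J) M) (\<lambda>\<omega>. (?X \<omega>, ?Y \<omega>))"
    using ind unfolding N.P.indep_var_distribution_eq XJ by simp
  have mm: "merge J (- J) \<in> measurable (PiM J M \<Otimes>\<^sub>M PiM (- J) M) ?N"
    using measurable_merge[of J "- J" M] by simp
  define A' where "A' = merge J (- J) -` A \<inter> space (PiM J M \<Otimes>\<^sub>M PiM (- J) M)"
  have A'm: "A' \<in> sets (PiM J M \<Otimes>\<^sub>M PiM (- J) M)" unfolding A'_def using mm A by (rule measurable_sets)
  then have A'm2: "A' \<in> sets (PiM J M \<Otimes>\<^sub>M ?T)" by simp
  have mrg: "merge J (- J) (u, ?Y \<omega>) = (\<lambda>i. if i \<in> J then u i else \<omega> i)"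
    "merge J (- J) (u, \<omega>) = (\<lambda>i. if i \<in> J then u i else \<omega> i)" for u \<omega>
    by (auto simp: merge_def fun_eq_iff)
  have sec: "(\<lambda>u. (u, ?Y \<omega>)) -` A' = {u \<in> space (PiM J M). (\<lambda>i. if i \<in> J then u i else \<omega> i) \<in> A}"
    if "\<omega> \<in> space ?N" for \<omega>
    using measurable_space[OF Ym that] unfolding A'_def by (auto simp: mrg space_pair_measure)
  \<comment> \<open>Splitting a point into its two groups of coordinates and merging them gives the
    point back, so \<open>A\<close> is the preimage of \<open>A'\<close>.\<close>
  have "A = (\<lambda>\<omega>. (?X \<omega>, ?Y \<omega>)) -` A' \<inter> space ?N"
  proof -
    have "merge J (- J) (?X \<omega>, ?Y \<omega>) = \<omega>" for \<omega> :: "'i \<Rightarrow> 'a"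
      unfolding mrg by auto
    then show ?thesis
      using measurable_space[OF Ym] measurable_space[OF Xm] sets.sets_into_space[OF A]
      unfolding A'_def by (auto simp: space_pair_measure)
  qed
  then have "emeasure ?N A = emeasure (PiM J M \<Otimes>\<^sub>M ?T) A'"
    unfolding joint using A'm Xm Ym by (subst emeasure_distr) auto
  also have "\<dots> = (\<integral>\<^sup>+y. emeasure (PiM J M) ((\<lambda>u. (u, y)) -` A') \<partial>?T)"
    by (rule JT.emeasure_pair_measure_alt2[OF A'm2])
  also have "\<dots> = (\<integral>\<^sup>+\<omega>. emeasure (PiM J M) ((\<lambda>u. (u, ?Y \<omega>)) -` A') \<partial>?N)"
    using JT.measurable_emeasure_Pair2[OF A'm2] by (subst nn_integral_distr[OF Ym]) auto
  also have "\<dots> = (\<integral>\<^sup>+\<omega>. emeasure (PiM J M) {u \<in> space (PiM J M). (\<lambda>i. if i \<in> J then u i else \<omega> i) \<in> A} \<partial>?N)"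
    by (rule nn_integral_cong) (simp add: sec)
  finally show "emeasure ?N A
    = (\<integral>\<^sup>+\<omega>. emeasure (PiM J M) {u \<in> space (PiM J M). (\<lambda>i. if i \<in> J then u i else \<omega> i) \<in> A} \<partial>?N)" .
  fix \<omega> assume "\<omega> \<in> space ?N"
  then show "{u \<in> space (PiM J M). (\<lambda>i. if i \<in> J then u i else \<omega> i) \<in> A} \<in> sets (PiM J M)"
    using sets_Pair2[OF A'm, of "?Y \<omega>"] sec by simp
qed

text \<open>A bound on a conditional probability in terms of sections: \<open>B\<close> contains
  every outcome from which \<open>A\<close> can be reached by changing the coordinates in
  \<open>J\<close>, and on \<open>B\<close> the section of \<open>A\<close> has mass at most
  \<open>p\<close>. The measurability of the section is handed to the premise \<open>le\<close>,
  ready for use there.\<close>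

lemma emeasure_le_resample:
  fixes M :: "'i \<Rightarrow> 'a measure"
  assumes M: "\<And>i. prob_space (M i)" and J: "finite J"
    and A: "A \<in> sets (PiM UNIV M)" and B: "B \<in> sets (PiM UNIV M)"
    and le: "\<And>\<omega>. \<omega> \<in> B \<Longrightarrow>
      {u \<in> space (PiM J M). (\<lambda>i. if i \<in> J then u i else \<omega> i) \<in> A} \<in> sets (PiM J M) \<Longrightarrow>
      emeasure (PiM J M) {u \<in> space (PiM J M). (\<lambda>i. if i \<in> J then u i else \<omega> i) \<in> A} \<le> p"
    and zero: "\<And>\<omega> u. \<omega> \<in> space (PiM UNIV M) \<Longrightarrow> (\<lambda>i. if i \<in> J then u i else \<omega> i) \<in> A \<Longrightarrow> \<omega> \<in> B"
  shows "emeasure (PiM UNIV M) A \<le> p * emeasure (PiM UNIV M) B"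
proof -
  have "emeasure (PiM UNIV M) A
    = (\<integral>\<^sup>+\<omega>. emeasure (PiM J M) {u \<in> space (PiM J M). (\<lambda>i. if i \<in> J then u i else \<omega> i) \<in> A} \<partial>PiM UNIV M)"
    by (rule emeasure_PiM_resample(1)[OF M J A])
  also have "\<dots> \<le> (\<integral>\<^sup>+\<omega>. p * indicator B \<omega> \<partial>PiM UNIV M)"
  proof (rule nn_integral_mono)
    fix \<omega> assume \<omega>: "\<omega> \<in> space (PiM UNIV M)"
    show "emeasure (PiM J M) {u \<in> space (PiM J M). (\<lambda>i. if i \<in> J then u i else \<omega> i) \<in> A} \<le> p * indicator B \<omega>"
    proof (cases "\<omega> \<in> B")
      case True
      then show ?thesis using le[OF True emeasure_PiM_resample(2)[OF M J A \<omega>]] by simp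
    next
      case False
      then have eq: "{u \<in> space (PiM J M). (\<lambda>i. if i \<in> J then u i else \<omega> i) \<in> A} = {}" using zero[OF \<omega>] by blast
      show ?thesis unfolding eq by simp
    qed
  qed
  also have "\<dots> = p * emeasure (PiM UNIV M) B" using B by (simp add: nn_integral_cmult)
  finally show ?thesis .
qed

section \<open>Deterministic analysis of the algorithm\<close>

text \<open>Events of a run are written with these total selectors, and a run counts as measurable
  when each of them is. For a returned state \<open>state_current\<close> is the output; the history
  and the noise time are dummies.\<close>

fun state_running :: "pgdot_state \<Rightarrow> bool" where
  "state_running (Running xs x tn y) = True"
| "state_running (Returned n y) = False"

fun state_history :: "pgdot_state \<Rightarrow> real vec list" where
  "state_history (Running xs x tn y) = xs"
| "state_history (Returned n y) = []"

fun state_current :: "pgdot_state \<Rightarrow> real vec" where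
  "state_current (Running xs x tn y) = x"
| "state_current (Returned n y) = y"

fun state_noise_time :: "pgdot_state \<Rightarrow> int" where
  "state_noise_time (Running xs x tn y) = tn"
| "state_noise_time (Returned n y) = 0"

fun state_base :: "pgdot_state \<Rightarrow> real vec" where
  "state_base (Running xs x tn y) = y"
| "state_base (Returned n y) = y"

fun state_passes :: "pgdot_state \<Rightarrow> nat" where
  "state_passes (Running xs x tn y) = length xs"
| "state_passes (Returned n y) = n"

lemma perturb_cong:
  "(\<And>i k. \<omega> (length xs, i, k) = \<omega>' (length xs, i, k)) \<Longrightarrow> perturb d w r \<omega> xs x = perturb d w r \<omega>' xs x"
  unfolding perturb_def by simp

lemma perturb_carrier [simp]: "perturb d w r \<omega> xs x \<in> carrier_vec d"
  unfolding perturb_def by simp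

text \<open>With \<open>\<gamma>\<close> as an opaque parameter, \<open>\<epsilon>\<close> can be
  eliminated through \<open>\<epsilon>_eq\<close>; the thresholds \<open>F\<close> and
  \<open>r\<close> then become monomials in \<open>\<gamma>\<close>, which simplification can
  compare.\<close>

locale pgdot =
  fixes d :: nat and f :: "real vec \<Rightarrow> real" and w :: "nat \<Rightarrow> real" and x0 :: "real vec"
    and l \<rho> \<epsilon> c \<delta> \<Delta>f \<gamma> :: real
  assumes \<gamma>_eq: "\<gamma> = sqrt (\<rho> * \<epsilon>)" and d_pos: "d \<ge> 1" and l_pos: "0 < l" and \<rho>_pos: "0 < \<rho>" and \<epsilon>_pos: "0 < \<epsilon>"
    and c_pos: "0 < c" and c_small: "c \<le> 1 / 100000" and \<delta>_pos: "0 < \<delta>"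
    and gradient_lip: "gradient_Lipschitz d l f" and hessian_lip: "hessian_Lipschitz d \<rho> f"
    and minimum: "has_minimum d f" and x0_carrier: "x0 \<in> carrier_vec d"
    and \<epsilon>_small: "\<epsilon> \<le> l\<^sup>2 / \<rho>" and \<Delta>f_ge: "\<Delta>f \<ge> f x0 - fstar d f"
begin

section \<open>Arithmetic of the thresholds\<close>

abbreviation "\<chi> \<equiv> chi d l \<epsilon> c \<delta> \<Delta>f"
abbreviation "g0 \<equiv> g_thres d l \<epsilon> c \<delta> \<Delta>f"
abbreviation "r \<equiv> radius d l \<epsilon> c \<delta> \<Delta>f"
abbreviation "F \<equiv> f_thres d l \<rho> \<epsilon> c \<delta> \<Delta>f"
abbreviation "T \<equiv> t_thres d l \<rho> \<epsilon> c \<delta> \<Delta>f"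
abbreviation "run \<equiv> pgdot_run d f w x0 l \<rho> \<epsilon> c \<delta> \<Delta>f"
abbreviation "gap \<equiv> f x0 - fstar d f"

definition gdv :: "real vec \<Rightarrow> real vec" where "gdv x = x - (c / l) \<cdot>\<^sub>v grad d f x"
text \<open>The decrease per pass that is guaranteed on average. The binding case is an epoch:
  \<open>\<kappa>\<close> is \<open>F\<close> divided by twice the upper bound
  \<open>2 * (\<chi> * l / (c\<^sup>2 * \<gamma>))\<close> for its \<open>T + 1\<close> passes. A
  plain gradient step above the gradient threshold gains at least \<open>2 / c\<close> times as
  much.\<close>

definition \<kappa> :: real where "\<kappa> = c ^ 3 * \<epsilon>\<^sup>2 / (4 * \<chi> ^ 4 * l)"

lemma differentiable: "differentiable_Rd d f"
  using gradient_lip unfolding gradient_Lipschitz_def by blast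

lemma twice_differentiable: "twice_differentiable_Rd d f"
  using hessian_lip unfolding hessian_Lipschitz_def by blast

sublocale E: smooth_function "f \<circ> proj d" "\<lambda>a. emb (grad d f (proj d a))"
    "\<lambda>a h. emb (hessian d f (proj d a) *\<^sub>v proj d h)" l \<rho>
  by (rule smooth_function_embedded[OF gradient_lip hessian_lip l_pos \<rho>_pos])

lemma chi_ge: "\<chi> \<ge> 12"
  unfolding chi_def by simp

lemma \<gamma>_pos: "\<gamma> > 0"
  unfolding \<gamma>_eq using \<rho>_pos \<epsilon>_pos by simp

lemma \<epsilon>_eq: "\<epsilon> = \<gamma>\<^sup>2 / \<rho>"
  unfolding \<gamma>_eq using \<rho>_pos \<epsilon>_pos by simp

lemma \<gamma>_le_l: "\<gamma> \<le> l"
proof -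
  have "\<gamma>\<^sup>2 \<le> l\<^sup>2" using \<epsilon>_small \<rho>_pos unfolding \<epsilon>_eq by (simp add: divide_le_cancel)
  then show ?thesis using l_pos by (simp add: power2_le_iff_abs_le)
qed

lemma F_eq: "F = c * \<gamma> ^ 3 / (\<rho>\<^sup>2 * \<chi> ^ 3)"
proof -
  have "sqrt (\<epsilon> ^ 3 / \<rho>) = \<gamma> ^ 3 / \<rho>\<^sup>2"
  proof (rule real_sqrt_unique)
    show "(\<gamma> ^ 3 / \<rho>\<^sup>2)\<^sup>2 = \<epsilon> ^ 3 / \<rho>" unfolding \<epsilon>_eq using \<rho>_pos by (simp add: field_simps eval_nat_numeral)
    show "\<gamma> ^ 3 / \<rho>\<^sup>2 \<ge> 0" using \<gamma>_pos by simp
  qed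
  then show ?thesis unfolding f_thres_def by simp
qed

lemma r_eq: "r = sqrt c * \<gamma>\<^sup>2 / (\<rho> * \<chi>\<^sup>2 * l)"
proof -
  define X where "X = \<chi>"
  show ?thesis unfolding radius_def X_def[symmetric] by (simp add: \<epsilon>_eq mult_ac)
qed

lemma g0_eq: "g0 = r * l"
  unfolding g_thres_def radius_def using l_pos by simp

lemma pos: "F > 0" "r > 0" "g0 > 0" "\<kappa> > 0" "\<chi> > 0"
  using c_pos \<gamma>_pos \<rho>_pos chi_ge l_pos \<epsilon>_pos unfolding F_eq g0_eq r_eq \<kappa>_def by auto

lemma T_arg: "\<chi> * l / (c\<^sup>2 * sqrt (\<rho> * \<epsilon>)) = \<chi> * l / (c\<^sup>2 * \<gamma>)"
  unfolding \<gamma>_eq ..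

text \<open>The argument of the ceiling is so large that rounding it up and adding 1 costs at most a
  factor 2.\<close>

lemma T_arg_ge: "12 \<le> \<chi> * l / (c\<^sup>2 * \<gamma>)"
proof -
  have "c\<^sup>2 \<le> 1" using c_pos c_small by (simp add: power_le_one)
  then have "c\<^sup>2 * \<gamma> \<le> 1 * l" using \<gamma>_le_l \<gamma>_pos by (intro mult_mono) auto
  then have "12 * (c\<^sup>2 * \<gamma>) \<le> \<chi> * l" using chi_ge l_pos c_pos \<gamma>_pos by (intro mult_mono) auto
  then show ?thesis using c_pos \<gamma>_pos by (simp add: pos_le_divide_eq)
qed

lemma T_bounds: "\<chi> * l / (c\<^sup>2 * \<gamma>) \<le> real_of_int T" "real_of_int T + 1 \<le> 2 * (\<chi> * l / (c\<^sup>2 * \<gamma>))" "T \<ge> 12"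
proof -
  show "\<chi> * l / (c\<^sup>2 * \<gamma>) \<le> real_of_int T"
    unfolding t_thres_def T_arg by simp
  then show "T \<ge> 12" using T_arg_ge by linarith
  show "real_of_int T + 1 \<le> 2 * (\<chi> * l / (c\<^sup>2 * \<gamma>))"
  proof -
    have "real_of_int \<lceil>A\<rceil> + 1 \<le> 2 * A" if "12 \<le> A" for A :: real using that by linarith
    from this[OF T_arg_ge] show ?thesis unfolding t_thres_def T_arg .
  qed
qed

lemma \<kappa>_epoch: "\<kappa> * (real_of_int T + 1) \<le> F"
proof -
  have "\<kappa> * (real_of_int T + 1) \<le> \<kappa> * (2 * (\<chi> * l / (c\<^sup>2 * \<gamma>)))"
    using T_bounds pos by (intro mult_left_mono) auto
  also have "\<dots> = F / 2"
  proof -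
    define X where "X = \<chi>"
    have "X > 0" unfolding X_def by (rule pos)
    then show ?thesis unfolding \<kappa>_def F_eq X_def[symmetric]
      using l_pos c_pos \<gamma>_pos \<rho>_pos by (simp add: \<epsilon>_eq field_simps eval_nat_numeral)
  qed
  finally show ?thesis using pos by linarith
qed

lemma \<kappa>_step: "\<kappa> \<le> c / l / 2 * g0\<^sup>2"
proof -
  have "c / l / 2 * g0\<^sup>2 = c\<^sup>2 * \<epsilon>\<^sup>2 / (2 * \<chi> ^ 4 * l)"
    unfolding g_thres_def using c_pos l_pos pos by (simp add: field_simps eval_nat_numeral)
  also have "\<dots> = 2 / c * \<kappa>" unfolding \<kappa>_def using c_pos l_pos pos by (simp add: field_simps eval_nat_numeral)
  also have "\<dots> \<ge> 1 * \<kappa>" using c_pos c_small pos by (intro mult_right_mono) (auto simp: field_simps)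
  finally show ?thesis by simp
qed

lemma \<eta>_bounds: "0 \<le> c / l" "c / l * l \<le> 1"
  using c_pos l_pos c_small by auto

lemma gdv_carrier [simp]: "x \<in> carrier_vec d \<Longrightarrow> gdv x \<in> carrier_vec d"
  unfolding gdv_def using grad_carrier[OF differentiable] by simp

lemma gdv_pow_carrier [simp]: "x \<in> carrier_vec d \<Longrightarrow> (gdv ^^ n) x \<in> carrier_vec d"
  by (induction n) auto

lemma emb_gdv: "x \<in> carrier_vec d \<Longrightarrow> emb (gdv x) = E.gd (c / l) (emb x)"
  unfolding gdv_def E.gd_def using grad_carrier[OF differentiable, of x] by (simp add: emb_arith)

lemma emb_gdv_pow: "x \<in> carrier_vec d \<Longrightarrow> emb ((gdv ^^ n) x) = (E.gd (c / l) ^^ n) (emb x)"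
  by (induction n) (auto simp: emb_gdv)

lemma gdv_descent:
  assumes "x \<in> carrier_vec d"
  shows "f (gdv x) \<le> f x - c / l / 2 * (vnorm (grad d f x))\<^sup>2"
proof -
  have "proj d (E.gd (c / l) (emb x)) = gdv x" using assms emb_gdv[of x] by (metis gdv_carrier proj_emb)
  then show ?thesis
    using E.gradient_step_descent[OF \<eta>_bounds, of "emb x"] assms unfolding E.gd_def by simp
qed

lemma gdv_descent_weak: "x \<in> carrier_vec d \<Longrightarrow> f (gdv x) \<le> f x"
proof -
  assume "x \<in> carrier_vec d"
  moreover have "0 \<le> c / l / 2 * (vnorm (grad d f x))\<^sup>2" using c_pos l_pos by simp
  ultimately show ?thesis using gdv_descent[of x] by linarith
qed

lemma gdv_descent_strong: "x \<in> carrier_vec d \<Longrightarrow> vnorm (grad d f x) > g0 \<Longrightarrow> f (gdv x) \<le> f x - \<kappa>"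
proof -
  assume x: "x \<in> carrier_vec d" "vnorm (grad d f x) > g0"
  have "c / l / 2 * g0\<^sup>2 \<le> c / l / 2 * (vnorm (grad d f x))\<^sup>2"
    using c_pos l_pos x pos by (intro mult_left_mono power_mono) auto
  then show ?thesis using gdv_descent[OF x(1)] \<kappa>_step by linarith
qed

lemma fstar_le: "x \<in> carrier_vec d \<Longrightarrow> fstar d f \<le> f x"
proof -
  assume x: "x \<in> carrier_vec d"
  obtain z where "\<forall>x\<in>carrier_vec d. f z \<le> f x" using minimum unfolding has_minimum_def by blast
  then show ?thesis unfolding fstar_def using x by (intro cINF_lower bdd_belowI2[of _ "f z"]) auto
qed

lemma gap_nonneg: "gap \<ge> 0"
  using fstar_le x0_carrier by simp

section \<open>Progress along every run, whatever the noise\<close>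

definition noisy :: "noise \<Rightarrow> nat \<Rightarrow> bool" where
  "noisy \<omega> t \<longleftrightarrow> state_running (run \<omega> t) \<and> vnorm (grad d f (state_current (run \<omega> t))) \<le> g0
     \<and> int t - state_noise_time (run \<omega> t) > T"

definition base :: "noise \<Rightarrow> nat \<Rightarrow> real vec" where
  "base \<omega> t = state_current (run \<omega> t)"

text \<open>Defined at every time, but a point of the run only when time \<open>t\<close> is
  noisy.\<close>

definition perturbed :: "noise \<Rightarrow> nat \<Rightarrow> real vec" where
  "perturbed \<omega> t = perturb d w r \<omega> (state_history (run \<omega> t)) (base \<omega> t)"

lemma perturbed_carrier [simp]: "perturbed \<omega> t \<in> carrier_vec d"
  unfolding perturbed_def by simp

definition noise_count :: "noise \<Rightarrow> nat \<Rightarrow> nat" where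
  "noise_count \<omega> n = card {t. t < n \<and> noisy \<omega> t}"

lemma noise_count_Suc: "noise_count \<omega> (Suc n) = noise_count \<omega> n + (if noisy \<omega> n then 1 else 0)"
proof -
  have "{t. t < Suc n \<and> noisy \<omega> t} = (if noisy \<omega> n then insert n {t. t < n \<and> noisy \<omega> t} else {t. t < n \<and> noisy \<omega> t})"
    by (auto simp: less_Suc_eq)
  then show ?thesis unfolding noise_count_def by simp
qed

lemma run_0: "run \<omega> 0 = Running [] x0 (- T - 1) x0"
  unfolding pgdot_run_def by simp

lemma run_Suc: "run \<omega> (Suc n) = pgdot_step d f w l \<rho> \<epsilon> c \<delta> \<Delta>f \<omega> (run \<omega> n)"
  unfolding pgdot_run_def by simp

text \<open>Progress is measured at the base point \<open>y\<close>, since the perturbation itself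
  may raise \<open>f\<close>. One is subtracted from the count because the epoch started at
  \<open>t\<close> is already counted but has not yet earned its decrease \<open>F\<close>.\<close>

definition epoch_invariant :: "noise \<Rightarrow> nat \<Rightarrow> nat \<Rightarrow> real vec \<Rightarrow> bool" where
  "epoch_invariant \<omega> n t y \<longleftrightarrow> t < n \<and> noisy \<omega> t \<and> y = base \<omega> t \<and> y \<in> carrier_vec d \<and>
     real t * \<kappa> \<le> f x0 - f y \<and> (real (noise_count \<omega> n) - 1) * F \<le> f x0 - f y"

text \<open>Outside an epoch all past passes and epochs are paid for at the current iterate; within
  an epoch this is known only at its base point. The initial noise time \<open>- T - 1\<close> puts
  the start of the run outside an epoch.\<close>

definition run_invariant :: "noise \<Rightarrow> nat \<Rightarrow> pgdot_state \<Rightarrow> bool" where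
  "run_invariant \<omega> n s = (case s of
     Running xs x tn y \<Rightarrow> length xs = n \<and> x \<in> carrier_vec d \<and> y \<in> carrier_vec d \<and> (\<forall>z\<in>set xs. z \<in> carrier_vec d) \<and>
       ((int n - tn > T \<and> real n * \<kappa> \<le> f x0 - f x \<and> real (noise_count \<omega> n) * F \<le> f x0 - f x)
        \<or> (\<exists>t. tn = int t \<and> int n - tn \<le> T \<and> epoch_invariant \<omega> n t y \<and> x = (gdv ^^ (n - t)) (perturbed \<omega> t)))
   | Returned m y \<Rightarrow> \<exists>t. epoch_invariant \<omega> n t y \<and> int m = int t + T + 1 \<and>
       f ((gdv ^^ nat T) (perturbed \<omega> t)) - f y > - F)"

lemma run_invariant_run: "run_invariant \<omega> n (run \<omega> n)"
proof (induction n)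
  case 0
  then show ?case using T_bounds x0_carrier unfolding run_invariant_def run_0 noise_count_def by simp
next
  case (Suc n)
  show ?case
  proof (cases "run \<omega> n")
    case (Returned m y)
    \<comment> \<open>After the return no further noise is counted, so both bounds keep their values
      while \<open>n\<close> grows.\<close>
    then have "\<not> noisy \<omega> n" unfolding noisy_def by simp
    then show ?thesis using Suc unfolding run_Suc Returned run_invariant_def epoch_invariant_def
      by (auto simp: noise_count_Suc)
  next
    case (Running xs x tn y)
    have inv: "length xs = n" "x \<in> carrier_vec d" "y \<in> carrier_vec d" "\<forall>z\<in>set xs. z \<in> carrier_vec d"
      and alt: "(int n - tn > T \<and> real n * \<kappa> \<le> f x0 - f x \<and> real (noise_count \<omega> n) * F \<le> f x0 - f x)
        \<or> (\<exists>t. tn = int t \<and> int n - tn \<le> T \<and> epoch_invariant \<omega> n t y \<and> x = (gdv ^^ (n - t)) (perturbed \<omega> t))"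
      using Suc unfolding Running run_invariant_def by auto
    have noisy: "noisy \<omega> n \<longleftrightarrow> vnorm (grad d f x) \<le> g0 \<and> int n - tn > T"
      unfolding noisy_def Running by simp
    from alt show ?thesis
    proof
      assume out: "int n - tn > T \<and> real n * \<kappa> \<le> f x0 - f x \<and> real (noise_count \<omega> n) * F \<le> f x0 - f x"
      show ?thesis
      proof (cases "noisy \<omega> n")
        case True
        have per: "perturb d w r \<omega> xs x = perturbed \<omega> n"
          unfolding perturbed_def base_def Running by simp
        \<comment> \<open>The pass that adds noise cannot return as well: the time elapsed since the
          noise is 0, whereas \<open>T \<ge> 12\<close>.\<close>
        have "run \<omega> (Suc n) = Running (xs @ [perturbed \<omega> n]) (gdv (perturbed \<omega> n)) (int n) x"
          unfolding run_Suc Running using True noisy inv T_bounds per by (simp add: Let_def gdv_def)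
        moreover have "perturbed \<omega> n \<in> carrier_vec d" unfolding perturbed_def by simp
        moreover have "base \<omega> n = x" unfolding base_def Running by simp
        ultimately show ?thesis
          using True inv out T_bounds unfolding run_invariant_def epoch_invariant_def
          by (auto simp: noise_count_Suc intro!: exI[of _ n])
      next
        case False
        then have big: "vnorm (grad d f x) > g0" using noisy out by auto
        have "run \<omega> (Suc n) = Running (xs @ [x]) (gdv x) tn y"
          unfolding run_Suc Running using False noisy inv out by (auto simp: Let_def gdv_def)
        moreover have "f (gdv x) \<le> f x - \<kappa>" using gdv_descent_strong inv big by blast
        moreover have "real (Suc n) * \<kappa> = real n * \<kappa> + \<kappa>" by (simp add: algebra_simps)
        moreover have "\<kappa> > 0" by (rule pos)
        ultimately show ?thesis
          using False inv out unfolding run_invariant_def by (auto simp: noise_count_Suc)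
      qed
    next
      assume "\<exists>t. tn = int t \<and> int n - tn \<le> T \<and> epoch_invariant \<omega> n t y \<and> x = (gdv ^^ (n - t)) (perturbed \<omega> t)"
      then obtain t where t: "tn = int t" "int n - tn \<le> T" "epoch_invariant \<omega> n t y" "x = (gdv ^^ (n - t)) (perturbed \<omega> t)"
        by blast
      have tn: "t < n" using t(3) unfolding epoch_invariant_def by blast
      have nn: "\<not> noisy \<omega> n" using noisy t by auto
      have cnt: "noise_count \<omega> (Suc n) = noise_count \<omega> n" using nn by (simp add: noise_count_Suc)
      have ep: "epoch_invariant \<omega> (Suc n) t y" using t(3) cnt unfolding epoch_invariant_def by auto
      show ?thesis
      proof (cases "int n - tn = T \<and> f x - f y > - F")
        case True
        then have "run \<omega> (Suc n) = Returned (Suc n) y"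
          unfolding run_Suc Running using nn noisy inv by (auto simp: Let_def)
        moreover have "nat T = n - t" using True t tn by auto
        ultimately show ?thesis using ep True t tn unfolding run_invariant_def by auto
      next
        case False
        then have s: "run \<omega> (Suc n) = Running (xs @ [x]) (gdv x) tn y"
          unfolding run_Suc Running using nn noisy inv by (auto simp: Let_def gdv_def)
        show ?thesis
        proof (cases "int n - tn = T")
          case True
          \<comment> \<open>An epoch that ends without a return has lowered \<open>f\<close> by
            \<open>F\<close>. This single amount settles two accounts: the passes \<open>t\<close>
            to \<open>t + T\<close> at rate \<open>\<kappa>\<close>, and the unit by which the epoch
            raised \<open>noise_count\<close>.\<close>
          then have dec: "f x \<le> f y - F" using False by simp
          have dec2: "f (gdv x) \<le> f x" using gdv_descent_weak inv by blast
          have n: "real n + 1 = real t + (real_of_int T + 1)" using True t(1) by simp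
          have "(real n + 1) * \<kappa> = real t * \<kappa> + \<kappa> * (real_of_int T + 1)" unfolding n by (simp add: algebra_simps)
          also have "\<dots> \<le> (f x0 - f y) + F" using t(3) \<kappa>_epoch unfolding epoch_invariant_def by linarith
          also have "\<dots> \<le> f x0 - f (gdv x)" using dec dec2 by linarith
          finally have 1: "real (Suc n) * \<kappa> \<le> f x0 - f (gdv x)" by (simp add: add.commute)
          have "(real (noise_count \<omega> n) - 1) * F \<le> f x0 - f y" using t(3) unfolding epoch_invariant_def by blast
          then have 2: "real (noise_count \<omega> (Suc n)) * F \<le> f x0 - f (gdv x)"
            using dec dec2 cnt by (simp add: algebra_simps)
          show ?thesis unfolding s run_invariant_def using 1 2 inv True by auto
        next
          case False
          have "gdv x = (gdv ^^ (Suc n - t)) (perturbed \<omega> t)"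
            unfolding t(4) using tn by (simp add: Suc_diff_le)
          moreover have "int (Suc n) - tn \<le> T" using False t by simp
          ultimately show ?thesis unfolding s run_invariant_def using inv t(1) ep by auto
        qed
      qed
    qed
  qed
qed

lemma run_Running_length: "run \<omega> n = Running xs x tn y \<Longrightarrow> length xs = n"
  using run_invariant_run[of \<omega> n] unfolding run_invariant_def by auto

text \<open>The run is adapted: the state before pass \<open>n\<close> is a function of the noise at
  earlier times. Hence noise at time \<open>t\<close> can be resampled without changing the base
  point or the history at \<open>t\<close>.\<close>

lemma run_cong:
  assumes "\<And>t i k. t < n \<Longrightarrow> \<omega> (t, i, k) = \<omega>' (t, i, k)"
  shows "run \<omega> n = run \<omega>' n"
  using assms
proof (induction n)
  case 0
  then show ?case by (simp add: run_0)
next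
  case (Suc n)
  then have IH: "run \<omega> n = run \<omega>' n" by simp
  show ?case
  proof (cases "run \<omega>' n")
    case (Returned m y)
    then show ?thesis unfolding run_Suc IH by simp
  next
    case (Running xs x tn y)
    then have "length xs = n" by (rule run_Running_length)
    then have per: "perturb d w r \<omega> xs x = perturb d w r \<omega>' xs x"
      using Suc.prems by (intro perturb_cong) simp
    then show ?thesis unfolding run_Suc IH Running by (simp only: pgdot_step.simps Let_def per)
  qed
qed

text \<open>The total decrease is at most \<open>gap\<close>, so at most
  \<open>gap / \<kappa>\<close> passes can be paid for. Within an epoch the payment refers to its
  start, which lies at most \<open>T\<close> passes back.\<close>

lemma run_terminates:
  assumes "real n > gap / \<kappa> + real_of_int T"
  shows "\<exists>m\<le>n. \<exists>y. run \<omega> m = Returned m y"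
proof -
  have "\<not> state_running (run \<omega> n)"
  proof
    assume "state_running (run \<omega> n)"
    then obtain xs x tn y where R: "run \<omega> n = Running xs x tn y" by (cases "run \<omega> n") auto
    have big: "gap < (real n - real_of_int T) * \<kappa>"
      using assms pos by (simp add: field_simps)
    consider "x \<in> carrier_vec d" "real n * \<kappa> \<le> f x0 - f x"
      | t where "int n - int t \<le> T" "epoch_invariant \<omega> n t y"
      using run_invariant_run[of \<omega> n] unfolding R run_invariant_def by auto
    then show False
    proof cases
      case 1
      have "real_of_int T * \<kappa> > 0" using T_bounds pos by simp
      then show False using 1 big fstar_le[of x] by (simp add: algebra_simps)
    next
      case 2
      then have "y \<in> carrier_vec d" "real t * \<kappa> \<le> f x0 - f y" unfolding epoch_invariant_def by auto
      then have "real t * \<kappa> \<le> gap" using fstar_le by fastforce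
      moreover have "real n - real_of_int T \<le> real t" using 2 by linarith
      then have "(real n - real_of_int T) * \<kappa> \<le> real t * \<kappa>" using pos by (intro mult_right_mono) auto
      ultimately show False using big by linarith
    qed
  qed
  \<comment> \<open>Going back to the first state that is not running: there the recorded number of
    passes is the index of the state.\<close>
  moreover have "\<not> state_running (run \<omega> n) \<Longrightarrow> \<exists>m\<le>n. \<exists>y. run \<omega> m = Returned m y" for n
  proof (induction n)
    case 0
    then show ?case by (simp add: run_0)
  next
    case (Suc n)
    show ?case
    proof (cases "run \<omega> n")
      case (Returned m y)
      then show ?thesis using Suc.IH by (auto intro: le_SucI)
    next
      case (Running xs x tn y)
      then have "length xs = n" by (rule run_Running_length)
      then show ?thesis using Suc.prems unfolding run_Suc Running
        by (intro exI[of _ "Suc n"]) (auto simp: run_Suc Running Let_def split: if_splits)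
    qed
  qed
  ultimately show ?thesis by blast
qed

text \<open>The output is always the base point of a noisy time. Its gradient is therefore small,
  and it can be wrong only through its curvature, in an epoch that got stuck.\<close>

lemma returned_stuck:
  assumes "run \<omega> n = Returned m y"
  shows "\<exists>t. noisy \<omega> t \<and> t < n \<and> y = base \<omega> t \<and> y \<in> carrier_vec d \<and> real m \<le> gap / \<kappa> + real_of_int T + 1
    \<and> f ((gdv ^^ nat T) (perturbed \<omega> t)) - f y > - F"
proof -
  obtain t where t: "epoch_invariant \<omega> n t y" "int m = int t + T + 1"
      "f ((gdv ^^ nat T) (perturbed \<omega> t)) - f y > - F"
    using run_invariant_run[of \<omega> n] unfolding assms run_invariant_def by auto
  then have "y \<in> carrier_vec d" "real t * \<kappa> \<le> f x0 - f y" unfolding epoch_invariant_def by auto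
  then have "real t * \<kappa> \<le> gap" using fstar_le by fastforce
  then have "real t \<le> gap / \<kappa>" using pos by (simp add: pos_le_divide_eq)
  moreover have "real m = real t + real_of_int T + 1" using t(2) by linarith
  ultimately show ?thesis using t unfolding epoch_invariant_def by auto
qed

text \<open>The summand \<open>F\<close> stands for the last epoch, which need not have lowered
  \<open>f\<close>.\<close>

lemma noise_count_le: "real (noise_count \<omega> n) * F \<le> gap + F"
proof (cases "run \<omega> n")
  case (Returned m y)
  then obtain t where "epoch_invariant \<omega> n t y"
    using run_invariant_run[of \<omega> n] unfolding run_invariant_def by auto
  then have "(real (noise_count \<omega> n) - 1) * F \<le> f x0 - f y" "y \<in> carrier_vec d"
    unfolding epoch_invariant_def by auto
  then show ?thesis using fstar_le[of y] by (simp add: algebra_simps)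
next
  case (Running xs x tn y)
  consider "x \<in> carrier_vec d" "real (noise_count \<omega> n) * F \<le> f x0 - f x"
    | t where "epoch_invariant \<omega> n t y"
    using run_invariant_run[of \<omega> n] unfolding Running run_invariant_def by auto
  then show ?thesis
  proof cases
    case 1
    then show ?thesis using fstar_le[of x] pos by linarith
  next
    case 2
    then have "(real (noise_count \<omega> n) - 1) * F \<le> f x0 - f y" "y \<in> carrier_vec d"
      unfolding epoch_invariant_def by auto
    then show ?thesis using fstar_le[of y] by (simp add: algebra_simps)
  qed
qed

lemma state_carrier:
  "state_current (run \<omega> n) \<in> carrier_vec d" "state_base (run \<omega> n) \<in> carrier_vec d"
  "z \<in> set (state_history (run \<omega> n)) \<Longrightarrow> z \<in> carrier_vec d"
  using run_invariant_run[of \<omega> n] unfolding run_invariant_def epoch_invariant_def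
  by (cases "run \<omega> n"; auto)+

end

section \<open>Escape from a saddle\<close>

lemma exp_half_le: "0 \<le> z \<Longrightarrow> z \<le> 1 \<Longrightarrow> exp (z / 2) \<le> 1 + (z::real)"
proof -
  assume z: "0 \<le> z" "z \<le> 1"
  have "exp (z / 2) \<le> 1 + z / 2 + (z / 2)\<^sup>2" using z by (intro exp_bound) auto
  moreover have "z * z \<le> z * 1" using z by (intro mult_left_mono) auto
  ultimately show ?thesis using z by (simp add: power2_eq_square)
qed

context pgdot
begin

definition saddle :: "real vec \<Rightarrow> bool" where
  "saddle x \<longleftrightarrow> lambda_min (hessian d f x) < - \<gamma>"

definition stuck :: "real vec \<Rightarrow> real vec \<Rightarrow> bool" where
  "stuck y x \<longleftrightarrow> f ((gdv ^^ nat T) x) - f y > - F"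

text \<open>Growth at rate \<open>1 + c / l * \<gamma>\<close> for this many steps reaches
  \<open>exp (3 * \<chi>)\<close>: half of the exponent \<open>6 * \<chi>\<close> is given away in
  \<open>exp_half_le\<close>. The analysis stops here and not at \<open>T\<close>, because the error
  condition of \<open>coupled_runs_separate\<close> fails over a whole epoch: with the same radius
  its left side would be at least \<open>24 / sqrt c\<close>.\<close>

definition escape_time :: nat where
  "escape_time = nat \<lceil>6 * \<chi> * l / (c * \<gamma>)\<rceil>"

text \<open>In units of \<open>sqrt c * \<gamma> / (\<rho> * \<chi>)\<close>, a stuck run moves at
  most \<open>sqrt 27 \<le> 21 / 4\<close> within the escape time, and the perturbation adds at most
  \<open>1 / 12\<close>; 6 is the rounded sum.\<close>

definition local_radius :: real where
  "local_radius = 6 * sqrt c * \<gamma> / (\<rho> * \<chi>)"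

lemma escape_time_bounds:
  "6 * \<chi> * l / (c * \<gamma>) \<le> real escape_time" "real escape_time \<le> 12 * \<chi> * l / (c * \<gamma>)" "escape_time \<le> nat T"
proof -
  define A where "A = 6 * \<chi> * l / (c * \<gamma>)"
  have "c * \<gamma> \<le> 1 * l" using c_pos c_small \<gamma>_pos \<gamma>_le_l by (intro mult_mono) auto
  then have "1 * (c * \<gamma>) \<le> 6 * \<chi> * l" using chi_ge l_pos c_pos \<gamma>_pos by (intro mult_mono) auto
  then have A: "A \<ge> 1" unfolding A_def using c_pos \<gamma>_pos by (simp add: pos_le_divide_eq)
  have "real escape_time \<le> 2 * A" and 1: "A \<le> real escape_time"
    using A unfolding escape_time_def A_def[symmetric] by linarith+
  then show "real escape_time \<le> 12 * \<chi> * l / (c * \<gamma>)" unfolding A_def by simp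
  show "6 * \<chi> * l / (c * \<gamma>) \<le> real escape_time" using 1 unfolding A_def .
  have "A \<le> \<chi> * l / (c\<^sup>2 * \<gamma>)"
  proof -
    have "A = 6 * c * (\<chi> * l / (c\<^sup>2 * \<gamma>))"
      unfolding A_def using c_pos \<gamma>_pos by (simp add: power2_eq_square)
    also have "\<dots> \<le> 1 * (\<chi> * l / (c\<^sup>2 * \<gamma>))"
      using c_small T_arg_ge by (intro mult_right_mono) auto
    finally show ?thesis by simp
  qed
  then have "A \<le> real_of_int T" using T_bounds by linarith
  then have "\<lceil>A\<rceil> \<le> T" by (simp add: ceiling_le_iff)
  then show "escape_time \<le> nat T" unfolding escape_time_def A_def by (rule nat_mono)
qed

text \<open>288 is 4 * 6 * 12: the 4 in the error condition of the coupling, the 6 in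
  \<open>local_radius\<close>, and the 12 in the upper bound for \<open>escape_time\<close>.\<close>

lemma sqrt_c_small: "sqrt c \<le> 1 / 288"
proof (rule real_le_lsqrt)
  show "c \<le> (1 / 288)\<^sup>2" using c_small by (simp add: power2_eq_square)
qed (use c_pos in auto)

text \<open>Compares the rise of \<open>f\<close> that a perturbation can cause, of order
  \<open>l * r\<^sup>2\<close>, with the decrease \<open>F\<close> demanded of an epoch.\<close>

lemma F_eq_r: "l * r\<^sup>2 = F * (\<gamma> / (\<chi> * l))"
  unfolding F_eq r_eq using \<rho>_pos l_pos c_pos pos by (simp add: field_simps eval_nat_numeral)

lemma \<gamma>_ratio: "\<gamma> / (\<chi> * l) \<le> 1 / 12"
proof -
  have "12 * \<gamma> \<le> \<chi> * l" using chi_ge \<gamma>_le_l \<gamma>_pos by (intro mult_mono) auto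
  then show ?thesis using pos l_pos by (simp add: field_simps)
qed

text \<open>A stuck run has lowered \<open>f\<close> by less than \<open>F\<close> after the whole
  epoch, hence also at every earlier time, as \<open>f\<close> decreases along the run. By
  \<open>improve_or_localize\<close> it cannot have moved far.\<close>

lemma stuck_localized:
  assumes x': "x' \<in> carrier_vec d" and g: "vnorm (grad d f x') \<le> g0"
    and x: "x \<in> carrier_vec d" and near: "vnorm (x - x') \<le> r" and stuck: "stuck x' x" and t: "t \<le> escape_time"
  shows "norm ((E.gd (c / l) ^^ t) (emb x) - emb x') \<le> local_radius"
proof -
  define q where "q = sqrt c * \<gamma> / (\<rho> * \<chi>)"
  have q: "q > 0" unfolding q_def using c_pos \<gamma>_pos \<rho>_pos pos by simp
  define h where "h = emb x - emb x'"
  have nh: "norm h \<le> r" unfolding h_def using x x' near by (simp add: emb_arith[symmetric])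
  have "f x \<le> f x' + inner (emb (grad d f x')) h + l / 2 * (norm h)\<^sup>2"
    using E.descent_quadratic[of "emb x'" h] x x' unfolding h_def by simp
  moreover have "inner (emb (grad d f x')) h \<le> g0 * r"
  proof -
    have "inner (emb (grad d f x')) h \<le> vnorm (grad d f x') * norm h"
      using norm_cauchy_schwarz[of "emb (grad d f x')" h] by simp
    also have "\<dots> \<le> g0 * r" using g nh pos by (intro mult_mono) auto
    finally show ?thesis .
  qed
  moreover have "l / 2 * (norm h)\<^sup>2 \<le> l / 2 * r\<^sup>2"
    using nh l_pos by (intro mult_left_mono power_mono) auto
  \<comment> \<open>The gradient contributes \<open>g0 * r = l * r\<^sup>2\<close>, the curvature
    half as much.\<close>
  ultimately have "f x \<le> f x' + 3 / 2 * (l * r\<^sup>2)"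
    unfolding g0_eq by (simp add: power2_eq_square algebra_simps)
  also have "3 / 2 * (l * r\<^sup>2) \<le> F / 8"
  proof -
    have "3 / 2 * (F * (\<gamma> / (\<chi> * l))) \<le> 3 / 2 * (F * (1 / 12))"
      using \<gamma>_ratio pos by (intro mult_left_mono) auto
    then show ?thesis unfolding F_eq_r by simp
  qed
  finally have fx: "f x \<le> f x' + F / 8" by simp
  define X where "X = (E.gd (c / l) ^^ t) (emb x)"
  have pX: "proj d X = (gdv ^^ t) x" unfolding X_def using x by (simp add: emb_gdv_pow[symmetric])
  have "f ((gdv ^^ nat T) x) \<le> f ((gdv ^^ t) x)"
    using E.gd_pow_decreasing[OF \<eta>_bounds, of t "nat T" "emb x"] t escape_time_bounds x
    by (simp add: emb_gdv_pow[symmetric])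
  then have fX: "f (proj d X) > f x' - F" using stuck unfolding stuck_def pX by linarith
  have "(norm (X - emb x))\<^sup>2 \<le> 2 * (c / l) * real t * (f x - f (proj d X))"
    using E.improve_or_localize[OF \<eta>_bounds, of t "emb x"] x unfolding X_def by simp
  also have "\<dots> \<le> 2 * (c / l) * (12 * \<chi> * l / (c * \<gamma>)) * (9 / 8 * F)"
  proof (rule mult_mono)
    show "2 * (c / l) * real t \<le> 2 * (c / l) * (12 * \<chi> * l / (c * \<gamma>))"
      using t escape_time_bounds(2) c_pos l_pos by (intro mult_left_mono) auto
    show "f x - f (proj d X) \<le> 9 / 8 * F" using fx fX by linarith
    show "0 \<le> f x - f (proj d X)"
      using E.gd_pow_decreasing[OF \<eta>_bounds, of 0 t "emb x"] x unfolding X_def by simp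
  qed (use c_pos l_pos \<gamma>_pos pos in auto)
  also have "\<dots> = 27 * q\<^sup>2"
    unfolding F_eq q_def using c_pos l_pos \<gamma>_pos \<rho>_pos pos by (simp add: field_simps eval_nat_numeral)
  also have "\<dots> \<le> (21 / 4 * q)\<^sup>2" by (simp add: power2_eq_square)
  finally have 1: "norm (X - emb x) \<le> 21 / 4 * q" by (rule power2_le_imp_le) (use q in simp)
  have "r = q * (\<gamma> / (\<chi> * l))" unfolding r_eq q_def by (simp add: power2_eq_square)
  also have "\<dots> \<le> q * (1 / 12)" using \<gamma>_ratio q by (intro mult_left_mono) auto
  finally have "norm (X - emb x') \<le> 21 / 4 * q + q * (1 / 12)"
    using norm_triangle_ineq[of "X - emb x" h] 1 nh unfolding h_def by simp
  also have "\<dots> \<le> 6 * q" using q by simp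
  finally show ?thesis unfolding X_def local_radius_def q_def by simp
qed

lemma local_radius_small: "4 * (c / l) * \<rho> * local_radius * real escape_time \<le> 1"
proof -
  have R: "0 \<le> 4 * (c / l) * \<rho> * local_radius"
    unfolding local_radius_def using c_pos l_pos \<gamma>_pos \<rho>_pos pos by simp
  have "4 * (c / l) * \<rho> * local_radius * real escape_time
    \<le> 4 * (c / l) * \<rho> * local_radius * (12 * \<chi> * l / (c * \<gamma>))"
    using escape_time_bounds R by (intro mult_left_mono)
  also have "\<dots> = 288 * sqrt c"
    unfolding local_radius_def using c_pos l_pos \<gamma>_pos \<rho>_pos pos by (simp add: field_simps)
  also have "\<dots> \<le> 1" using sqrt_c_small by simp
  finally show ?thesis .
qed

lemma escape_growth:
  assumes "\<gamma> \<le> \<mu>"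
  shows "exp (3 * \<chi>) \<le> (1 + c / l * \<mu>) ^ escape_time"
proof -
  define z where "z = c / l * \<gamma>"
  have z0: "0 \<le> z" unfolding z_def using c_pos l_pos \<gamma>_pos by simp
  have "c * \<gamma> \<le> 1 * l" using c_pos c_small \<gamma>_pos \<gamma>_le_l by (intro mult_mono) auto
  then have z1: "z \<le> 1" unfolding z_def using l_pos by (simp add: field_simps)
  have "6 * \<chi> = z * (6 * \<chi> * l / (c * \<gamma>))"
    unfolding z_def using c_pos l_pos \<gamma>_pos by simp
  also have "\<dots> \<le> z * real escape_time" using escape_time_bounds z0 by (intro mult_left_mono)
  finally have "exp (3 * \<chi>) \<le> exp (real escape_time * (z / 2))" by (simp add: mult.commute)
  also have "\<dots> = exp (z / 2) ^ escape_time" by (rule exp_of_nat_mult)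
  also have "\<dots> \<le> (1 + z) ^ escape_time" using exp_half_le[OF z0 z1] by (intro power_mono) auto
  also have "\<dots> \<le> (1 + c / l * \<mu>) ^ escape_time"
    using assms z0 c_pos l_pos unfolding z_def by (intro power_mono add_left_mono mult_left_mono) auto
  finally show ?thesis .
qed

lemma hessian_form:
  assumes "x \<in> carrier_vec d" "v \<in> carrier_vec d"
  shows "lambda_min (hessian d f x) * (vnorm v)\<^sup>2 \<le> v \<bullet> (hessian d f x *\<^sub>v v)"
  by (rule lambda_min_Rayleigh(2)[OF _ d_pos])
    (use assms hessian_carrier[OF twice_differentiable] hessian_symmetric[OF gradient_lip hessian_lip l_pos \<rho>_pos] in auto)

lemma hessian_eigenvector:
  assumes "x \<in> carrier_vec d"
  obtains u where "u \<in> carrier_vec d" "vnorm u = 1" "hessian d f x *\<^sub>v u = lambda_min (hessian d f x) \<cdot>\<^sub>v u"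
  using lambda_min_Rayleigh(1)[OF hessian_carrier[OF twice_differentiable assms] d_pos]
    hessian_symmetric[OF gradient_lip hessian_lip l_pos \<rho>_pos assms] by blast

text \<open>The coupling is run with the true least eigenvalue \<open>- \<mu>\<close>, not with the
  threshold \<open>- \<gamma>\<close>: its rate must be attained by an eigenvector and at the same
  time bound the form from below. Since \<open>\<gamma> \<le> \<mu>\<close>, the growth is only
  faster.\<close>

lemma stuck_pair_close:
  assumes x': "x' \<in> carrier_vec d" and g: "vnorm (grad d f x') \<le> g0" and sad: "saddle x'"
    and u: "u \<in> carrier_vec d" "vnorm u = 1" "hessian d f x' *\<^sub>v u = lambda_min (hessian d f x') \<cdot>\<^sub>v u"
    and x: "x \<in> carrier_vec d" "vnorm (x - x') \<le> r" "stuck x' x"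
    and y: "y \<in> carrier_vec d" "vnorm (y - x') \<le> r" "stuck x' y"
    and diff: "x - y = s \<cdot>\<^sub>v u"
  shows "\<bar>s\<bar> \<le> 4 * local_radius * exp (- 3 * \<chi>)"
proof -
  define \<mu> where "\<mu> = - lambda_min (hessian d f x')"
  have \<mu>: "\<gamma> \<le> \<mu>" using sad unfolding saddle_def \<mu>_def by simp
  have hc: "hessian d f x' \<in> carrier_mat d d" using hessian_carrier[OF twice_differentiable x'] .
  have "(1 + c / l * \<mu>) ^ escape_time * \<bar>s\<bar> \<le> 4 * local_radius"
  proof (rule E.coupled_runs_separate[OF \<eta>_bounds])
    show "0 \<le> \<mu>" using \<mu> \<gamma>_pos by simp
    show "norm (emb u) = 1" using u by simp
    show "emb (hessian d f (proj d (emb x')) *\<^sub>v proj d (emb u)) = - \<mu> *\<^sub>R emb u"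
      using u x' unfolding \<mu>_def by (simp add: emb_arith)
    show "emb x - emb y = s *\<^sub>R emb u"
      using diff x y by (simp add: emb_arith[symmetric])
    show "4 * (c / l) * \<rho> * local_radius * real escape_time \<le> 1" by (rule local_radius_small)
    fix v
    \<comment> \<open>On the whole sequence space the extended Hessian vanishes beyond the first
      \<open>d\<close> coordinates, so the lower bound survives because \<open>- \<mu>\<close> is
      negative and truncation shortens \<open>v\<close>.\<close>
    have "- \<mu> * (norm v)\<^sup>2 \<le> - \<mu> * (vnorm (proj d v))\<^sup>2"
      using \<mu> \<gamma>_pos vnorm_proj_le[of d v] by (intro mult_left_mono_neg power_mono) auto
    also have "\<dots> \<le> proj d v \<bullet> (hessian d f x' *\<^sub>v proj d v)"
      using hessian_form[OF x', of "proj d v"] unfolding \<mu>_def by simp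
    also have "\<dots> = inner v (emb (hessian d f x' *\<^sub>v proj d v))"
      using hc by (subst inner_commute) (simp add: inner_emb_left[of _ d] comm_scalar_prod[of _ d])
    finally show "- \<mu> * (norm v)\<^sup>2 \<le> inner v (emb (hessian d f (proj d (emb x')) *\<^sub>v proj d v))"
      using x' by simp
  qed (use stuck_localized[OF x' g] x y in auto)
  moreover have "exp (3 * \<chi>) * \<bar>s\<bar> \<le> (1 + c / l * \<mu>) ^ escape_time * \<bar>s\<bar>"
    using escape_growth[OF \<mu>] by (intro mult_right_mono) auto
  ultimately have "exp (3 * \<chi>) * \<bar>s\<bar> \<le> 4 * local_radius" by linarith
  then have "\<bar>s\<bar> \<le> 4 * local_radius / exp (3 * \<chi>)"
    by (simp add: pos_le_divide_eq mult.commute)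
  then show ?thesis by (simp add: exp_minus divide_inverse)
qed

section \<open>Counting the epochs that start at a saddle\<close>

lemma base_le_start: "noisy \<omega> t \<Longrightarrow> f (base \<omega> t) \<le> f x0"
proof -
  assume n: "noisy \<omega> t"
  then obtain xs x tn y where R: "run \<omega> t = Running xs x tn y" unfolding noisy_def by (cases "run \<omega> t") auto
  then have "int t - tn > T" using n unfolding noisy_def by simp
  then have "real (noise_count \<omega> t) * F \<le> f x0 - f x"
    using run_invariant_run[of \<omega> t] unfolding R run_invariant_def by auto
  moreover have "real (noise_count \<omega> t) * F \<ge> 0" using pos by simp
  ultimately show ?thesis unfolding base_def R by simp
qed

text \<open>From the base point, which is no higher than \<open>x0\<close>,
  \<open>saddle_gap\<close> still descends by \<open>\<gamma> ^ 3 / (6 * \<rho>\<^sup>2)\<close>,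
  and this is more than \<open>F\<close>.\<close>

lemma noisy_saddle_imp_gap:
  assumes "noisy \<omega> t" "saddle (base \<omega> t)"
  shows "F \<le> gap"
proof -
  have x: "base \<omega> t \<in> carrier_vec d" unfolding base_def by (rule state_carrier)
  obtain u where u: "u \<in> carrier_vec d" "vnorm u = 1"
    "hessian d f (base \<omega> t) *\<^sub>v u = lambda_min (hessian d f (base \<omega> t)) \<cdot>\<^sub>v u"
    using hessian_eigenvector[OF x] .
  have "u \<bullet> u = 1" using u unfolding vnorm_def by simp
  then have "inner (emb u) (emb (hessian d f (proj d (emb (base \<omega> t))) *\<^sub>v proj d (emb u))) \<le> - \<gamma>"
    using u x assms(2) unfolding saddle_def by (simp add: emb_arith inner_emb[of _ d])
  then obtain z where "f (proj d z) \<le> f (base \<omega> t) - \<gamma> ^ 3 / (6 * \<rho>\<^sup>2)"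
    using E.saddle_gap[of "emb u" "emb (base \<omega> t)" \<gamma>] u x \<gamma>_pos by auto
  moreover have "fstar d f \<le> f (proj d z)" by (rule fstar_le) simp
  moreover have "F \<le> \<gamma> ^ 3 / (6 * \<rho>\<^sup>2)"
  proof -
    have "1 \<le> \<chi> ^ 3" using chi_ge by (simp add: one_le_power)
    then have "c * 6 \<le> 1 * \<chi> ^ 3" using c_small by linarith
    then have "\<gamma> ^ 3 * (c * 6) \<le> \<gamma> ^ 3 * \<chi> ^ 3" using \<gamma>_pos by (intro mult_left_mono) auto
    then show ?thesis unfolding F_eq using \<rho>_pos pos by (simp add: field_simps)
  qed
  ultimately show ?thesis using base_le_start[OF assms(1)] by linarith
qed

text \<open>\<open>noise_count_le\<close> leaves an additive 1 beside \<open>gap / F\<close>. The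
  logarithm in \<open>\<chi>\<close> controls only quantities proportional to
  \<open>\<Delta>f\<close>, so that 1 has to be absorbed: if a saddle occurs at all, it is at most
  \<open>gap / F\<close>; otherwise the count is 0.\<close>

lemma noisy_saddle_count:
  "real (card {t. t < n \<and> noisy \<omega> t \<and> saddle (base \<omega> t)}) * F \<le> 2 * gap"
proof (cases "{t. t < n \<and> noisy \<omega> t \<and> saddle (base \<omega> t)} = {}")
  case True
  show ?thesis unfolding True using gap_nonneg by simp
next
  case False
  then have "F \<le> gap" using noisy_saddle_imp_gap by blast
  have "card {t. t < n \<and> noisy \<omega> t \<and> saddle (base \<omega> t)} \<le> noise_count \<omega> n"
    unfolding noise_count_def by (rule card_mono) auto
  then have "real (card {t. t < n \<and> noisy \<omega> t \<and> saddle (base \<omega> t)}) * F \<le> real (noise_count \<omega> n) * F"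
    using pos by (intro mult_right_mono) auto
  note this
  also have "real (noise_count \<omega> n) * F \<le> gap + F" by (rule noise_count_le)
  also have "\<dots> \<le> gap + gap" using \<open>F \<le> gap\<close> by (rule add_left_mono)
  finally show ?thesis by simp
qed

text \<open>The width of the stuck set in units of the \<open>Size\<close> noise, of which
  \<open>r / sqrt d\<close> is the scale. The 8 is twice the 4 of \<open>stuck_pair_close\<close>,
  which makes the bound strict.\<close>

definition thickness :: real where
  "thickness = 8 * local_radius * exp (- 3 * \<chi>) * sqrt d / r"

text \<open>The volume bound for thin subsets of the cube. Its factor \<open>sqrt d\<close> and the
  one in \<open>thickness\<close> combine to the \<open>d\<close> inside the logarithm of
  \<open>\<chi>\<close>.\<close>

definition failure_bound :: real where
  "failure_bound = exp 1 * sqrt d * thickness"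

lemma local_radius_pos: "local_radius > 0"
  unfolding local_radius_def using c_pos \<gamma>_pos \<rho>_pos pos by simp

lemma thickness_pos: "thickness > 0"
  unfolding thickness_def using local_radius_pos pos d_pos by simp

text \<open>The expected number of failures. The factors are \<open>exp (- 3 * \<chi>)\<close> from
  the escape, at most \<open>\<delta> * exp (\<chi> / 3)\<close> from the problem parameters, and
  \<open>\<chi> ^ 4\<close>, which is at most \<open>256 * exp \<chi>\<close>. Altogether
  \<open>exp (1 - 5 / 3 * \<chi>)\<close> remains, at most \<open>exp (- 19)\<close> for
  \<open>\<chi> \<ge> 12\<close>.\<close>

lemma failure_bound_total: "failure_bound * (2 * gap / F) \<le> \<delta>"
proof -
  define A where "A = real d * l * \<Delta>f / (c * \<epsilon>\<^sup>2)"
  have e: "exp (- 3 * \<chi>) > 0" by simp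
  have "failure_bound * (2 * gap / F) = 96 * exp 1 * \<chi> ^ 4 * exp (- 3 * \<chi>) * (real d * l * gap / (c * \<epsilon>\<^sup>2))"
  proof -
    define X where "X = \<chi>"
    define Y where "Y = exp (- 3 * \<chi>)"
    define Z where "Z = gap"
    have "X > 0" unfolding X_def by (rule pos)
    have "sqrt (real d) * sqrt (real d) = real d" by simp
    then have "failure_bound * (2 * Z / F) = exp 1 * real d * (8 * local_radius * Y) / r * (2 * Z / F)"
      unfolding failure_bound_def thickness_def Y_def by (simp add: field_simps)
    also have "\<dots> = 96 * exp 1 * X ^ 4 * Y * (real d * l * Z / (c * \<epsilon>\<^sup>2))"
      unfolding F_eq r_eq local_radius_def X_def[symmetric]
      using c_pos \<gamma>_pos \<rho>_pos l_pos \<open>X > 0\<close> by (simp add: \<epsilon>_eq field_simps eval_nat_numeral)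
    finally show ?thesis unfolding X_def Y_def Z_def .
  qed
  also have "\<dots> \<le> 96 * exp 1 * \<chi> ^ 4 * exp (- 3 * \<chi>) * A"
    unfolding A_def using \<Delta>f_ge l_pos c_pos \<epsilon>_pos pos by (intro mult_left_mono divide_right_mono) auto
  also have "\<dots> \<le> 96 * exp 1 * \<chi> ^ 4 * exp (- 3 * \<chi>) * (\<delta> * exp (\<chi> / 3))"
  proof (rule mult_left_mono)
    have "A / \<delta> \<le> exp (\<chi> / 3)"
    \<comment> \<open>The other case is \<open>\<Delta>f = 0\<close>, where the logarithm carries no
      information and positivity of \<open>exp\<close> is enough.\<close>
    proof (cases "A / \<delta> > 0")
      case True
      have eq: "A / \<delta> = real d * l * \<Delta>f / (c * \<epsilon>\<^sup>2 * \<delta>)" unfolding A_def by simp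
      have "ln (A / \<delta>) \<le> \<chi> / 3" unfolding eq chi_def by simp
      then show ?thesis using True by (metis exp_ln exp_le_cancel_iff)
    next
      case False
      then show ?thesis using exp_gt_zero[of "\<chi> / 3"] by linarith
    qed
    then show "A \<le> \<delta> * exp (\<chi> / 3)" using \<delta>_pos by (simp add: pos_divide_le_eq mult.commute)
  qed simp
  also have "\<dots> \<le> \<delta>"
  proof -
    \<comment> \<open>The fourth power of \<open>1 + x \<le> exp x\<close> at
      \<open>x = \<chi> / 4\<close>.\<close>
    have "\<chi> / 4 \<le> 1 + \<chi> / 4" by simp
    also have "\<dots> \<le> exp (\<chi> / 4)" by (rule exp_ge_add_one_self)
    finally have "(\<chi> / 4) ^ 4 \<le> exp (\<chi> / 4) ^ 4" using pos by (intro power_mono) auto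
    also have "\<dots> = exp \<chi>" by (simp add: exp_of_nat_mult[symmetric])
    finally have c4: "\<chi> ^ 4 \<le> 256 * exp \<chi>" by (simp add: power_divide)
    have "96 * exp 1 * \<chi> ^ 4 * exp (- 3 * \<chi>) * exp (\<chi> / 3)
      \<le> 96 * exp 1 * (256 * exp \<chi>) * exp (- 3 * \<chi>) * exp (\<chi> / 3)"
      using c4 by (intro mult_right_mono mult_left_mono) auto
    also have "\<dots> = 24576 * (exp 1 * exp \<chi> * exp (- 3 * \<chi>) * exp (\<chi> / 3))" by simp
    also have "\<dots> = 24576 * exp (1 - 5 / 3 * \<chi>)" by (simp add: exp_add[symmetric])
    also have "\<dots> \<le> 24576 * exp (- 19)" using chi_ge by simp
    also have "\<dots> \<le> 1"
    proof -
      \<comment> \<open>The constant 24576 is 96 * 256, which is below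
        \<open>2 ^ 19\<close>.\<close>
      have "(2::real) ^ 19 \<le> exp 1 ^ 19" using exp_ge_add_one_self[of 1] by (intro power_mono) auto
      also have "\<dots> = exp 19" by (simp add: exp_of_nat_mult[symmetric])
      finally show ?thesis by (simp add: exp_minus field_simps)
    qed
    finally have "96 * exp 1 * \<chi> ^ 4 * exp (- 3 * \<chi>) * exp (\<chi> / 3) \<le> 1" .
    from mult_left_mono[OF this, of \<delta>] show ?thesis using \<delta>_pos by (simp add: mult_ac)
  qed
  finally show ?thesis .
qed

end

section \<open>Measurability of the run\<close>

text \<open>In this form, a finite combination of coordinates, continuity for the product topology
  on sequences is immediate.\<close>

lemma emb_vec_eq_sum: "emb (vec d a) = (\<Sum>i<d. a i *\<^sub>R emb (unit_vec d i))"
proof (rule fseq_eqI)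
  fix k
  have cs: "coord (\<Sum>i\<in>A. h i) k = (\<Sum>i\<in>A. coord (h i) k)" if "finite A" for h :: "nat \<Rightarrow> fseq" and A
    using that by (induction rule: finite_induct) (auto simp: coord_simps)
  have "(\<Sum>i<d. a i * coord (emb (unit_vec d i)) k) = (\<Sum>i<d. if k = i then a i else 0)"
    by (rule sum.cong) (auto simp: coord_emb unit_vec_def)
  also have "\<dots> = coord (emb (vec d a)) k" by (simp add: coord_emb sum.delta)
  finally show "coord (emb (vec d a)) k = coord (\<Sum>i<d. a i *\<^sub>R emb (unit_vec d i)) k"
    by (simp add: cs coord_simps)
qed

lemma continuous_on_emb_vec: "continuous_on UNIV (\<lambda>a. emb (vec d a))"
  unfolding emb_vec_eq_sum by (intro continuous_intros continuous_on_product_then_coordinatewise[OF continuous_on_id])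

lemma continuous_on_vec_coordinate:
  assumes "continuous_on UNIV (\<lambda>a. emb (h (vec d a)))" and "\<And>x. x \<in> carrier_vec d \<Longrightarrow> h x \<in> carrier_vec d" and "i < d"
  shows "continuous_on UNIV (\<lambda>a :: nat \<Rightarrow> real. h (vec d a) $ i)"
proof -
  have "h (vec d a) $ i = inner (emb (h (vec d a))) (emb (unit_vec d i))" for a
    using assms(2)[of "vec d a"] assms(3) by (simp add: inner_emb[of _ d])
  then show ?thesis using assms(1) by (simp add: continuous_on_inner)
qed

text \<open>Measurability on \<open>carrier_vec d\<close> is expressed through sequences: the vector
  is padded to a sequence, and the pullback of \<open>\<phi>\<close> to sequences is composed with
  that map.\<close>

lemma measurable_vec_function:
  fixes \<phi> :: "real vec \<Rightarrow> real"
  assumes \<phi>: "(\<lambda>a. \<phi> (vec d a)) \<in> borel_measurable borel"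
    and v: "\<And>\<omega>. \<omega> \<in> space M \<Longrightarrow> v \<omega> \<in> carrier_vec d" and coords: "\<And>i. i < d \<Longrightarrow> (\<lambda>\<omega>. v \<omega> $ i) \<in> borel_measurable M"
  shows "(\<lambda>\<omega>. \<phi> (v \<omega>)) \<in> borel_measurable M"
proof -
  define a where "a \<omega> i = (if i < d then v \<omega> $ i else 0)" for \<omega> i
  have "(\<lambda>\<omega>. a \<omega> i) \<in> borel_measurable M" for i
    unfolding a_def using coords by (cases "i < d") auto
  then have "a \<in> measurable M borel"
    by (intro measurable_coordinatewise_then_product)
  then have "(\<lambda>\<omega>. \<phi> (vec d (a \<omega>))) \<in> borel_measurable M"
    using \<phi> by (rule measurable_compose)
  moreover have "vec d (a \<omega>) = v \<omega>" if "\<omega> \<in> space M" for \<omega>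
    using v[OF that] unfolding a_def by auto
  ultimately show ?thesis by (simp cong: measurable_cong)
qed

lemma pred_vec_function:
  fixes P :: "real vec \<Rightarrow> bool"
  assumes P: "{a. P (vec d a)} \<in> sets borel"
    and v: "\<And>\<omega>. \<omega> \<in> space M \<Longrightarrow> v \<omega> \<in> carrier_vec d" and coords: "\<And>i. i < d \<Longrightarrow> (\<lambda>\<omega>. v \<omega> $ i) \<in> borel_measurable M"
  shows "Measurable.pred M (\<lambda>\<omega>. P (v \<omega>))"
proof -
  have "(\<lambda>a. indicator {a. P (vec d a)} a :: real) \<in> borel_measurable borel"
    using P by (rule borel_measurable_indicator)
  then have "(\<lambda>a. if P (vec d a) then 1 else 0 :: real) \<in> borel_measurable borel"
    by (simp add: indicator_def of_bool_def)
  then have "(\<lambda>\<omega>. if P (v \<omega>) then 1 else 0 :: real) \<in> borel_measurable M"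
    by (rule measurable_vec_function[where \<phi> = "\<lambda>x. if P x then 1 else 0 :: real"]) (use v coords in auto)
  then have "{\<omega> \<in> space M. (if P (v \<omega>) then 1 else 0 :: real) \<ge> 1} \<in> sets M" by measurable
  moreover have "{\<omega> \<in> space M. (if P (v \<omega>) then 1 else 0 :: real) \<ge> 1} = {\<omega> \<in> space M. P (v \<omega>)}" by auto
  ultimately show ?thesis by (simp add: pred_def)
qed

lemma measurable_If_pred:
  "Measurable.pred M P \<Longrightarrow> f \<in> measurable M N \<Longrightarrow> g \<in> measurable M N \<Longrightarrow>
    (\<lambda>x. if P x then f x else g x) \<in> measurable M N"
  by (rule measurable_If) (auto simp: pred_def)

lemma measurable_card_less:
  assumes "\<And>s. s < (n::nat) \<Longrightarrow> Measurable.pred M (P s)"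
  shows "(\<lambda>\<omega>. card {s. s < n \<and> P s \<omega>}) \<in> measurable M (count_space UNIV)"
proof -
  have "card {s. s < n \<and> P s \<omega>} = (\<Sum>s<n. if P s \<omega> then 1 else 0)" for \<omega>
    by (simp add: sum.If_cases Int_def)
  moreover have "(\<lambda>\<omega>. \<Sum>s<n. if P s \<omega> then 1 else 0 :: nat) \<in> measurable M (count_space UNIV)"
    using assms
  proof (induction n)
    case (Suc n)
    then have "(\<lambda>\<omega>. \<Sum>s<n. if P s \<omega> then 1 else 0 :: nat) \<in> measurable M (count_space UNIV)"
      and [measurable]: "Measurable.pred M (P n)" by auto
    note [measurable] = this(1)
    show ?case by simp measurable
  qed simp
  ultimately show ?thesis by simp
qed

lemma sets_noise_space: "sets noise_space = sets (\<Pi>\<^sub>M j\<in>UNIV. borel)"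
  unfolding noise_space_def by (rule sets_PiM_cong) auto

lemma space_noise_space: "space noise_space = UNIV"
  unfolding noise_space_def by (simp add: space_PiM)

lemma measurable_noise: "(\<lambda>\<omega>. \<omega> j) \<in> borel_measurable noise_space"
proof -
  have "(\<lambda>\<omega>. \<omega> j) \<in> borel_measurable (\<Pi>\<^sub>M j\<in>UNIV. borel)" by (rule measurable_component_singleton) simp
  then show ?thesis using measurable_cong_sets[OF sets_noise_space refl] by blast
qed

lemma prob_space_uniform: "prob_space (uniform_measure lborel {0..1::real})"
  by (rule prob_space_uniform_measure) auto

lemma prob_space_noise: "prob_space noise_space"
  unfolding noise_space_def by (rule prob_space_PiM) (rule prob_space_uniform)

context pgdot
begin

section \<open>Continuity of the objective and measurability of the set of saddles\<close>

lemma continuous_f: "continuous_on UNIV (f \<circ> proj d)"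
  using has_derivative_continuous[OF E.f_deriv] unfolding continuous_on_eq_continuous_at[OF open_UNIV] by blast

lemma continuous_grad: "continuous_on UNIV (\<lambda>a. emb (grad d f (proj d a)))"
  using has_derivative_continuous[OF E.g_deriv] unfolding continuous_on_eq_continuous_at[OF open_UNIV] by blast

lemma continuous_on_grad_vec: "continuous_on UNIV (\<lambda>a. emb (grad d f (vec d a)))"
proof -
  have "continuous_on UNIV ((\<lambda>a. emb (grad d f (proj d a))) \<circ> (\<lambda>a. emb (vec d a)))"
    by (rule continuous_on_compose[OF continuous_on_emb_vec continuous_on_subset[OF continuous_grad]]) simp
  then show ?thesis by (simp add: o_def)
qed

lemma continuous_on_f_vec: "continuous_on UNIV (\<lambda>a. f (vec d a))"
proof -
  have "continuous_on UNIV ((f \<circ> proj d) \<circ> (\<lambda>a. emb (vec d a)))"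
    by (rule continuous_on_compose[OF continuous_on_emb_vec continuous_on_subset[OF continuous_f]]) simp
  then show ?thesis by (simp add: o_def)
qed

lemma continuous_on_gd_pow: "continuous_on UNIV (E.gd (c / l) ^^ n)"
proof (induction n)
  case (Suc n)
  have "continuous_on UNIV (E.gd (c / l))"
    unfolding E.gd_def[abs_def] by (intro continuous_intros continuous_grad)
  from continuous_on_compose[OF Suc continuous_on_subset[OF this]] show ?case by simp
qed (simp add: id_def)

lemma continuous_on_emb_gdv_pow: "continuous_on UNIV (\<lambda>a. emb ((gdv ^^ n) (vec d a)))"
proof -
  have "continuous_on UNIV ((E.gd (c / l) ^^ n) \<circ> (\<lambda>a. emb (vec d a)))"
    by (rule continuous_on_compose[OF continuous_on_emb_vec continuous_on_subset[OF continuous_on_gd_pow]]) simp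
  then show ?thesis by (simp add: o_def emb_gdv_pow)
qed

lemma continuous_on_f_gdv_pow: "continuous_on UNIV (\<lambda>a. f ((gdv ^^ n) (vec d a)))"
proof -
  have "continuous_on UNIV ((f \<circ> proj d) \<circ> (\<lambda>a. emb ((gdv ^^ n) (vec d a))))"
    by (rule continuous_on_compose[OF continuous_on_emb_gdv_pow continuous_on_subset[OF continuous_f]]) simp
  then show ?thesis by (simp add: o_def)
qed

lemma continuous_on_hessian_form:
  assumes v: "v \<in> carrier_vec d"
  shows "continuous_on UNIV (\<lambda>a. v \<bullet> (hessian d f (vec d a) *\<^sub>v v))"
proof -
  let ?G = "\<lambda>a. emb (hessian d f (proj d a) *\<^sub>v proj d (emb v))"
  have "(\<rho> * norm (emb v))-lipschitz_on UNIV ?G"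
    using E.H_lip[of _ "emb v"] \<rho>_pos by (intro lipschitz_onI) (auto simp: dist_norm mult_ac)
  then have "continuous_on UNIV ?G" by (rule lipschitz_on_continuous_on)
  then have "continuous_on UNIV (?G \<circ> (\<lambda>a. emb (vec d a)))"
    by (intro continuous_on_compose[OF continuous_on_emb_vec continuous_on_subset]) auto
  then have "continuous_on UNIV (\<lambda>a. inner (emb v) (emb (hessian d f (vec d a) *\<^sub>v v)))"
    using v by (intro continuous_intros) (simp add: o_def)
  moreover have "hessian d f (vec d a) \<in> carrier_mat d d" for a
    using hessian_carrier[OF twice_differentiable] by simp
  then have "hessian d f (vec d a) *\<^sub>v v \<in> carrier_vec d" for a using v by (metis mult_mat_vec_carrier)
  ultimately show ?thesis using v by (simp add: inner_emb)
qed

lemma vnorm_grad_measurable: "(\<lambda>a. vnorm (grad d f (vec d a))) \<in> borel_measurable borel"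
proof -
  have "continuous_on UNIV (\<lambda>a. norm (emb (grad d f (vec d a))))"
    by (intro continuous_intros continuous_on_grad_vec)
  then show ?thesis by (simp add: borel_measurable_continuous_onI)
qed

lemma saddle_iff:
  assumes "x \<in> carrier_vec d"
  shows "saddle x \<longleftrightarrow> \<not> (\<forall>v\<in>carrier_vec d. - \<gamma> * (vnorm v)\<^sup>2 \<le> v \<bullet> (hessian d f x *\<^sub>v v))"
  unfolding saddle_def not_le[symmetric]
  by (subst lambda_min_ge_iff[OF hessian_carrier[OF twice_differentiable assms] d_pos])
    (use assms hessian_symmetric[OF gradient_lip hessian_lip l_pos \<rho>_pos] in auto)

text \<open>The complement is an intersection over uncountably many test vectors, which closed sets
  survive and measurable sets need not.\<close>

lemma saddle_measurable: "{a. saddle (vec d a)} \<in> sets borel"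
proof -
  have "closed {a. \<forall>v. v \<in> carrier_vec d \<longrightarrow> - \<gamma> * (vnorm v)\<^sup>2 \<le> v \<bullet> (hessian d f (vec d a) *\<^sub>v v)}"
  proof (rule closed_Collect_all)
    fix v :: "real vec"
    show "closed {a. v \<in> carrier_vec d \<longrightarrow> - \<gamma> * (vnorm v)\<^sup>2 \<le> v \<bullet> (hessian d f (vec d a) *\<^sub>v v)}"
    proof (cases "v \<in> carrier_vec d")
      case True
      then show ?thesis
        by (simp only: True simp_thms) (intro closed_Collect_le continuous_on_const continuous_on_hessian_form True)
    qed simp
  qed
  then have "- {a. \<forall>v. v \<in> carrier_vec d \<longrightarrow> - \<gamma> * (vnorm v)\<^sup>2 \<le> v \<bullet> (hessian d f (vec d a) *\<^sub>v v)} \<in> sets borel"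
    by (intro borel_comp borel_closed)
  moreover have "{a. saddle (vec d a)} = - {a. \<forall>v. v \<in> carrier_vec d \<longrightarrow> - \<gamma> * (vnorm v)\<^sup>2 \<le> v \<bullet> (hessian d f (vec d a) *\<^sub>v v)}"
    by (auto simp: saddle_iff)
  ultimately show ?thesis by simp
qed

text \<open>The pass counter is included because the success event compares it with the index of the
  state.\<close>

definition measurable_state :: "nat \<Rightarrow> bool" where
  "measurable_state n \<longleftrightarrow>
     Measurable.pred noise_space (\<lambda>\<omega>. state_running (run \<omega> n)) \<and>
     (\<lambda>\<omega>. state_noise_time (run \<omega> n)) \<in> measurable noise_space (count_space UNIV) \<and>
     (\<lambda>\<omega>. state_passes (run \<omega> n)) \<in> measurable noise_space (count_space UNIV) \<and>
     (\<forall>i<d. (\<lambda>\<omega>. state_current (run \<omega> n) $ i) \<in> borel_measurable noise_space) \<and>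
     (\<forall>i<d. (\<lambda>\<omega>. state_base (run \<omega> n) $ i) \<in> borel_measurable noise_space) \<and>
     (\<forall>i<d. \<forall>s<n. (\<lambda>\<omega>. (state_history (run \<omega> n) ! s) $ i) \<in> borel_measurable noise_space)"

lemma noisy_measurable:
  assumes "measurable_state n"
  shows "Measurable.pred noise_space (\<lambda>\<omega>. noisy \<omega> n)"
proof -
  have 1: "Measurable.pred noise_space (\<lambda>\<omega>. state_running (run \<omega> n))"
    using assms unfolding measurable_state_def by blast
  have 2: "Measurable.pred noise_space (\<lambda>\<omega>. int n - state_noise_time (run \<omega> n) > T)"
    by (rule measurable_compose[where g = "\<lambda>k. int n - k > T" and N = "count_space UNIV"])
      (use assms in \<open>auto simp: measurable_state_def\<close>)
  have "(\<lambda>\<omega>. vnorm (grad d f (state_current (run \<omega> n)))) \<in> borel_measurable noise_space"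
    by (rule measurable_vec_function[OF vnorm_grad_measurable])
      (use assms state_carrier in \<open>auto simp: measurable_state_def\<close>)
  then have 3: "Measurable.pred noise_space (\<lambda>\<omega>. vnorm (grad d f (state_current (run \<omega> n))) \<le> g0)"
    unfolding pred_def by (intro borel_measurable_le borel_measurable_const)
  show ?thesis unfolding noisy_def using 1 2 3 by (intro pred_intros_logic)
qed

lemma perturbed_coordinate:
  assumes "state_running (run \<omega> n)" "i < d"
  shows "perturbed \<omega> n $ i =
    (let L = card {s. s < n \<and> (state_history (run \<omega> n) ! s) $ i \<le> base \<omega> n $ i};
         R = card {s. s < n \<and> (state_history (run \<omega> n) ! s) $ i > base \<omega> n $ i}
     in if \<omega> (n, i, Sign) < w R / (w L + w R) then base \<omega> n $ i - r / sqrt (real d) * \<omega> (n, i, Size)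
        else base \<omega> n $ i + r / sqrt (real d) * \<omega> (n, i, Size))"
proof -
  obtain xs x tn y where R: "run \<omega> n = Running xs x tn y" using assms by (cases "run \<omega> n") auto
  then have "length xs = n" by (rule run_Running_length)
  then show ?thesis using assms(2) unfolding perturbed_def perturb_def R by (simp add: Let_def)
qed

text \<open>The guard is there because \<open>perturb\<close> reads the noise at time
  \<open>length xs\<close>, and this is \<open>n\<close> only for a running state.\<close>

lemma perturbed_measurable:
  assumes M: "measurable_state n" and i: "i < d"
  shows "(\<lambda>\<omega>. if state_running (run \<omega> n) then perturbed \<omega> n $ i else 0) \<in> borel_measurable noise_space"
proof -
  have rn: "Measurable.pred noise_space (\<lambda>\<omega>. state_running (run \<omega> n))"
    using M unfolding measurable_state_def by auto
  have b: "(\<lambda>\<omega>. base \<omega> n $ i) \<in> borel_measurable noise_space"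
    using M i unfolding measurable_state_def base_def by auto
  have h: "(\<lambda>\<omega>. (state_history (run \<omega> n) ! s) $ i) \<in> borel_measurable noise_space" if "s < n" for s
    using M i that unfolding measurable_state_def by auto
  define L where "L \<omega> = card {s. s < n \<and> (state_history (run \<omega> n) ! s) $ i \<le> base \<omega> n $ i}" for \<omega>
  define R where "R \<omega> = card {s. s < n \<and> (state_history (run \<omega> n) ! s) $ i > base \<omega> n $ i}" for \<omega>
  have Lm: "L \<in> measurable noise_space (count_space UNIV)"
    unfolding L_def[abs_def]
  proof (rule measurable_card_less)
    fix s assume "s < n"
    then show "Measurable.pred noise_space (\<lambda>\<omega>. (state_history (run \<omega> n) ! s) $ i \<le> base \<omega> n $ i)"
      unfolding pred_def by (intro borel_measurable_le h b)
  qed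
  have Rm: "R \<in> measurable noise_space (count_space UNIV)"
    unfolding R_def[abs_def]
  proof (rule measurable_card_less)
    fix s assume "s < n"
    then show "Measurable.pred noise_space (\<lambda>\<omega>. (state_history (run \<omega> n) ! s) $ i > base \<omega> n $ i)"
      unfolding pred_def by (intro borel_measurable_less h b)
  qed
  have "(\<lambda>\<omega>. w (R \<omega>) / (w (L \<omega>) + w (R \<omega>))) \<in> borel_measurable noise_space"
    by (intro borel_measurable_divide borel_measurable_add measurable_compose[OF Lm] measurable_compose[OF Rm]) auto
  then have p: "Measurable.pred noise_space (\<lambda>\<omega>. \<omega> (n, i, Sign) < w (R \<omega>) / (w (L \<omega>) + w (R \<omega>)))"
    unfolding pred_def by (intro borel_measurable_less measurable_noise)
  have "(\<lambda>\<omega>. if state_running (run \<omega> n) then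
       (if \<omega> (n, i, Sign) < w (R \<omega>) / (w (L \<omega>) + w (R \<omega>)) then base \<omega> n $ i - r / sqrt (real d) * \<omega> (n, i, Size)
        else base \<omega> n $ i + r / sqrt (real d) * \<omega> (n, i, Size)) else 0) \<in> borel_measurable noise_space"
    by (intro measurable_If_pred rn p borel_measurable_diff borel_measurable_add borel_measurable_times
        borel_measurable_const b measurable_noise)
  then show ?thesis
    unfolding L_def R_def by (rule measurable_cong[THEN iffD1, rotated]) (auto simp: perturbed_coordinate[OF _ i] Let_def)
qed

lemma measurable_state_run: "measurable_state n"
proof (induction n)
  case 0
  show ?case unfolding measurable_state_def by (simp add: run_0)
next
  case (Suc n)
  define N where "N \<omega> = noisy \<omega> n" for \<omega>
  define Rn where "Rn \<omega> = state_running (run \<omega> n)" for \<omega>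
  define X where "X \<omega> = (if N \<omega> then perturbed \<omega> n else base \<omega> n)" for \<omega>
  define Y where "Y \<omega> = (if N \<omega> then base \<omega> n else state_base (run \<omega> n))" for \<omega>
  define tn where "tn \<omega> = (if N \<omega> then int n else state_noise_time (run \<omega> n))" for \<omega>
  define stop where "stop \<omega> \<longleftrightarrow> Rn \<omega> \<and> int n - tn \<omega> = T \<and> f (X \<omega>) - f (Y \<omega>) > - F" for \<omega>
  \<comment> \<open>One pass as a case distinction on measurable predicates, so that each component
    of the next state becomes a nested \<open>if\<close> of measurable functions.\<close>
  have step: "run \<omega> (Suc n) = (if Rn \<omega> then
      (if stop \<omega> then Returned (Suc n) (Y \<omega>)
       else Running (state_history (run \<omega> n) @ [X \<omega>]) (gdv (X \<omega>)) (tn \<omega>) (Y \<omega>)) else run \<omega> n)" for \<omega>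
  proof (cases "run \<omega> n")
    case (Running xs x t y)
    then have "length xs = n" by (rule run_Running_length)
    then show ?thesis
      unfolding run_Suc stop_def X_def Y_def tn_def N_def Rn_def noisy_def perturbed_def base_def Running gdv_def
      by (simp add: Let_def)
  next
    case (Returned m y)
    then show ?thesis unfolding run_Suc Rn_def by simp
  qed
  have len: "Rn \<omega> \<Longrightarrow> length (state_history (run \<omega> n)) = n" for \<omega>
    unfolding Rn_def by (cases "run \<omega> n") (auto dest: run_Running_length)
  have Xc: "X \<omega> \<in> carrier_vec d" and Yc: "Y \<omega> \<in> carrier_vec d" for \<omega>
    unfolding X_def Y_def base_def by (auto simp: state_carrier)
  have Nm: "Measurable.pred noise_space N" and Rm: "Measurable.pred noise_space Rn"
    and old: "(\<lambda>\<omega>. state_noise_time (run \<omega> n)) \<in> measurable noise_space (count_space UNIV)"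
    "(\<lambda>\<omega>. state_passes (run \<omega> n)) \<in> measurable noise_space (count_space UNIV)"
    using noisy_measurable[OF Suc] Suc unfolding N_def[abs_def] Rn_def[abs_def] measurable_state_def by auto
  have c: "(\<lambda>\<omega>. state_current (run \<omega> n) $ i) \<in> borel_measurable noise_space"
    "(\<lambda>\<omega>. base \<omega> n $ i) \<in> borel_measurable noise_space"
    "(\<lambda>\<omega>. state_base (run \<omega> n) $ i) \<in> borel_measurable noise_space" if "i < d" for i
    using Suc that unfolding measurable_state_def base_def by auto
  have NR: "N \<omega> \<Longrightarrow> state_running (run \<omega> n)" for \<omega> unfolding N_def noisy_def by simp
  have Xm: "(\<lambda>\<omega>. X \<omega> $ i) \<in> borel_measurable noise_space" if i: "i < d" for i
  proof -
    have "(\<lambda>\<omega>. if N \<omega> then (if state_running (run \<omega> n) then perturbed \<omega> n $ i else 0) else base \<omega> n $ i) \<in> borel_measurable noise_space"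
      by (intro measurable_If_pred[OF Nm] perturbed_measurable[OF Suc i] c[OF i])
    moreover have "X \<omega> $ i = (if N \<omega> then (if state_running (run \<omega> n) then perturbed \<omega> n $ i else 0) else base \<omega> n $ i)" for \<omega>
      unfolding X_def using NR by auto
    ultimately show ?thesis by simp
  qed
  have Ym: "(\<lambda>\<omega>. Y \<omega> $ i) \<in> borel_measurable noise_space" if i: "i < d" for i
  proof -
    have "(\<lambda>\<omega>. if N \<omega> then base \<omega> n $ i else state_base (run \<omega> n) $ i) \<in> borel_measurable noise_space"
      by (intro measurable_If_pred[OF Nm] c[OF i])
    moreover have "Y \<omega> $ i = (if N \<omega> then base \<omega> n $ i else state_base (run \<omega> n) $ i)" for \<omega>
      unfolding Y_def by auto
    ultimately show ?thesis by simp
  qed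
  have tm: "tn \<in> measurable noise_space (count_space UNIV)"
    unfolding tn_def[abs_def] by (intro measurable_If_pred[OF Nm] old measurable_const) simp
  have fX: "(\<lambda>\<omega>. f (X \<omega>)) \<in> borel_measurable noise_space"
    by (rule measurable_vec_function[OF borel_measurable_continuous_onI[OF continuous_on_f_vec]])
      (use Xc Xm in auto)
  have fY: "(\<lambda>\<omega>. f (Y \<omega>)) \<in> borel_measurable noise_space"
    by (rule measurable_vec_function[OF borel_measurable_continuous_onI[OF continuous_on_f_vec]])
      (use Yc Ym in auto)
  have s1: "Measurable.pred noise_space (\<lambda>\<omega>. int n - tn \<omega> = T)"
    by (rule measurable_compose[OF tm, where g = "\<lambda>k. int n - k = T"]) auto
  have s2: "Measurable.pred noise_space (\<lambda>\<omega>. f (X \<omega>) - f (Y \<omega>) > - F)"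
    unfolding pred_def by (intro borel_measurable_less borel_measurable_diff borel_measurable_const fX fY)
  have stm: "Measurable.pred noise_space stop"
    unfolding stop_def[abs_def] by (intro pred_intros_logic Rm s1 s2)
  have gm: "(\<lambda>\<omega>. gdv (X \<omega>) $ i) \<in> borel_measurable noise_space" if "i < d" for i
  proof (rule measurable_vec_function[where v = X and \<phi> = "\<lambda>x. gdv x $ i"])
    show "(\<lambda>a. gdv (vec d a) $ i) \<in> borel_measurable borel"
      using continuous_on_emb_gdv_pow[of 1] that
      by (intro borel_measurable_continuous_onI continuous_on_vec_coordinate) auto
  qed (use Xc Xm in auto)
  have RS: "Measurable.pred noise_space (\<lambda>\<omega>. Rn \<omega> \<and> \<not> stop \<omega>)"
    by (intro pred_intros_logic Rm stm)
  show ?case unfolding measurable_state_def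
  proof (intro conjI allI impI)
    show "Measurable.pred noise_space (\<lambda>\<omega>. state_running (run \<omega> (Suc n)))"
    proof -
      have "Measurable.pred noise_space (\<lambda>\<omega>. Rn \<omega> \<and> \<not> stop \<omega>)" by (intro pred_intros_logic Rm stm)
      moreover have "state_running (run \<omega> (Suc n)) \<longleftrightarrow> Rn \<omega> \<and> \<not> stop \<omega>" for \<omega>
        unfolding step by (auto simp: Rn_def)
      ultimately show ?thesis by simp
    qed
    show "(\<lambda>\<omega>. state_noise_time (run \<omega> (Suc n))) \<in> measurable noise_space (count_space UNIV)"
    proof -
      have "(\<lambda>\<omega>. if Rn \<omega> then (if stop \<omega> then 0 else tn \<omega>) else state_noise_time (run \<omega> n)) \<in> measurable noise_space (count_space UNIV)"
        by (intro measurable_If_pred Rm stm RS old tm measurable_const c Xm Ym gm) simp_all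
      moreover have "state_noise_time (run \<omega> (Suc n)) = (if Rn \<omega> then (if stop \<omega> then 0 else tn \<omega>) else state_noise_time (run \<omega> n))" for \<omega>
        unfolding step by auto
      ultimately show ?thesis by simp
    qed
    show "(\<lambda>\<omega>. state_passes (run \<omega> (Suc n))) \<in> measurable noise_space (count_space UNIV)"
    proof -
      have "(\<lambda>\<omega>. if Rn \<omega> then Suc n else state_passes (run \<omega> n)) \<in> measurable noise_space (count_space UNIV)"
        by (intro measurable_If_pred Rm stm RS old tm measurable_const c Xm Ym gm) simp_all
      moreover have "state_passes (run \<omega> (Suc n)) = (if Rn \<omega> then Suc n else state_passes (run \<omega> n))" for \<omega>
        unfolding step using len by auto
      ultimately show ?thesis by simp
    qed
    fix i assume i: "i < d"
    show "(\<lambda>\<omega>. state_current (run \<omega> (Suc n)) $ i) \<in> borel_measurable noise_space"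
    proof -
      have "(\<lambda>\<omega>. if Rn \<omega> then (if stop \<omega> then Y \<omega> $ i else gdv (X \<omega>) $ i) else state_current (run \<omega> n) $ i) \<in> borel_measurable noise_space"
        by (intro measurable_If_pred Rm stm RS old tm measurable_const c Xm Ym gm i)
      moreover have "state_current (run \<omega> (Suc n)) $ i = (if Rn \<omega> then (if stop \<omega> then Y \<omega> $ i else gdv (X \<omega>) $ i) else state_current (run \<omega> n) $ i)" for \<omega>
        unfolding step by auto
      ultimately show ?thesis by simp
    qed
    show "(\<lambda>\<omega>. state_base (run \<omega> (Suc n)) $ i) \<in> borel_measurable noise_space"
    proof -
      have "(\<lambda>\<omega>. if Rn \<omega> then Y \<omega> $ i else state_base (run \<omega> n) $ i) \<in> borel_measurable noise_space"
        by (intro measurable_If_pred Rm stm RS old tm measurable_const c Xm Ym gm i)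
      moreover have "state_base (run \<omega> (Suc n)) $ i = (if Rn \<omega> then Y \<omega> $ i else state_base (run \<omega> n) $ i)" for \<omega>
        unfolding step by auto
      ultimately show ?thesis by simp
    qed
    fix s assume s: "s < Suc n"
    show "(\<lambda>\<omega>. (state_history (run \<omega> (Suc n)) ! s) $ i) \<in> borel_measurable noise_space"
    proof -
      define h where "h \<omega> = (if s < n then (state_history (run \<omega> n) ! s) $ i else X \<omega> $ i)" for \<omega>
      have hm: "h \<in> borel_measurable noise_space"
        using Suc i Xm[OF i] unfolding measurable_state_def h_def[abs_def] by (cases "s < n") auto
      \<comment> \<open>A returned state has an empty history. The value \<open>[] ! s\<close> is
        unspecified but fixed, hence a constant function of \<open>\<omega>\<close>.\<close>
      have "(\<lambda>\<omega>. if Rn \<omega> \<and> \<not> stop \<omega> then h \<omega> else ([] ! s) $ i) \<in> borel_measurable noise_space"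
        by (rule measurable_If_pred[OF RS hm]) simp
      moreover have "(state_history (run \<omega> (Suc n)) ! s) $ i = (if Rn \<omega> \<and> \<not> stop \<omega> then h \<omega> else ([] ! s) $ i)" for \<omega>
      proof -
        have "\<not> Rn \<omega> \<Longrightarrow> state_history (run \<omega> n) = []" unfolding Rn_def by (cases "run \<omega> n") auto
        moreover have "s < n \<or> s = n" using s by auto
        ultimately show ?thesis unfolding step h_def using len[of \<omega>] by (auto simp: nth_append)
      qed
      ultimately show ?thesis by simp
    qed
  qed
qed

end

section \<open>The failure probability\<close>

context pgdot
begin

definition failure :: "nat \<Rightarrow> noise \<Rightarrow> bool" where
  "failure t \<omega> \<longleftrightarrow> noisy \<omega> t \<and> saddle (base \<omega> t) \<and> stuck (base \<omega> t) (perturbed \<omega> t)"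

lemma base_carrier: "base \<omega> t \<in> carrier_vec d"
  unfolding base_def by (rule state_carrier)

lemma saddle_event: "{\<omega>. noisy \<omega> t \<and> saddle (base \<omega> t)} \<in> sets noise_space"
proof -
  have "Measurable.pred noise_space (\<lambda>\<omega>. saddle (base \<omega> t))"
    by (rule pred_vec_function[OF saddle_measurable])
      (use base_carrier measurable_state_run[of t] in \<open>auto simp: measurable_state_def base_def\<close>)
  then have "Measurable.pred noise_space (\<lambda>\<omega>. noisy \<omega> t \<and> saddle (base \<omega> t))"
    by (intro pred_intros_logic noisy_measurable measurable_state_run)
  then show ?thesis by (simp add: pred_def space_noise_space)
qed

lemma failure_event: "{\<omega>. failure t \<omega>} \<in> sets noise_space"
proof -
  have M: "measurable_state t" by (rule measurable_state_run)
  have 1: "Measurable.pred noise_space (\<lambda>\<omega>. noisy \<omega> t \<and> saddle (base \<omega> t))"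
    using saddle_event by (simp add: pred_def space_noise_space)
  have rn: "Measurable.pred noise_space (\<lambda>\<omega>. state_running (run \<omega> t))"
    using M unfolding measurable_state_def by blast
  define X where "X \<omega> = (if state_running (run \<omega> t) then perturbed \<omega> t else 0\<^sub>v d)" for \<omega>
  have Xc: "X \<omega> \<in> carrier_vec d" for \<omega> unfolding X_def by simp
  have Xm: "(\<lambda>\<omega>. X \<omega> $ i) \<in> borel_measurable noise_space" if "i < d" for i
  proof -
    have "X \<omega> $ i = (if state_running (run \<omega> t) then perturbed \<omega> t $ i else 0)" for \<omega>
      unfolding X_def using that by simp
    then show ?thesis using perturbed_measurable[OF M that] by simp
  qed
  have a: "(\<lambda>\<omega>. f ((gdv ^^ nat T) (X \<omega>))) \<in> borel_measurable noise_space"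
    by (rule measurable_vec_function[OF borel_measurable_continuous_onI[OF continuous_on_f_gdv_pow]])
      (use Xc Xm in auto)
  have b: "(\<lambda>\<omega>. f (base \<omega> t)) \<in> borel_measurable noise_space"
    by (rule measurable_vec_function[OF borel_measurable_continuous_onI[OF continuous_on_f_vec]])
      (use base_carrier M in \<open>auto simp: measurable_state_def base_def\<close>)
  have 2: "Measurable.pred noise_space (\<lambda>\<omega>. f ((gdv ^^ nat T) (X \<omega>)) - f (base \<omega> t) > - F)"
    unfolding pred_def by (intro borel_measurable_less borel_measurable_diff borel_measurable_const a b)
  have "Measurable.pred noise_space (\<lambda>\<omega>. (noisy \<omega> t \<and> saddle (base \<omega> t)) \<and> f ((gdv ^^ nat T) (X \<omega>)) - f (base \<omega> t) > - F)"
    by (intro pred_intros_logic 1 2)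
  moreover have "failure t \<omega> \<longleftrightarrow> (noisy \<omega> t \<and> saddle (base \<omega> t)) \<and> f ((gdv ^^ nat T) (X \<omega>)) - f (base \<omega> t) > - F" for \<omega>
    unfolding failure_def stuck_def X_def noisy_def by auto
  ultimately show ?thesis by (simp add: pred_def space_noise_space)
qed

lemma not_saddle_iff: "\<not> saddle x \<longleftrightarrow> - sqrt (\<rho> * \<epsilon>) \<le> lambda_min (hessian d f x)"
  by (simp add: saddle_def not_less \<gamma>_eq[symmetric])

text \<open>Only the \<open>Size\<close> variables of one time are resampled. With the
  \<open>Sign\<close> variables kept, the perturbed point is an affine function of the new
  sample.\<close>

definition size_noise :: "nat \<Rightarrow> (nat \<times> nat \<times> noise_kind) set" where
  "size_noise t = (\<lambda>i. (t, i, Size)) ` {..<d}"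

definition resample :: "nat \<Rightarrow> noise \<Rightarrow> noise \<Rightarrow> noise" where
  "resample t u \<omega> = (\<lambda>j. if j \<in> size_noise t then u j else \<omega> j)"

lemma run_resample: "run (resample t u \<omega>) t = run \<omega> t"
  by (rule run_cong) (auto simp: resample_def size_noise_def)

text \<open>The signs are chosen before \<open>u\<close>: they are determined by the past and by the
  \<open>Sign\<close> variables, and the occupation weights enter only through them.\<close>

lemma perturbed_resample:
  assumes "state_running (run \<omega> t)"
  shows "\<exists>\<sigma>. (\<forall>i. \<sigma> i = 1 \<or> \<sigma> i = - 1) \<and>
    (\<forall>u i. i < d \<longrightarrow> perturbed (resample t u \<omega>) t $ i = base \<omega> t $ i + \<sigma> i * (r / sqrt d * u (t, i, Size)))"
proof -
  define p where "p i = (let L = card {s. s < t \<and> (state_history (run \<omega> t) ! s) $ i \<le> base \<omega> t $ i};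
         R = card {s. s < t \<and> (state_history (run \<omega> t) ! s) $ i > base \<omega> t $ i}
     in w R / (w L + w R))" for i
  show ?thesis
  proof (intro exI[of _ "\<lambda>i. if \<omega> (t, i, Sign) < p i then - 1 else 1"] conjI allI impI)
    fix u i assume i: "i < d"
    have "resample t u \<omega> (t, i, Size) = u (t, i, Size)" "resample t u \<omega> (t, i, Sign) = \<omega> (t, i, Sign)"
      using i by (auto simp: resample_def size_noise_def)
    moreover have "base (resample t u \<omega>) t = base \<omega> t" unfolding base_def run_resample ..
    ultimately show "perturbed (resample t u \<omega>) t $ i
      = base \<omega> t $ i + (if \<omega> (t, i, Sign) < p i then - 1 else 1) * (r / sqrt d * u (t, i, Size))"
      using perturbed_coordinate[of "resample t u \<omega>" t i] assms i
      unfolding run_resample p_def by (simp add: Let_def)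
  qed simp
qed

lemma resampled_failure_small:
  assumes \<omega>: "noisy \<omega> t" "saddle (base \<omega> t)"
    and S: "{u \<in> space (\<Pi>\<^sub>M j\<in>size_noise t. uniform_measure lborel {0..1}). failure t (resample t u \<omega>)}
      \<in> sets (\<Pi>\<^sub>M j\<in>size_noise t. uniform_measure lborel {0..1})"
  shows "emeasure (\<Pi>\<^sub>M j\<in>size_noise t. uniform_measure lborel {0..1})
    {u \<in> space (\<Pi>\<^sub>M j\<in>size_noise t. uniform_measure lborel {0..1}). failure t (resample t u \<omega>)}
    \<le> ennreal failure_bound"
proof -
  let ?x = "base \<omega> t"
  have x: "?x \<in> carrier_vec d" by (rule base_carrier)
  have g: "vnorm (grad d f ?x) \<le> g0" using \<omega> unfolding noisy_def base_def by simp
  obtain e where e: "e \<in> carrier_vec d" "vnorm e = 1"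
    "hessian d f ?x *\<^sub>v e = lambda_min (hessian d f ?x) \<cdot>\<^sub>v e"
    using hessian_eigenvector[OF x] .
  obtain \<sigma> where \<sigma>: "\<And>i. \<sigma> i = 1 \<or> \<sigma> i = - 1"
    and per: "\<And>u i. i < d \<Longrightarrow> perturbed (resample t u \<omega>) t $ i = ?x $ i + \<sigma> i * (r / sqrt d * u (t, i, Size))"
    using perturbed_resample[of \<omega> t] \<omega> unfolding noisy_def by blast
  have \<sigma>2: "\<sigma> i * \<sigma> i = 1" "\<bar>\<sigma> i\<bar> = 1" for i using \<sigma>[of i] by auto
  \<comment> \<open>The pullback of the eigenvector to the coordinates of the noise. As each
    \<open>\<sigma> i\<close> squares to 1, moving the sample by \<open>s * v\<close> moves the
    perturbed point by \<open>r / sqrt d * s\<close> times \<open>e\<close>, whatever the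
    signs.\<close>
  define v where "v j = (case j of (_, i, _) \<Rightarrow> \<sigma> i * e $ i)" for j :: "nat \<times> nat \<times> noise_kind"
  have inj: "inj_on (\<lambda>i. (t, i, Size)) {..<d}" by (auto simp: inj_on_def)
  have card: "card (size_noise t) = d" unfolding size_noise_def using inj by (simp add: card_image)
  have v1: "(\<Sum>j\<in>size_noise t. (v j)\<^sup>2) \<le> 1"
  proof -
    have "(\<Sum>j\<in>size_noise t. (v j)\<^sup>2) = (\<Sum>i<d. (\<sigma> i * e $ i)\<^sup>2)"
      unfolding size_noise_def v_def using inj by (simp add: sum.reindex)
    also have "\<dots> = (\<Sum>i<d. (e $ i)\<^sup>2)" by (simp add: power_mult_distrib power2_eq_square[of "\<sigma> _"] \<sigma>2)
    also have "\<dots> = (vnorm e)\<^sup>2" using e by (simp add: vnorm_eq_L2[of _ d] L2_set_def sum_nonneg atLeast0LessThan)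
    finally show ?thesis using e by simp
  qed
  have near: "vnorm (perturbed (resample t u \<omega>) t - ?x) \<le> r" if u: "\<forall>j\<in>size_noise t. u j \<in> {0..1}" for u
  proof -
    have "(\<Sum>i<d. ((perturbed (resample t u \<omega>) t - ?x) $ i)\<^sup>2) \<le> (\<Sum>i<d. (r / sqrt d)\<^sup>2)"
    proof (rule sum_mono)
      fix i assume i: "i \<in> {..<d}"
      have ui: "\<bar>u (t, i, Size)\<bar> \<le> 1" using u i unfolding size_noise_def by auto
      have "\<bar>(perturbed (resample t u \<omega>) t - ?x) $ i\<bar> = r / sqrt d * \<bar>u (t, i, Size)\<bar>"
        using i x per[of i u] pos by (simp add: abs_mult \<sigma>2)
      also have "\<dots> \<le> r / sqrt d * 1" using ui pos by (intro mult_left_mono) auto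
      finally show "((perturbed (resample t u \<omega>) t - ?x) $ i)\<^sup>2 \<le> (r / sqrt d)\<^sup>2"
        by (metis abs_ge_zero mult.right_neutral power2_abs power_mono)
    qed
    also have "\<dots> = r\<^sup>2" using d_pos by (simp add: power_divide)
    finally have "sqrt (\<Sum>i<d. ((perturbed (resample t u \<omega>) t - ?x) $ i)\<^sup>2) \<le> r"
      using pos by (intro real_le_lsqrt) (auto intro: sum_nonneg)
    then show ?thesis using x by (subst vnorm_eq_L2[of _ d]) (auto simp: L2_set_def atLeast0LessThan)
  qed
  have "emeasure (\<Pi>\<^sub>M j\<in>size_noise t. uniform_measure lborel {0..1})
    {u \<in> space (\<Pi>\<^sub>M j\<in>size_noise t. uniform_measure lborel {0..1}). failure t (resample t u \<omega>)}
    \<le> ennreal (exp 1 * sqrt (card (size_noise t)) * thickness)"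
  proof (rule emeasure_uniform_cube_thin_set_le[OF _ _ S v1 thickness_pos])
    show "finite (size_noise t)" unfolding size_noise_def by simp
    show "size_noise t \<noteq> {}" unfolding size_noise_def using d_pos by (simp add: lessThan_empty_iff)
    fix u s
    let ?u' = "\<lambda>j\<in>size_noise t. u j + s * v j"
    assume u: "u \<in> {u \<in> space (\<Pi>\<^sub>M j\<in>size_noise t. uniform_measure lborel {0..1}). failure t (resample t u \<omega>)}"
      and u': "?u' \<in> {u \<in> space (\<Pi>\<^sub>M j\<in>size_noise t. uniform_measure lborel {0..1}). failure t (resample t u \<omega>)}"
      and c: "\<forall>j\<in>size_noise t. u j \<in> {0..1}" "\<forall>j\<in>size_noise t. u j + s * v j \<in> {0..1}"
    define a where "a = r / sqrt d"
    have a: "a > 0" unfolding a_def using pos d_pos by simp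
    have b: "base (resample t u \<omega>) t = ?x" for u unfolding base_def run_resample ..
    have "\<bar>a * s\<bar> \<le> 4 * local_radius * exp (- 3 * \<chi>)"
    proof (rule stuck_pair_close[OF x g \<omega>(2) e])
      show "perturbed (resample t ?u' \<omega>) t \<in> carrier_vec d" "perturbed (resample t u \<omega>) t \<in> carrier_vec d" by simp_all
      show "stuck ?x (perturbed (resample t ?u' \<omega>) t)" "stuck ?x (perturbed (resample t u \<omega>) t)"
        using u u' unfolding failure_def b by auto
      show "vnorm (perturbed (resample t u \<omega>) t - ?x) \<le> r" by (rule near) (use c in auto)
      show "vnorm (perturbed (resample t ?u' \<omega>) t - ?x) \<le> r" by (rule near) (use c in auto)
      have "dim_vec (perturbed \<omega>' t) = d" for \<omega>' by (rule carrier_vecD[OF perturbed_carrier])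
      note dims = this carrier_vecD[OF e(1)]
      show "perturbed (resample t ?u' \<omega>) t - perturbed (resample t u \<omega>) t = (a * s) \<cdot>\<^sub>v e"
      proof (rule eq_vecI)
        fix i assume "i < dim_vec ((a * s) \<cdot>\<^sub>v e)"
        then have i: "i < d" by (simp only: index_smult_vec dims)
        have "(t, i, Size) \<in> size_noise t" using i unfolding size_noise_def by simp
        then have "perturbed (resample t ?u' \<omega>) t $ i = ?x $ i + \<sigma> i * (a * (u (t, i, Size) + s * (\<sigma> i * e $ i)))"
          using per[OF i, of ?u'] unfolding a_def by (simp add: v_def)
        also have "\<dots> = perturbed (resample t u \<omega>) t $ i + (\<sigma> i * \<sigma> i) * (a * s * e $ i)"
          using per[OF i, of u] unfolding a_def by (simp add: algebra_simps)
        finally have "perturbed (resample t ?u' \<omega>) t $ i - perturbed (resample t u \<omega>) t $ i = a * s * e $ i"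
          by (simp add: \<sigma>2)
        then show "(perturbed (resample t ?u' \<omega>) t - perturbed (resample t u \<omega>) t) $ i = ((a * s) \<cdot>\<^sub>v e) $ i"
          using i by (simp only: index_minus_vec index_smult_vec dims)
      qed (simp only: index_minus_vec index_smult_vec dims)
    qed
    then have "a * \<bar>s\<bar> \<le> 4 * local_radius * exp (- 3 * \<chi>)"
      using a by (simp only: abs_mult abs_of_pos)
    then have "\<bar>s\<bar> \<le> 4 * local_radius * exp (- 3 * \<chi>) / a"
      by (intro mult_imp_le_div_pos[OF a]) (subst mult.commute)
    also have "\<dots> = thickness / 2"
    proof -
      \<comment> \<open>Dividing by the scale \<open>r / sqrt d\<close> gives exactly half the
        thickness.\<close>
      have "4 * A * B / (q / D) = 8 * A * B * D / q / 2" for A B D q :: real by simp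
      then show ?thesis unfolding thickness_def a_def .
    qed
    also have "\<dots> < thickness" using thickness_pos by simp
    finally show "\<bar>s\<bar> < thickness" .
  qed
  then show ?thesis unfolding failure_bound_def card .
qed

text \<open>Whether an epoch starts at \<open>t\<close>, and whether at a saddle, is decided before
  the noise of time \<open>t\<close>; resampling does not change that event.\<close>

lemma emeasure_failure_le:
  "emeasure noise_space {\<omega>. failure t \<omega>}
    \<le> ennreal failure_bound * emeasure noise_space {\<omega>. noisy \<omega> t \<and> saddle (base \<omega> t)}"
  unfolding noise_space_def
proof (rule emeasure_le_resample[where J = "size_noise t"])
  show "finite (size_noise t)" unfolding size_noise_def by simp
  show "{\<omega>. failure t \<omega>} \<in> sets (\<Pi>\<^sub>M j\<in>UNIV. uniform_measure lborel {0..1})"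
    using failure_event unfolding noise_space_def .
  show "{\<omega>. noisy \<omega> t \<and> saddle (base \<omega> t)} \<in> sets (\<Pi>\<^sub>M j\<in>UNIV. uniform_measure lborel {0..1})"
    using saddle_event unfolding noise_space_def .
  fix \<omega> u
  assume "(\<lambda>i. if i \<in> size_noise t then u i else \<omega> i) \<in> {\<omega>. failure t \<omega>}"
  then have "failure t (resample t u \<omega>)" unfolding resample_def by simp
  then show "\<omega> \<in> {\<omega>. noisy \<omega> t \<and> saddle (base \<omega> t)}"
    unfolding failure_def noisy_def base_def run_resample by simp
next
  fix \<omega>
  assume "\<omega> \<in> {\<omega>. noisy \<omega> t \<and> saddle (base \<omega> t)}"
    and "{u \<in> space (\<Pi>\<^sub>M j\<in>size_noise t. uniform_measure lborel {0..1}).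
      (\<lambda>i. if i \<in> size_noise t then u i else \<omega> i) \<in> {\<omega>. failure t \<omega>}}
      \<in> sets (\<Pi>\<^sub>M j\<in>size_noise t. uniform_measure lborel {0..1})"
  then show "emeasure (\<Pi>\<^sub>M j\<in>size_noise t. uniform_measure lborel {0..1})
     {u \<in> space (\<Pi>\<^sub>M j\<in>size_noise t. uniform_measure lborel {0..1}).
      (\<lambda>i. if i \<in> size_noise t then u i else \<omega> i) \<in> {\<omega>. failure t \<omega>}} \<le> ennreal failure_bound"
    using resampled_failure_small[of \<omega> t] unfolding resample_def by simp
qed (rule prob_space_uniform)

text \<open>
  The bound on the number of epochs that start at a saddle holds surely; hence it suffices to
  bound the conditional failure probability of a single epoch.
\<close>

lemma prob_some_failure_le: "measure noise_space (\<Union>t<n. {\<omega>. failure t \<omega>}) \<le> \<delta>"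
proof -
  interpret prob_space noise_space by (rule prob_space_noise)
  let ?B = "\<lambda>t. {\<omega>. noisy \<omega> t \<and> saddle (base \<omega> t)}"
  have fb: "failure_bound \<ge> 0" unfolding failure_bound_def using thickness_pos by simp
  have "emeasure noise_space (\<Union>t<n. {\<omega>. failure t \<omega>}) \<le> (\<Sum>t<n. emeasure noise_space {\<omega>. failure t \<omega>})"
    by (rule emeasure_subadditive_finite) (use failure_event in auto)
  also have "\<dots> \<le> (\<Sum>t<n. ennreal failure_bound * emeasure noise_space (?B t))"
    by (intro sum_mono emeasure_failure_le)
  also have "\<dots> = ennreal failure_bound * (\<Sum>t<n. emeasure noise_space (?B t))"
    by (simp add: sum_distrib_left)
  \<comment> \<open>The probabilities add up to the expected number of epochs started at a saddle.
    Bounding this number pointwise avoids the factor \<open>n\<close> that a uniform bound for each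
    time would bring.\<close>
  also have "(\<Sum>t<n. emeasure noise_space (?B t)) = (\<integral>\<^sup>+\<omega>. (\<Sum>t<n. indicator (?B t) \<omega>) \<partial>noise_space)"
    using saddle_event by (subst nn_integral_sum) auto
  also have "\<dots> \<le> (\<integral>\<^sup>+\<omega>. ennreal (2 * gap / F) \<partial>noise_space)"
  proof (rule nn_integral_mono)
    fix \<omega>
    have "(\<Sum>t<n. indicator (?B t) \<omega>) = (of_nat (card {t. t < n \<and> noisy \<omega> t \<and> saddle (base \<omega> t)}) :: ennreal)"
    proof -
      have "(\<Sum>t<n. indicator (?B t) \<omega> :: ennreal) = (\<Sum>t<n. if noisy \<omega> t \<and> saddle (base \<omega> t) then 1 else 0)"
        by (rule sum.cong) (auto simp: indicator_def)
      also have "\<dots> = of_nat (card ({..<n} \<inter> {t. noisy \<omega> t \<and> saddle (base \<omega> t)}))"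
        by (subst sum.If_cases) simp_all
      also have "{..<n} \<inter> {t. noisy \<omega> t \<and> saddle (base \<omega> t)} = {t. t < n \<and> noisy \<omega> t \<and> saddle (base \<omega> t)}" by auto
      finally show ?thesis .
    qed
    also have "\<dots> = ennreal (real (card {t. t < n \<and> noisy \<omega> t \<and> saddle (base \<omega> t)}))"
      by (simp add: ennreal_of_nat_eq_real_of_nat)
    also have "\<dots> \<le> ennreal (2 * gap / F)"
      using noisy_saddle_count[of n \<omega>] pos by (intro ennreal_leI) (simp only: pos_le_divide_eq)
    finally show "(\<Sum>t<n. indicator (?B t) \<omega>) \<le> ennreal (2 * gap / F)" .
  qed
  also have "\<dots> = ennreal (2 * gap / F)" by (simp add: emeasure_space_1)
  finally have "emeasure noise_space (\<Union>t<n. {\<omega>. failure t \<omega>}) \<le> ennreal failure_bound * ennreal (2 * gap / F)"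
    by (simp add: mult_left_mono)
  also have "\<dots> = ennreal (failure_bound * (2 * gap / F))"
    by (rule ennreal_mult'[symmetric, OF fb])
  also have "\<dots> \<le> ennreal \<delta>" by (intro ennreal_leI failure_bound_total)
  finally show ?thesis using \<delta>_pos by (simp add: emeasure_eq_measure)
qed

text \<open>The output can be read off the state by \<open>state_current\<close>, and the pass
  counter must equal the index; what remains is a countable union over \<open>n\<close>.\<close>

lemma success_event:
  "{\<omega>. \<exists>n y. run \<omega> n = Returned n y \<and> second_order_stationary d f \<rho> \<epsilon> y \<and> real n \<le> K} \<in> sets noise_space"
proof -
  have "{\<omega>. run \<omega> n = Returned n (state_current (run \<omega> n)) \<and> second_order_stationary d f \<rho> \<epsilon> (state_current (run \<omega> n))}
    \<in> sets noise_space" for n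
  proof -
    have M: "measurable_state n" by (rule measurable_state_run)
    have 1: "Measurable.pred noise_space (\<lambda>\<omega>. \<not> state_running (run \<omega> n))"
      by (intro pred_intros_logic) (use M measurable_state_def in blast)
    have "(\<lambda>\<omega>. state_passes (run \<omega> n)) \<in> measurable noise_space (count_space UNIV)"
      using M unfolding measurable_state_def by blast
    then have 2: "Measurable.pred noise_space (\<lambda>\<omega>. state_passes (run \<omega> n) = n)"
      by (rule measurable_compose[where g = "\<lambda>k. k = n"]) simp
    have cc: "state_current (run \<omega> n) \<in> carrier_vec d" for \<omega> by (rule state_carrier)
    have cm: "(\<lambda>\<omega>. state_current (run \<omega> n) $ i) \<in> borel_measurable noise_space" if "i < d" for i
      using M that unfolding measurable_state_def by blast
    have "(\<lambda>\<omega>. vnorm (grad d f (state_current (run \<omega> n)))) \<in> borel_measurable noise_space"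
      by (rule measurable_vec_function[OF vnorm_grad_measurable]) (use cc cm in auto)
    then have 3: "Measurable.pred noise_space (\<lambda>\<omega>. vnorm (grad d f (state_current (run \<omega> n))) \<le> \<epsilon>)"
      unfolding pred_def by (intro borel_measurable_le borel_measurable_const)
    have 4: "Measurable.pred noise_space (\<lambda>\<omega>. saddle (state_current (run \<omega> n)))"
      by (rule pred_vec_function[OF saddle_measurable]) (use cc cm in auto)
    have "Measurable.pred noise_space (\<lambda>\<omega>. \<not> state_running (run \<omega> n) \<and> state_passes (run \<omega> n) = n \<and>
        vnorm (grad d f (state_current (run \<omega> n))) \<le> \<epsilon> \<and> \<not> saddle (state_current (run \<omega> n)))"
      by (intro pred_intros_logic 1 2 3 4)
    moreover have "run \<omega> n = Returned n (state_current (run \<omega> n)) \<and>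
        second_order_stationary d f \<rho> \<epsilon> (state_current (run \<omega> n)) \<longleftrightarrow>
      \<not> state_running (run \<omega> n) \<and> state_passes (run \<omega> n) = n \<and>
        vnorm (grad d f (state_current (run \<omega> n))) \<le> \<epsilon> \<and> \<not> saddle (state_current (run \<omega> n))" for \<omega>
    proof -
      have "run \<omega> n = Returned n (state_current (run \<omega> n)) \<longleftrightarrow> \<not> state_running (run \<omega> n) \<and> state_passes (run \<omega> n) = n"
        by (cases "run \<omega> n") auto
      then show ?thesis using cc[of \<omega>] unfolding second_order_stationary_def not_saddle_iff by auto
    qed
    ultimately show ?thesis by (simp add: pred_def space_noise_space)
  qed
  then have "(\<Union>n\<in>{n. real n \<le> K}. {\<omega>. run \<omega> n = Returned n (state_current (run \<omega> n)) \<and>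
      second_order_stationary d f \<rho> \<epsilon> (state_current (run \<omega> n))}) \<in> sets noise_space"
    by (intro sets.countable_UN') auto
  moreover have "(\<Union>n\<in>{n. real n \<le> K}. {\<omega>. run \<omega> n = Returned n (state_current (run \<omega> n)) \<and>
      second_order_stationary d f \<rho> \<epsilon> (state_current (run \<omega> n))})
    = {\<omega>. \<exists>n y. run \<omega> n = Returned n y \<and> second_order_stationary d f \<rho> \<epsilon> y \<and> real n \<le> K}"
    by (auto; metis state_current.simps(2))
  ultimately show ?thesis by simp
qed

lemma g0_le_\<epsilon>: "g0 \<le> \<epsilon>"
proof -
  have "sqrt c \<le> 1" using c_small by simp
  also have "1 \<le> \<chi>\<^sup>2" using chi_ge by (simp add: one_le_power)
  finally have "\<epsilon> * sqrt c \<le> \<epsilon> * \<chi>\<^sup>2" using \<epsilon>_pos by (intro mult_left_mono) auto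
  then show ?thesis unfolding g_thres_def using pos by (simp add: pos_divide_le_eq)
qed

lemma success_probability:
  assumes K: "gap / \<kappa> + real_of_int T + 1 \<le> K"
  shows "1 - \<delta> \<le> measure noise_space
    {\<omega>. \<exists>n y. run \<omega> n = Returned n y \<and> second_order_stationary d f \<rho> \<epsilon> y \<and> real n \<le> K}"
    (is "_ \<le> measure _ ?G")
proof -
  interpret prob_space noise_space by (rule prob_space_noise)
  \<comment> \<open>A horizon by which every run has returned, so finitely many possible failures
    cover everything; the 1 makes the inequality strict.\<close>
  define n0 where "n0 = nat \<lceil>gap / \<kappa> + real_of_int T\<rceil> + 1"
  define A where "A = (\<Union>t<n0. {\<omega>. failure t \<omega>})"
  have n0: "real n0 > gap / \<kappa> + real_of_int T" unfolding n0_def by linarith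
  have Am: "A \<in> sets noise_space" unfolding A_def using failure_event by auto
  have sub: "space noise_space - A \<subseteq> ?G"
  proof
    fix \<omega> assume \<omega>: "\<omega> \<in> space noise_space - A"
    obtain m y where m: "m \<le> n0" "run \<omega> m = Returned m y" using run_terminates[OF n0] by blast
    obtain t where t: "noisy \<omega> t" "t < m" "y = base \<omega> t" "y \<in> carrier_vec d"
      "real m \<le> gap / \<kappa> + real_of_int T + 1" "f ((gdv ^^ nat T) (perturbed \<omega> t)) - f y > - F"
      using returned_stuck[OF m(2)] by blast
    have "\<not> failure t \<omega>" using \<omega> t m unfolding A_def by auto
    then have "\<not> saddle y" using t unfolding failure_def stuck_def by auto
    moreover have "vnorm (grad d f y) \<le> \<epsilon>" using t g0_le_\<epsilon> unfolding noisy_def base_def by simp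
    ultimately have "second_order_stationary d f \<rho> \<epsilon> y"
      using t unfolding second_order_stationary_def not_saddle_iff by simp
    then show "\<omega> \<in> ?G" using m t K by fastforce
  qed
  have "1 - \<delta> \<le> 1 - measure noise_space A" using prob_some_failure_le[of n0] unfolding A_def by simp
  also have "\<dots> = measure noise_space (space noise_space - A)" using Am by (simp add: prob_compl)
  also have "\<dots> \<le> measure noise_space ?G" using sub success_event by (intro finite_measure_mono) auto
  finally show ?thesis .
qed

section \<open>The iteration bound\<close>

text \<open>972 is 4 * 243: the 4 is the one in \<open>\<kappa>\<close>, and 243 is
  \<open>3 ^ 4\<close> from the factor 3 in \<open>\<chi>\<close>, times a 3 that bounds
  \<open>exp 1\<close>. The 5 dominates the floor 4 in \<open>\<chi>\<close>,
  \<open>ln (1 / c)\<close> accounts for the \<open>c\<close> inside its logarithm, and the final 2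
  pays for \<open>T + 1\<close>.\<close>

definition bound_constant :: real where
  "bound_constant = 972 * (5 + ln (1 / c)) ^ 4 / c ^ 3 + 2"

text \<open>If the logarithm \<open>L\<close> is at least 1, then \<open>\<chi>\<close> is at most a
  multiple of it. Otherwise \<open>\<chi>\<close> is bounded in terms of \<open>c\<close> alone and
  \<open>gap / \<kappa>\<close> by a constant depending on \<open>c\<close>, which the
  \<open>T\<close> in the maximum absorbs even when the iteration bound is 0.\<close>

lemma passes_le:
  assumes \<delta>: "\<delta> < 1"
  shows "gap / \<kappa> + real_of_int T + 1 \<le> bound_constant * max (iteration_bound d f x0 l \<epsilon> \<delta> \<Delta>f) (real_of_int T)"
proof -
  define z where "z = real d * l * \<Delta>f / (\<epsilon>\<^sup>2 * \<delta>)"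
  define L where "L = ln z"
  define k where "k = 5 + ln (1 / c)"
  define G where "G = l * gap / \<epsilon>\<^sup>2"
  define M where "M = max (iteration_bound d f x0 l \<epsilon> \<delta> \<Delta>f) (real_of_int T)"
  have lnc: "ln (1 / c) \<ge> 0" using c_pos c_small by (intro ln_ge_zero) simp
  have k: "k \<ge> 5" unfolding k_def using lnc by simp
  have G: "G \<ge> 0" unfolding G_def using gap_nonneg l_pos by simp
  have \<Delta>: "\<Delta>f \<ge> 0" using \<Delta>f_ge gap_nonneg by linarith
  have z0: "z \<ge> 0" unfolding z_def using \<Delta> l_pos \<delta>_pos by simp
  have chi: "\<chi> = 3 * max (ln (z / c)) 4" unfolding chi_def z_def by (simp add: mult_ac)
  have lnz: "ln (z / c) = L + ln (1 / c)" if "z > 0"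
    unfolding L_def using that c_pos by (simp add: ln_div)
  have IB: "iteration_bound d f x0 l \<epsilon> \<delta> \<Delta>f = G * L ^ 4"
    unfolding iteration_bound_def G_def L_def z_def by simp
  have T1: "real_of_int T \<ge> 1" using T_bounds by simp
  have "\<chi> ^ 4 * G \<le> 243 * k ^ 4 * M"
  proof (cases "L \<ge> 1")
    case True
    have "z > 0"
    proof (rule ccontr)
      assume "\<not> z > 0"
      then have "z = 0" using z0 by simp
      then show False using True unfolding L_def by simp
    qed
    have "ln (1 / c) * 1 \<le> ln (1 / c) * L" using True lnc by (intro mult_left_mono)
    then have "ln (z / c) \<le> k * L" using lnz[OF \<open>z > 0\<close>] True unfolding k_def by (simp add: algebra_simps)
    moreover have "5 * 1 \<le> k * L" using k True by (intro mult_mono) auto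
    ultimately have "\<chi> \<le> 3 * (k * L)" unfolding chi by simp
    then have "\<chi> ^ 4 \<le> (3 * (k * L)) ^ 4" using pos by (intro power_mono) auto
    then have "\<chi> ^ 4 * G \<le> (3 * (k * L)) ^ 4 * G" using G by (intro mult_right_mono)
    also have "\<dots> = 81 * k ^ 4 * (G * L ^ 4)" by (simp add: power_mult_distrib)
    also have "\<dots> \<le> 81 * k ^ 4 * M" unfolding M_def IB by (intro mult_left_mono) auto
    also have "\<dots> \<le> 243 * k ^ 4 * M" using k T1 unfolding M_def by (intro mult_right_mono) auto
    finally show ?thesis .
  next
    case False
    have "ln (z / c) \<le> k"
    proof (cases "z > 0")
      case True
      then show ?thesis using lnz False unfolding k_def by simp
    next
      case False
      \<comment> \<open>In this case \<open>ln (z / c)\<close> is \<open>ln 0\<close>, which is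
        0.\<close>
      then have "z = 0" using z0 by simp
      then show ?thesis using k by simp
    qed
    then have "\<chi> \<le> 3 * k" unfolding chi using k by simp
    then have 1: "\<chi> ^ 4 \<le> (3 * k) ^ 4" using pos by (intro power_mono) auto
    have "z \<le> exp 1"
    proof (cases "z > 0")
      case True
      then show ?thesis using False unfolding L_def by (metis exp_ln exp_le_cancel_iff linear)
    next
      case False
      then show ?thesis using exp_gt_zero[of 1] by linarith
    qed
    then have z3: "z \<le> 3" using exp_le by linarith
    \<comment> \<open>By \<open>d \<ge> 1\<close> and \<open>\<delta> < 1\<close> the argument of
      the logarithm is at least \<open>G\<close>, so a small logarithm forces \<open>G\<close> to be
      small as well.\<close>
    have "G \<le> z"
    proof -
      have "l * gap * (1 * \<delta>) \<le> l * \<Delta>f * (real d * 1)"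
        using \<Delta>f_ge l_pos \<delta>_pos \<delta> d_pos gap_nonneg by (intro mult_mono) auto
      then have "l * gap * (1 * \<delta>) / (\<epsilon>\<^sup>2 * \<delta>) \<le> l * \<Delta>f * (real d * 1) / (\<epsilon>\<^sup>2 * \<delta>)"
        using \<delta>_pos by (intro divide_right_mono) auto
      moreover have "G = l * gap * (1 * \<delta>) / (\<epsilon>\<^sup>2 * \<delta>)" unfolding G_def using \<delta>_pos by simp
      moreover have "z = l * \<Delta>f * (real d * 1) / (\<epsilon>\<^sup>2 * \<delta>)" unfolding z_def by (simp add: mult_ac)
      ultimately show ?thesis by simp
    qed
    then have "\<chi> ^ 4 * G \<le> (3 * k) ^ 4 * 3" using 1 z3 G k by (intro mult_mono) auto
    also have "\<dots> = 243 * k ^ 4 * 1" by (simp add: power_mult_distrib)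
    also have "\<dots> \<le> 243 * k ^ 4 * M" using T1 k unfolding M_def by (intro mult_left_mono) auto
    finally show ?thesis .
  qed
  then have "4 / c ^ 3 * (\<chi> ^ 4 * G) \<le> 4 / c ^ 3 * (243 * k ^ 4 * M)"
    using c_pos by (intro mult_left_mono) auto
  moreover have "gap / \<kappa> = 4 / c ^ 3 * (\<chi> ^ 4 * G)"
    unfolding \<kappa>_def G_def by simp
  moreover have "real_of_int T + 1 \<le> 2 * M" using T1 unfolding M_def by linarith
  ultimately have "gap / \<kappa> + real_of_int T + 1 \<le> 4 / c ^ 3 * (243 * k ^ 4 * M) + 2 * M" by linarith
  also have "\<dots> = bound_constant * M" unfolding bound_constant_def k_def by (simp add: algebra_simps)
  finally show ?thesis unfolding M_def .
qed

end

theorem theorem3p2: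
  "\<exists>c_max>0. \<forall>c. 0 < c \<and> c \<le> c_max \<longrightarrow> (\<exists>C>0.
     \<forall>(d::nat) (f :: real vec \<Rightarrow> real) (w :: nat \<Rightarrow> real) l \<rho> x0 \<delta> \<epsilon> \<Delta>f.
       d \<ge> 1 \<and> l > 0 \<and> \<rho> > 0 \<and>
       gradient_Lipschitz d l f \<and> hessian_Lipschitz d \<rho> f \<and> has_minimum d f \<and>
       (\<forall>n. w n > 0) \<and> mono w \<and> x0 \<in> carrier_vec d \<and>
       \<delta> > 0 \<and> \<epsilon> > 0 \<and> \<epsilon> \<le> l\<^sup>2 / \<rho> \<and> \<Delta>f \<ge> f x0 - fstar d f \<longrightarrow>
       \<P>(\<omega> in noise_space. \<exists>n y.
           pgdot_returns d f w x0 l \<rho> \<epsilon> c \<delta> \<Delta>f \<omega> n y \<and>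
           second_order_stationary d f \<rho> \<epsilon> y \<and>
           real n \<le> C * max (iteration_bound d f x0 l \<epsilon> \<delta> \<Delta>f)
                             (real_of_int (t_thres d l \<rho> \<epsilon> c \<delta> \<Delta>f)))
         \<ge> 1 - \<delta>)"
proof (rule exI[of _ "1 / 100000"], rule conjI, simp, intro allI impI, goal_cases)
  case (1 c)
  \<comment> \<open>The unfolded \<open>bound_constant\<close>; it depends on \<open>c\<close> alone
    and so can be chosen before the dimension, the function and the other parameters.\<close>
  let ?C = "972 * (5 + ln (1 / c)) ^ 4 / c ^ 3 + 2"
  have "ln (1 / c) \<ge> 0" using 1 by (intro ln_ge_zero) simp
  then have C: "?C > 0" using 1 by (intro add_nonneg_pos divide_nonneg_pos) auto
  show ?case
  proof (rule exI[of _ ?C], rule conjI, rule C, intro allI impI, goal_cases)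
    case (1 d f w l \<rho> x0 \<delta> \<epsilon> \<Delta>f)
    show ?case
    \<comment> \<open>For \<open>\<delta> \<ge> 1\<close> the claimed lower bound is not
      positive.\<close>
    proof (cases "\<delta> < 1")
      case True
      interpret pgdot d f w x0 l \<rho> \<epsilon> c \<delta> \<Delta>f "sqrt (\<rho> * \<epsilon>)"
        using 1 \<open>0 < c \<and> c \<le> 1 / 100000\<close> by unfold_locales auto
      show ?thesis
        using success_probability[OF passes_le[OF True]]
        unfolding pgdot_returns_def bound_constant_def space_noise_space by simp
    next
      case False
      then show ?thesis by (smt (verit) measure_nonneg)
    qed
  qed
qed

end
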